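(* Let $f(n)$ be a function of an integer argument such that $f(n)\ge\log n$ for all $n$. Then there exists a number $\theta>0$ such that for every tuple of binary strings $(a,b,c,d,e)$: ($\mathcal I4$-Kolm) if $\mathrm I(a:d|c)\le f(n)$ and $\mathrm I(a:c|d)\le f(n)$, then $$\square_{ab,cd}+\mathrm I(a:c|e)+\mathrm I(a:e|c)+\theta\cdot\sqrt{n\cdot f(n)}\ge 0;$$ ($\mathcal I5$-Kolm) if $\mathrm I(b:c|d)\le f(n)$ and $\mathrm I(c:d|b)\le f(n)$, then $$\square_{ab,cd}+\mathrm I(b:c|e)+\mathrm I(c:e|b)+\theta\cdot\sqrt{n\cdot f(n)}\ge 0;$$ ($\mathcal I6$-Kolm) if $\mathrm I(b:c|d)\le f(n)$ and $\mathrm I(c:d|b)\le f(n)$, then $$\square_{ab,cd}+\mathrm I(c:d|e)+\mathrm I(c:e|d)+\theta\cdot\sqrt{n\cdot f(n)}\ge 0;$$ where $n$ is the sum of the lengths of the strings $a,b,c,d,e$.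
   Context: Kolmogorov complexity: a programming language is a partial computable function $\mathcal L:\{0,1\}^*\times\{0,1\}^*\to\{0,1\}^*$ (program, input $\mapsto$ output), and $\mathrm C_{\mathcal L}(x|y)=\min\{|p|:\mathcal L(p,y)=x\}$. Fix a universal language $\mathcal U$, i.e. one such that for every $\mathcal L$ one has $\mathrm C_{\mathcal U}(x|y)\le \mathrm C_{\mathcal L}(x|y)+O(1)$ for all $x,y$ (the $O(1)$ depending on $\mathcal L$ but not on $x,y$); write $\mathrm C(x|y)=\mathrm C_{\mathcal U}(x|y)$ and $\mathrm C(x)$ for the complexity of $x$ given the empty string. The complexity of a tuple of strings is the complexity of its code under a fixed computable bijection between finite tuples of binary strings and binary strings. Define $\mathrm I(x:y):=\mathrm C(x)+\mathrm C(y)-\mathrm C(x,y)$ and $\mathrm I(x:y|z):=\mathrm C(x,z)+\mathrm C(y,z)-\mathrm C(x,y,z)-\mathrm C(z)$, and $\square_{ab,cd}:=\mathrm I(c:d|a)+\mathrm I(c:d|b)+\mathrm I(a:b)-\mathrm I(c:d)$.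
   Formalization: The formal statement requires n·f(n) > 0, excluding only n = 0, and n = 1 when f(1) = 0, where the error term vanishes and the exact inequality fails for some universal languages; also f(n) ≥ log n is assumed only for n ≥ 1. *)

theory Defs
  imports Complex_Main "HOL-Library.Extended_Nat" "HOL-Library.Nat_Bijection"
begin

datatype recf =
    Zero
  | Succ
  | Proj nat
  | Comp recf "recf list"
  | PrimRec recf recf
  | Mu recf

text \<open>\<open>computes r xs y\<close>: the \<open>\<mu>\<close>-recursive program \<open>r\<close> halts on the arguments \<open>xs\<close> with
  value \<open>y\<close>. A program that gets stuck, for instance on the wrong number of arguments, has no value.\<close>

inductive computes :: "recf \<Rightarrow> nat list \<Rightarrow> nat \<Rightarrow> bool" where
  Zero: "computes Zero xs 0"
| Succ: "computes Succ [x] (Suc x)"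
| Proj: "i < length xs \<Longrightarrow> computes (Proj i) xs (xs ! i)"
| Comp: "list_all2 (\<lambda>g y. computes g xs y) gs ys \<Longrightarrow> computes r ys z \<Longrightarrow> computes (Comp r gs) xs z"
| PrimRec_0: "computes g xs y \<Longrightarrow> computes (PrimRec g h) (0 # xs) y"
| PrimRec_Suc: "computes (PrimRec g h) (m # xs) y \<Longrightarrow> computes h (m # y # xs) z
    \<Longrightarrow> computes (PrimRec g h) (Suc m # xs) z"
| Mu: "computes r (m # xs) 0 \<Longrightarrow> (\<forall>i<m. \<exists>y. computes r (i # xs) (Suc y)) \<Longrightarrow> computes (Mu r) xs m"

text \<open>Binary strings are identified with natural numbers by bijective base-2 numeration
  (digits 1 and 2, least significant digit first).\<close>

fun string_nat :: "bool list \<Rightarrow> nat" where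
  "string_nat [] = 0"
| "string_nat (b # bs) = 2 * string_nat bs + (if b then 2 else 1)"

lemma bij_string_nat: "bij string_nat"
proof (rule bijI)
  show "inj string_nat"
  proof (rule injI)
    fix x y show "string_nat x = string_nat y \<Longrightarrow> x = y"
    proof (induction x arbitrary: y)
      case Nil
      then show ?case by (cases y) (auto split: if_splits)
    next
      case (Cons b bs)
      then obtain b' bs' where y: "y = b' # bs'" by (cases y) (auto split: if_splits)
      have "b = b' \<and> string_nat bs = string_nat bs'"
        using Cons.prems unfolding y by (cases b; cases b'; simp; presburger)
      then show ?case using Cons.IH y by blast
    qed
  qed
  have "\<exists>x. string_nat x = m" for m
  proof (induction m rule: less_induct)
    case (less m)
    show ?case
    proof (cases "m = 0")
      case True
      then have "string_nat [] = m" by simp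
      then show ?thesis by blast
    next
      case False
      then obtain x where x: "string_nat x = (m - 1) div 2"
        using less.IH[of "(m - 1) div 2"] by (metis False div_le_dividend diff_less le_less_trans neq0_conv zero_less_one)
      have "string_nat (even m # x) = m"
        using x False by simp presburger
      then show ?thesis by blast
    qed
  qed
  then show "surj string_nat" by (metis surjI)
qed

text \<open>A language maps a program and an input to an output; \<open>None\<close> means undefined.\<close>

type_synonym language = "bool list \<Rightarrow> bool list \<Rightarrow> bool list option"

definition partial_computable :: "language \<Rightarrow> bool" where
  "partial_computable L \<longleftrightarrow>
     (\<exists>r. \<forall>p y x. L p y = Some x \<longleftrightarrow> computes r [string_nat p, string_nat y] (string_nat x))"

text \<open>The infimum of the empty set is \<open>\<infinity>\<close>.\<close>

definition cond_complexity :: "language \<Rightarrow> bool list \<Rightarrow> bool list \<Rightarrow> enat" where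
  "cond_complexity L x y = (INF p \<in> {p. L p y = Some x}. enat (length p))"

definition universal :: "language \<Rightarrow> bool" where
  "universal U \<longleftrightarrow> partial_computable U \<and>
     (\<forall>L. partial_computable L \<longrightarrow>
       (\<exists>k::nat. \<forall>x y. cond_complexity U x y \<le> cond_complexity L x y + enat k))"

text \<open>Hence the conversion to a real number in \<open>complexity\<close> below loses nothing.\<close>

lemma universal_cond_complexity_finite:
  assumes "universal U"
  shows "cond_complexity U x y \<noteq> \<infinity>"
proof -
  let ?L = "\<lambda>p y. Some p"
  have eq: "computes (Proj 0) [i, j] m \<longleftrightarrow> m = i" for i j m
    by (auto elim: computes.cases intro: computes.Proj[of 0 "[i, j]", simplified])
  have "partial_computable ?L"
    unfolding partial_computable_def
    by (rule exI[of _ "Proj 0"]) (auto simp: eq inj_eq[OF bij_is_inj[OF bij_string_nat]])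
  then obtain k :: nat where "cond_complexity U x y \<le> cond_complexity ?L x y + enat k"
    using assms unfolding universal_def by blast
  moreover have "cond_complexity ?L x y = enat (length x)"
    by (simp add: cond_complexity_def)
  ultimately show ?thesis by (metis enat_ord_code(5) plus_enat_simps(1))
qed

definition complexity :: "language \<Rightarrow> bool list \<Rightarrow> real" where
  "complexity U x = real (the_enat (cond_complexity U x []))"

text \<open>Computability of \<open>code\<close> refers to the standard numbering of finite sequences of natural numbers;
  the inverse of \<open>code\<close> is then computable too, by exhaustive search.\<close>

definition tuple_code :: "(bool list list \<Rightarrow> bool list) \<Rightarrow> bool" where
  "tuple_code code \<longleftrightarrow> bij code \<and>
     (\<exists>r. \<forall>xs. computes r [list_encode (map string_nat xs)] (string_nat (code xs)))"

definition mutual_info ::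
    "language \<Rightarrow> (bool list list \<Rightarrow> bool list) \<Rightarrow> bool list \<Rightarrow> bool list \<Rightarrow> real" where
  "mutual_info U code x y = complexity U x + complexity U y - complexity U (code [x, y])"

definition cond_mutual_info ::
    "language \<Rightarrow> (bool list list \<Rightarrow> bool list) \<Rightarrow> bool list \<Rightarrow> bool list \<Rightarrow> bool list \<Rightarrow> real" where
  "cond_mutual_info U code x y z =
     complexity U (code [x, z]) + complexity U (code [y, z])
       - complexity U (code [x, y, z]) - complexity U z"

definition ingleton_box ::
    "language \<Rightarrow> (bool list list \<Rightarrow> bool list) \<Rightarrow>
     bool list \<Rightarrow> bool list \<Rightarrow> bool list \<Rightarrow> bool list \<Rightarrow> real" where
  "ingleton_box U code a b c d =
     cond_mutual_info U code c d a + cond_mutual_info U code c d b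
       + mutual_info U code a b - mutual_info U code c d"

end

(*
  Given strings (a,b,c,d,e) of total length n, an effective greedy selection produces a finite set of
  5-tuples such that for the uniform distribution on it all joint entropies agree with the Kolmogorov
  complexities of the corresponding tuples of strings up to O(log n). Entropies satisfy the
  inequalities of Matus

    s (box + I(a:c|e) + I(a:e|c)) + I(c:e|a) + s(s-1)/2 (I(a:d|c) + I(a:c|d)) >= 0

  for all s >= 0, and two analogous families, by induction on s with a conditionally independent copy
  of e in each step. If the two terms in the last bracket are at most f(n), division by s leaves an
  error O(n/s + s f(n)) besides the logarithmic terms, and s = sqrt(n/f(n)) balances it.
*)
theory Submission
  imports Defs
begin

section \<open>Recursive functions\<close>

text \<open>Copies of a variable have no counterpart for strings, which forces the detour through
  entropy. One random vector serves every \<open>s\<close>, so the transfer error enters each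
  quantity independently of \<open>s\<close>; only joint entropies of at most three of the five
  variables have to match complexities, the larger ones stay inside the entropy argument. The
  obvious set of tuples, those whose subtuples are no more complex than the given ones, has few
  enough values but may have oversized fibres, and then the lower bounds on entropy fail. Capping
  each fibre at its expected size repairs this. The price is to show that the given tuple is not
  crowded out: a value with a full fibre is one of few, and its rank among them describes it too
  cheaply. This argument needs the selection to be carried out by a program, hence the bounded
  evaluator, the closure properties of recursive functions and the explicit bit encodings. The
  hypothesis on \<open>f\<close> enters only to absorb logarithms; the factor lost there is 2 except
  at \<open>n = 1\<close>, where it depends on \<open>f 1\<close>.\<close>

text \<open>The value \<open>0\<close> means that no result was found within the bound \<open>t\<close>, \<open>Suc y\<close> that the result is
  \<open>y\<close>. The bound restricts the range of the \<open>\<mu>\<close>-searches only.\<close>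

fun eval_steps :: "recf \<Rightarrow> nat \<Rightarrow> nat list \<Rightarrow> nat" where
  "eval_steps Zero t xs = 1"
| "eval_steps Succ t xs = (if length xs = 1 then Suc (Suc (hd xs)) else 0)"
| "eval_steps (Proj i) t xs = (if i < length xs then Suc (xs ! i) else 0)"
| "eval_steps (Comp r gs) t xs =
     (if \<exists>g\<in>set gs. eval_steps g t xs = 0 then 0
      else eval_steps r t (map (\<lambda>g. eval_steps g t xs - 1) gs))"
| "eval_steps (PrimRec g h) t xs =
     (if length xs = 0 then 0
      else rec_nat (eval_steps g t (tl xs))
             (\<lambda>i y. if y = 0 then 0 else eval_steps h t (i # (y - 1) # tl xs)) (hd xs))"
| "eval_steps (Mu r) t xs =
     (\<Sum>m<t. if eval_steps r t (m # xs) = 1 \<and> (\<forall>i<m. 2 \<le> eval_steps r t (i # xs)) then Suc m else 0)"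

text \<open>At most one summand is nonzero, since the least zero is unique. The sum thus encodes a
  bounded search in a form to which closure under bounded sums applies.\<close>

lemma eval_steps_Mu_eq:
  "eval_steps (Mu r) t xs = Suc m \<longleftrightarrow>
     m < t \<and> eval_steps r t (m # xs) = 1 \<and> (\<forall>i<m. 2 \<le> eval_steps r t (i # xs))"
proof -
  let ?P = "\<lambda>m. eval_steps r t (m # xs) = 1 \<and> (\<forall>i<m. 2 \<le> eval_steps r t (i # xs))"
  have uniq: "?P m \<Longrightarrow> ?P m' \<Longrightarrow> m = m'" for m m'
    by (metis One_nat_def Suc_1 Suc_n_not_le_n linorder_neqE_nat)
  show ?thesis
  proof (cases "\<exists>k<t. ?P k")
    case True
    then obtain k where k: "k < t" "?P k" by blast
    have "eval_steps (Mu r) t xs = (\<Sum>i<t. if i = k then Suc k else 0)"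
      unfolding eval_steps.simps by (rule sum.cong[OF refl]) (use uniq k in \<open>metis (full_types)\<close>)
    also have "\<dots> = Suc k" using k by simp
    finally show ?thesis using k uniq by (metis Suc_inject)
  next
    case False
    then have "eval_steps (Mu r) t xs = 0" by auto
    then show ?thesis using False by (metis Zero_neq_Suc)
  qed
qed

text \<open>A value once found is never revised. For \<open>Mu\<close>, the zero at \<open>y\<close>
  and the positive values below it persist under a larger bound, so the search still stops at
  \<open>y\<close>.\<close>

lemma eval_steps_mono:
  "eval_steps r t xs = Suc y \<Longrightarrow> t \<le> t' \<Longrightarrow> eval_steps r t' xs = Suc y"
proof (induction r arbitrary: xs y)
  case (Comp r gs)
  have nz: "\<forall>g\<in>set gs. eval_steps g t xs \<noteq> 0"
    and r: "eval_steps r t (map (\<lambda>g. eval_steps g t xs - 1) gs) = Suc y"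
    using Comp.prems(1) by (auto split: if_splits)
  have eq: "eval_steps g t' xs = eval_steps g t xs" if "g \<in> set gs" for g
    using nz that Comp.IH(2)[OF that _ Comp.prems(2), of xs] by (metis not0_implies_Suc)
  then have m: "map (\<lambda>g. eval_steps g t' xs - 1) gs = map (\<lambda>g. eval_steps g t xs - 1) gs"
    by simp
  show ?case unfolding eval_steps.simps m using nz eq Comp.IH(1)[OF r Comp.prems(2)] by auto
next
  case (PrimRec g h)
  have ne: "xs \<noteq> []" using PrimRec.prems(1) by (auto split: if_splits)
  let ?R = "\<lambda>t m. rec_nat (eval_steps g t (tl xs))
             (\<lambda>i y. if y = 0 then 0 else eval_steps h t (i # (y - 1) # tl xs)) m"
  have "?R t m = Suc z \<Longrightarrow> ?R t' m = Suc z" for m z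
  proof (induction m arbitrary: z)
    case 0
    then show ?case using PrimRec.IH(1) PrimRec.prems(2) by simp
  next
    case (Suc m)
    then obtain u where u: "?R t m = Suc u" by (cases "?R t m") auto
    have "?R t' m = Suc u" by (rule Suc.IH[OF u])
    moreover have "eval_steps h t (m # u # tl xs) = Suc z" using Suc.prems u by simp
    ultimately show ?case using PrimRec.IH(2) PrimRec.prems(2) by simp
  qed
  then show ?case using PrimRec.prems(1) ne by simp
next
  case (Mu r)
  have *: "y < t" "eval_steps r t (y # xs) = 1" "\<forall>i<y. 2 \<le> eval_steps r t (i # xs)"
    using Mu.prems(1) eval_steps_Mu_eq by auto
  have 1: "eval_steps r t' (y # xs) = 1"
    using Mu.IH[of "y # xs" 0] *(2) Mu.prems(2) by simp
  have 2: "2 \<le> eval_steps r t' (i # xs)" if "i < y" for i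
  proof -
    have "2 \<le> eval_steps r t (i # xs)" using *(3) that by blast
    then obtain u where u: "eval_steps r t (i # xs) = Suc u" by (cases "eval_steps r t (i # xs)") auto
    then show ?thesis using Mu.IH[OF u Mu.prems(2)] \<open>2 \<le> eval_steps r t (i # xs)\<close> by simp
  qed
  show ?case using 1 2 *(1) Mu.prems(2) eval_steps_Mu_eq by auto
qed auto

lemma eval_steps_sound: "eval_steps r t xs = Suc y \<Longrightarrow> computes r xs y"
proof (induction r arbitrary: xs y)
  case Zero
  then show ?case by (simp add: computes.Zero)
next
  case Succ
  then have "xs = [hd xs]" by (cases xs) (auto split: if_splits)
  then show ?case using Succ by (metis computes.Succ eval_steps.simps(2) nat.simps(1) Zero_neq_Suc)
next
  case (Proj i)
  then show ?case using computes.Proj by (auto split: if_splits)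
next
  case (Comp r gs)
  have nz: "\<forall>g\<in>set gs. eval_steps g t xs \<noteq> 0"
    and r: "eval_steps r t (map (\<lambda>g. eval_steps g t xs - 1) gs) = Suc y"
    using Comp.prems(1) by (auto split: if_splits)
  have "list_all2 (\<lambda>g y. computes g xs y) gs (map (\<lambda>g. eval_steps g t xs - 1) gs)"
    using nz Comp.IH(2) by (auto simp: list_all2_map2 intro!: list.rel_refl_strong)
  then show ?case using Comp.IH(1)[OF r] by (rule computes.Comp)
next
  case (PrimRec g h)
  have ne: "xs \<noteq> []" using PrimRec.prems(1) by (auto split: if_splits)
  let ?R = "rec_nat (eval_steps g t (tl xs))
             (\<lambda>i y. if y = 0 then 0 else eval_steps h t (i # (y - 1) # tl xs))"
  have "?R m = Suc z \<Longrightarrow> computes (PrimRec g h) (m # tl xs) z" for m z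
  proof (induction m arbitrary: z)
    case 0
    then show ?case using PrimRec.IH(1) by (auto intro: computes.PrimRec_0)
  next
    case (Suc m)
    then obtain u where u: "?R m = Suc u" by (cases "?R m") auto
    moreover have "eval_steps h t (m # u # tl xs) = Suc z" using Suc.prems u by simp
    ultimately show ?case using Suc.IH PrimRec.IH(2) by (blast intro: computes.PrimRec_Suc)
  qed
  from this[of "hd xs" y] show ?case using PrimRec.prems(1) ne by simp
next
  case (Mu r)
  have *: "eval_steps r t (y # xs) = 1" "\<forall>i<y. 2 \<le> eval_steps r t (i # xs)"
    using Mu.prems(1) eval_steps_Mu_eq by auto
  have "\<exists>z. computes r (i # xs) (Suc z)" if "i < y" for i
  proof -
    have "2 \<le> eval_steps r t (i # xs)" using *(2) that by blast
    then obtain u where "eval_steps r t (i # xs) = 2 + u" using le_Suc_ex by blast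
    then have "eval_steps r t (i # xs) = Suc (Suc u)" by simp
    then show ?thesis using Mu.IH by blast
  qed
  then show ?case using *(1) Mu.IH by (auto intro: computes.Mu)
qed

text \<open>The maximum of finitely many witnesses. It serves for evaluation bounds and equally,
  with \<open>t\<close> read as an additive constant, for merging the constants of finitely many
  complexity estimates.\<close>

lemma bounded_stages:
  fixes Q :: "nat \<Rightarrow> nat \<Rightarrow> bool"
  assumes "\<forall>i<n. \<exists>t. Q i t" and "\<And>i t t'. Q i t \<Longrightarrow> t \<le> t' \<Longrightarrow> Q i t'"
  shows "\<exists>t. \<forall>i<n. Q i t"
proof -
  obtain T where T: "\<forall>i<n. Q i (T i)" using assms(1) by metis
  have "Q i (Max (T ` {..<n}))" if "i < n" for i
    using assms(2)[OF T[rule_format, OF that]] that by (simp add: Max_ge)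
  then show ?thesis by blast
qed

lemma eval_steps_complete: "computes r xs y \<Longrightarrow> \<exists>t. eval_steps r t xs = Suc y"
proof (induction rule: computes.induct)
  case (Comp xs gs ys r z)
  have len: "length gs = length ys" using Comp.IH(1) by (simp add: list_all2_lengthD)
  from Comp.IH(1) have "\<forall>i<length gs. \<exists>t. eval_steps (gs ! i) t xs = Suc (ys ! i)"
    by (simp add: list_all2_conv_all_nth)
  then obtain t1 where t1: "\<forall>i<length gs. eval_steps (gs ! i) t1 xs = Suc (ys ! i)"
    using bounded_stages[of "length gs" "\<lambda>i t. eval_steps (gs ! i) t xs = Suc (ys ! i)"] eval_steps_mono
    by blast
  obtain t2 where t2: "eval_steps r t2 ys = Suc z" using Comp.IH(2) by blast
  let ?t = "max t1 t2"
  have e: "\<forall>i<length gs. eval_steps (gs ! i) ?t xs = Suc (ys ! i)"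
    using t1 eval_steps_mono[of _ t1 xs _ ?t] by simp
  then have "map (\<lambda>g. eval_steps g ?t xs - 1) gs = ys"
    using len by (auto intro: nth_equalityI)
  moreover have "\<not> (\<exists>g\<in>set gs. eval_steps g ?t xs = 0)"
    using e by (metis in_set_conv_nth Zero_neq_Suc)
  moreover have "eval_steps r ?t ys = Suc z" using eval_steps_mono[OF t2, of ?t] by simp
  ultimately have "eval_steps (Comp r gs) ?t xs = Suc z" by simp
  then show ?case by blast
next
  case (PrimRec_0 g xs y h)
  then obtain t where "eval_steps g t xs = Suc y" by blast
  then have "eval_steps (PrimRec g h) t (0 # xs) = Suc y" by simp
  then show ?case by blast
next
  case (PrimRec_Suc g h m xs y z)
  then obtain t1 t2 where t: "eval_steps (PrimRec g h) t1 (m # xs) = Suc y"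
    "eval_steps h t2 (m # y # xs) = Suc z" by blast
  let ?t = "max t1 t2"
  have 1: "eval_steps (PrimRec g h) ?t (m # xs) = Suc y" using eval_steps_mono[OF t(1), of ?t] by simp
  have 2: "eval_steps h ?t (m # y # xs) = Suc z" using eval_steps_mono[OF t(2), of ?t] by simp
  have "eval_steps (PrimRec g h) ?t (Suc m # xs) = Suc z" using 1 2 by (simp cong: if_cong)
  then show ?case by blast
next
  case (Mu r m xs)
  then obtain t1 where t1: "eval_steps r t1 (m # xs) = 1" by auto
  have mono: "2 \<le> eval_steps r t' (i # xs)" if ge: "2 \<le> eval_steps r t (i # xs)" and le: "t \<le> t'" for i t t'
  proof -
    obtain u where u: "eval_steps r t (i # xs) = Suc u"
      using ge by (cases "eval_steps r t (i # xs)") auto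
    show ?thesis using eval_steps_mono[OF u le] ge u by simp
  qed
  have "\<exists>t. 2 \<le> eval_steps r t (i # xs)" if im: "i < m" for i
  proof -
    obtain z t where "eval_steps r t (i # xs) = Suc (Suc z)" using Mu.IH(2) im by blast
    then show ?thesis by (intro exI[of _ t]) simp
  qed
  then have "\<forall>i<m. \<exists>t. 2 \<le> eval_steps r t (i # xs)" by blast
  then obtain t2 where t2: "\<forall>i<m. 2 \<le> eval_steps r t2 (i # xs)"
    using bounded_stages[of m "\<lambda>i t. 2 \<le> eval_steps r t (i # xs)"] mono by blast
  \<comment> \<open>\<open>Suc m\<close> is included because the search ranges only over numbers
    below the bound.\<close>
  let ?t = "max (Suc m) (max t1 t2)"
  have "eval_steps r ?t (m # xs) = 1" using eval_steps_mono[of r t1 "m # xs" 0 ?t] t1 by simp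
  moreover have "2 \<le> eval_steps r ?t (i # xs)" if "i < m" for i
    by (rule mono[of t2]) (use t2 that in auto)
  ultimately have "eval_steps (Mu r) ?t xs = Suc m" using eval_steps_Mu_eq by auto
  then show ?case by blast
qed auto

text \<open>The evaluator is a function, so it suffices to run both computations with a common
  bound.\<close>

lemma computes_det:
  assumes "computes r xs y" "computes r xs z"
  shows "y = z"
proof -
  obtain t1 t2 where t: "eval_steps r t1 xs = Suc y" "eval_steps r t2 xs = Suc z"
    using assms eval_steps_complete by blast
  have "eval_steps r (max t1 t2) xs = Suc y" "eval_steps r (max t1 t2) xs = Suc z"
    using eval_steps_mono[OF t(1), of "max t1 t2"] eval_steps_mono[OF t(2), of "max t1 t2"] by auto
  then show ?thesis by simp
qed

section \<open>Total recursive functions and decidable predicates: closure properties\<close>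

definition computable :: "nat \<Rightarrow> (nat list \<Rightarrow> nat) \<Rightarrow> bool" where
  "computable n F \<longleftrightarrow> (\<exists>r. \<forall>xs. length xs = n \<longrightarrow> computes r xs (F xs))"

definition computable_list :: "nat \<Rightarrow> nat \<Rightarrow> (nat list \<Rightarrow> nat list) \<Rightarrow> bool" where
  "computable_list n m V \<longleftrightarrow>
     (\<forall>xs. length xs = n \<longrightarrow> length (V xs) = m) \<and> (\<forall>i<m. computable n (\<lambda>xs. V xs ! i))"

lemma computable_cong:
  "(\<And>xs. length xs = n \<Longrightarrow> F xs = G xs) \<Longrightarrow> computable n F \<longleftrightarrow> computable n G"
  unfolding computable_def by (metis (no_types, lifting))

lemma computable_app:
  assumes "computable m h" "computable_list n m V"
  shows "computable n (\<lambda>xs. h (V xs))"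
proof -
  obtain r where r: "\<forall>ys. length ys = m \<longrightarrow> computes r ys (h ys)"
    using assms(1) unfolding computable_def by blast
  have "\<forall>i<m. \<exists>g. \<forall>xs. length xs = n \<longrightarrow> computes g xs (V xs ! i)"
    using assms(2) unfolding computable_list_def computable_def by blast
  then obtain G where G: "\<forall>i<m. \<forall>xs. length xs = n \<longrightarrow> computes (G i) xs (V xs ! i)" by metis
  have "computes (Comp r (map G [0..<m])) xs (h (V xs))" if "length xs = n" for xs
  proof (rule computes.Comp)
    have "length (V xs) = m" using assms(2) that unfolding computable_list_def by blast
    then show "list_all2 (\<lambda>g. computes g xs) (map G [0..<m]) (V xs)" "computes r (V xs) (h (V xs))"
      using G that r by (auto simp: list_all2_conv_all_nth)
  qed
  then show ?thesis unfolding computable_def by blast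
qed

lemma computable_nth: "i < n \<Longrightarrow> computable n (\<lambda>xs. xs ! i)"
  unfolding computable_def using computes.Proj by metis

lemma computable_list_id: "computable_list n n (\<lambda>xs. xs)"
  unfolding computable_list_def using computable_nth by blast

lemma computable_list_Nil: "computable_list n 0 (\<lambda>xs. [])"
  unfolding computable_list_def by simp

lemma computable_list_Cons:
  assumes "computable n f" "computable_list n m V"
  shows "computable_list n (Suc m) (\<lambda>xs. f xs # V xs)"
  using assms unfolding computable_list_def by (auto simp: less_Suc_eq_0_disj)

lemma computable_list_tl:
  assumes "computable_list n m V"
  shows "computable_list n (m - 1) (\<lambda>xs. tl (V xs))"
proof -
  have "computable n (\<lambda>xs. tl (V xs) ! i)" if "i < m - 1" for i
  proof -
    have "computable n (\<lambda>xs. V xs ! Suc i)" using assms that unfolding computable_list_def by auto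
    then show ?thesis
      by (rule computable_cong[THEN iffD1, rotated])
        (use assms that in \<open>auto simp: computable_list_def nth_tl\<close>)
  qed
  then show ?thesis using assms unfolding computable_list_def by simp
qed

lemma computable_hd:
  assumes "computable_list n m V" "0 < m"
  shows "computable n (\<lambda>xs. hd (V xs))"
proof -
  have "computable n (\<lambda>xs. V xs ! 0)" using assms unfolding computable_list_def by auto
  then show ?thesis
    by (rule computable_cong[THEN iffD1, rotated])
      (use assms in \<open>auto simp: computable_list_def hd_conv_nth\<close>)
qed

lemma computable_list_map:
  assumes "\<And>g. g \<in> set gs \<Longrightarrow> computable n (f g)"
  shows "computable_list n (length gs) (\<lambda>xs. map (\<lambda>g. f g xs) gs)"
  using assms unfolding computable_list_def by simp

lemma computable_app2:
  assumes "computable 2 (\<lambda>xs. h (hd xs) (hd (tl xs)))" "computable n f" "computable n g"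
  shows "computable n (\<lambda>xs. h (f xs) (g xs))"
proof -
  have "computable_list n 2 (\<lambda>xs. [f xs, g xs])"
    using computable_list_Cons[OF assms(2) computable_list_Cons[OF assms(3) computable_list_Nil]]
    by (simp add: numeral_2_eq_2)
  from computable_app[OF assms(1) this] show ?thesis by simp
qed

lemma computable_app1:
  assumes "computable 1 (\<lambda>xs. h (hd xs))" "computable n f"
  shows "computable n (\<lambda>xs. h (f xs))"
proof -
  have "computable_list n 1 (\<lambda>xs. [f xs])"
    using computable_list_Cons[OF assms(2) computable_list_Nil] by simp
  from computable_app[OF assms(1) this] show ?thesis by simp
qed

text \<open>In a recursion step the counter and the previous value stand in front of the arguments;
  functions of the arguments alone are shifted past them. The next lemma does the same for a single
  bound variable.\<close>

lemma computable_drop2: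
  assumes "computable n f"
  shows "computable (Suc (Suc n)) (\<lambda>xs. f (tl (tl xs)))"
  using computable_app[OF assms, of "Suc (Suc n)" "\<lambda>xs. tl (tl xs)"]
    computable_list_tl[OF computable_list_tl[OF computable_list_id, of "Suc (Suc n)"]] by simp

lemma computable_drop1:
  assumes "computable n f"
  shows "computable (Suc n) (\<lambda>xs. f (tl xs))"
  using computable_app[OF assms, of "Suc n" "\<lambda>xs. tl xs"]
    computable_list_tl[OF computable_list_id, of "Suc n"] by simp

lemma computable_rec:
  assumes g: "computable n g"
    and h: "computable (Suc (Suc n)) (\<lambda>xs. h (hd xs) (hd (tl xs)) (tl (tl xs)))"
    and b: "computable n b"
  shows "computable n (\<lambda>xs. rec_nat (g xs) (\<lambda>i y. h i y xs) (b xs))"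
proof -
  obtain rg rh where rg: "\<And>xs. length xs = n \<Longrightarrow> computes rg xs (g xs)"
    and rh: "\<And>xs. length xs = Suc (Suc n) \<Longrightarrow> computes rh xs (h (hd xs) (hd (tl xs)) (tl (tl xs)))"
    using g h unfolding computable_def by blast
  have *: "computes (PrimRec rg rh) (m # xs) (rec_nat (g xs) (\<lambda>i y. h i y xs) m)" if "length xs = n" for xs m
  proof (induction m)
    case 0
    then show ?case using rg[OF that] by (simp add: computes.PrimRec_0)
  next
    case (Suc m)
    show ?case using Suc rh[of "m # rec_nat (g xs) (\<lambda>i y. h i y xs) m # xs"] that
      by (auto intro: computes.PrimRec_Suc)
  qed
  have "computes (PrimRec rg rh) ys (rec_nat (g (tl ys)) (\<lambda>i y. h i y (tl ys)) (hd ys))"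
    if "length ys = Suc n" for ys
    using *[of "tl ys" "hd ys"] that by (cases ys) auto
  then have "computable (Suc n) (\<lambda>ys. rec_nat (g (tl ys)) (\<lambda>i y. h i y (tl ys)) (hd ys))"
    unfolding computable_def by blast
  from computable_app[OF this computable_list_Cons[OF b computable_list_id]]
  show ?thesis by simp
qed

lemma computable_0: "computable n (\<lambda>_. 0)"
  unfolding computable_def using computes.Zero by blast

lemma computable_Suc:
  assumes "computable n f"
  shows "computable n (\<lambda>xs. Suc (f xs))"
proof -
  have "computes Succ xs (Suc (hd xs))" if "length xs = 1" for xs
    using that computes.Succ[of "hd xs"] by (cases xs) auto
  then have "computable 1 (\<lambda>xs. Suc (hd xs))"
    unfolding computable_def by blast
  then show ?thesis using assms by (rule computable_app1)
qed

lemma computable_const: "computable n (\<lambda>_. c)"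
  by (induction c) (auto intro: computable_0 computable_Suc)

lemmas computable_base = computable_const computable_Suc computable_hd computable_list_tl
  computable_list_id computable_list_Cons

lemma computable_add:
  assumes "computable n f" "computable n g"
  shows "computable n (\<lambda>xs. f xs + g xs)"
proof -
  have eq: "a + b = rec_nat a (\<lambda>i y. Suc y) b" for a b :: nat by (induction b) auto
  show ?thesis unfolding eq
    by (rule computable_rec[OF assms(1) _ assms(2)]) (rule computable_base | simp)+
qed

lemma computable_mult:
  assumes "computable n f" "computable n g"
  shows "computable n (\<lambda>xs. f xs * g xs)"
proof -
  have eq: "a * b = rec_nat 0 (\<lambda>i y. y + a) b" for a b :: nat by (induction b) auto
  show ?thesis unfolding eq
    by (rule computable_rec[OF computable_0 _ assms(2)], rule computable_add)
      (rule computable_base computable_drop2[OF assms(1)] | simp)+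
qed

lemma computable_diff:
  assumes "computable n f" "computable n g"
  shows "computable n (\<lambda>xs. f xs - g xs)"
proof -
  let ?p = "rec_nat 0 (\<lambda>i y. i) :: nat \<Rightarrow> nat"
  have 1: "?p m = m - 1" for m by (cases m) auto
  have p: "computable k h \<Longrightarrow> computable k (\<lambda>xs. ?p (h xs))" for k h
    by (rule computable_rec[OF computable_0]) (rule computable_base | simp)+
  have eq: "a - b = rec_nat a (\<lambda>i y. ?p y) b" for a b :: nat by (induction b) (auto simp: 1)
  show ?thesis unfolding eq
    by (rule computable_rec[OF assms(1) _ assms(2)], rule p) (rule computable_base | simp)+
qed

lemma computable_power:
  assumes "computable n f" "computable n g"
  shows "computable n (\<lambda>xs. f xs ^ g xs)"
proof -
  have eq: "a ^ b = rec_nat 1 (\<lambda>i y. y * a) b" for a b :: nat by (induction b) auto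
  show ?thesis unfolding eq
    by (rule computable_rec[OF computable_const _ assms(2)], rule computable_mult)
      (rule computable_base computable_drop2[OF assms(1)] | simp)+
qed

lemma computable_sum_lessThan:
  assumes "computable n b" "computable (Suc n) (\<lambda>xs. g (hd xs) (tl xs))"
  shows "computable n (\<lambda>xs. \<Sum>i<b xs. g i xs)"
proof -
  have eq: "(\<Sum>i<b. g i xs) = rec_nat 0 (\<lambda>i y. y + g i xs) b" for b xs
    by (induction b) auto
  have "computable (Suc (Suc n)) (\<lambda>xs. g (hd xs) (tl (tl xs)))"
  proof -
    have "computable_list (Suc (Suc n)) (Suc n) (\<lambda>xs. hd xs # tl (tl xs))"
      using computable_list_Cons[OF computable_hd[OF computable_list_id]
          computable_list_tl[OF computable_list_tl[OF computable_list_id, of "Suc (Suc n)"]]] by simp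
    from computable_app[OF assms(2) this] show ?thesis by simp
  qed
  then show ?thesis unfolding eq
    by (intro computable_rec[OF computable_0 _ assms(1)] computable_add)
      (rule computable_base computable_drop2[OF assms(1)] | simp)+
qed

definition decidable :: "nat \<Rightarrow> (nat list \<Rightarrow> bool) \<Rightarrow> bool" where
  "decidable n P \<longleftrightarrow> computable n (\<lambda>xs. if P xs then 1 else 0)"

lemma computable_if:
  assumes "decidable n P" "computable n f" "computable n g"
  shows "computable n (\<lambda>xs. if P xs then f xs else g xs)"
proof -
  have eq: "(if P xs then f xs else g xs) =
      (if P xs then 1 else 0) * f xs + (1 - (if P xs then 1 else 0)) * g xs" for xs by simp
  show ?thesis unfolding eq
    by (intro computable_add computable_mult computable_diff computable_const
        assms(1)[unfolded decidable_def] assms(2,3))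
qed

lemma decidable_le:
  assumes "computable n f" "computable n g"
  shows "decidable n (\<lambda>xs. f xs \<le> g xs)"
proof -
  have eq: "(if f xs \<le> g xs then 1 else 0) = 1 - (f xs - g xs)" for xs by simp
  show ?thesis unfolding decidable_def eq by (intro computable_diff computable_const assms)
qed

lemma decidable_conj:
  assumes "decidable n P" "decidable n Q"
  shows "decidable n (\<lambda>xs. P xs \<and> Q xs)"
proof -
  have eq: "(if P xs \<and> Q xs then 1 else 0) = (if P xs then 1 else 0) * (if Q xs then 1 else (0::nat))" for xs
    by simp
  show ?thesis unfolding decidable_def eq
    by (intro computable_mult assms[unfolded decidable_def])
qed

lemma decidable_not:
  assumes "decidable n P"
  shows "decidable n (\<lambda>xs. \<not> P xs)"
proof -
  have eq: "(if \<not> P xs then 1 else 0) = 1 - (if P xs then 1 else (0::nat))" for xs by simp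
  show ?thesis unfolding decidable_def eq
    by (intro computable_diff computable_const assms[unfolded decidable_def])
qed

lemma decidable_less:
  assumes "computable n f" "computable n g"
  shows "decidable n (\<lambda>xs. f xs < g xs)"
  unfolding not_le[symmetric] by (intro decidable_not decidable_le assms)

lemma decidable_eq:
  assumes "computable n f" "computable n g"
  shows "decidable n (\<lambda>xs. f xs = g xs)"
  unfolding eq_iff[of "f _"] by (intro decidable_conj decidable_le assms)

text \<open>A count is a sum of indicators. Bounded quantifiers, division and \<open>val2\<close>
  are all reduced to counting.\<close>

lemma computable_card:
  assumes "computable n b" "decidable (Suc n) (\<lambda>xs. P (hd xs) (tl xs))"
  shows "computable n (\<lambda>xs. card {i. i < b xs \<and> P i xs})"
proof -
  have eq: "card {i. i < m \<and> P i xs} = (\<Sum>i<m. if P i xs then 1 else 0)" for xs m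
    by (simp add: sum.If_cases Int_def)
  show ?thesis unfolding eq
    by (intro computable_sum_lessThan assms(1) computable_const computable_if assms(2))
qed

lemma decidable_ex_less:
  assumes "computable n b" "decidable (Suc n) (\<lambda>xs. P (hd xs) (tl xs))"
  shows "decidable n (\<lambda>xs. \<exists>i<b xs. P i xs)"
proof -
  have eq: "(\<exists>i<b xs. P i xs) \<longleftrightarrow> 0 < card {i. i < b xs \<and> P i xs}" for xs
    by (auto simp: card_gt_0_iff)
  show ?thesis unfolding eq
    by (intro decidable_less computable_const computable_card assms)
qed

lemma decidable_all_less:
  fixes b :: "nat list \<Rightarrow> nat"
  assumes "computable n b" "decidable (Suc n) (\<lambda>xs. P (hd xs) (tl xs))"
  shows "decidable n (\<lambda>xs. \<forall>i<b xs. P i xs)"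
proof -
  have eq: "(\<forall>i<b xs. P i xs) \<longleftrightarrow> \<not> (\<exists>i<b xs. \<not> P i xs)" for xs by blast
  show ?thesis unfolding eq by (intro decidable_not decidable_ex_less assms)
qed

text \<open>\<open>J\<close> is fixed and nothing is uniform in \<open>j\<close>: the conjunction is
  unrolled. This suits the functions \<open>\<pi> j\<close>, which are computable one by
  one.\<close>

lemma decidable_all_finite:
  fixes J :: nat
  assumes "\<And>j. j < J \<Longrightarrow> decidable n (P j)"
  shows "decidable n (\<lambda>xs. \<forall>j<J. P j xs)"
  using assms
proof (induction J)
  case 0
  then show ?case unfolding decidable_def by (simp add: computable_const)
next
  case (Suc J)
  have "decidable n (\<lambda>xs. (\<forall>j<J. P j xs) \<and> P J xs)" by (intro decidable_conj Suc) simp_all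
  moreover have "(\<forall>j<Suc J. P j xs) \<longleftrightarrow> (\<forall>j<J. P j xs) \<and> P J xs" for xs
    by (auto simp: less_Suc_eq)
  ultimately show ?case by simp
qed

lemma computable_div:
  assumes "computable n f" "computable n g"
  shows "computable n (\<lambda>xs. f xs div g xs)"
proof -
  \<comment> \<open>The quotient counts the positive multiples of \<open>b\<close> up to
    \<open>a\<close>; for \<open>b = 0\<close> every \<open>q < a\<close> would be counted.\<close>
  have eq: "a div b = (if b = 0 then 0 else card {q. q < a \<and> Suc q * b \<le> a})" for a b :: nat
  proof (cases "b = 0")
    case False
    then have "{q. q < a \<and> Suc q * b \<le> a} = {..<a div b}"
      by (auto simp: less_eq_div_iff_mult_less_eq[of b _ a, symmetric] Suc_le_eq simp del: mult_Suc)
         (metis div_le_dividend less_le_trans)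
    then show ?thesis using False by simp
  qed simp
  show ?thesis unfolding eq
    by (intro computable_if decidable_eq computable_const computable_card decidable_le computable_mult
        computable_Suc computable_drop1 assms) (rule computable_base | simp)+
qed

lemma computable_mod:
  assumes "computable n f" "computable n g"
  shows "computable n (\<lambda>xs. f xs mod g xs)"
  unfolding minus_mult_div_eq_mod[symmetric]
  by (intro computable_diff computable_mult computable_div assms)

lemma decidable_ball:
  assumes "\<And>g. g \<in> set gs \<Longrightarrow> decidable n (P g)"
  shows "decidable n (\<lambda>xs. \<forall>g\<in>set gs. P g xs)"
proof -
  have "decidable n (\<lambda>xs. \<forall>j<length gs. P (gs ! j) xs)"
    by (rule decidable_all_finite) (simp add: assms)
  then show ?thesis by (simp add: all_set_conv_all_nth)
qed

text \<open>The bound is an argument, so that runs of one machine on many inputs can be dovetailed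
  inside a decidable predicate. The arity varies in the induction because subprograms take other
  numbers of arguments; cases of wrong arity are the constant 0.\<close>

lemma computable_eval_steps:
  "computable (Suc n) (\<lambda>xs. eval_steps r (hd xs) (tl xs))"
proof (induction r arbitrary: n)
  case Zero
  then show ?case by (simp add: computable_const)
next
  case Succ
  show ?case
  proof (cases "n = 1")
    case True
    have "computable (Suc n) (\<lambda>xs. Suc (Suc (hd (tl xs))))"
      by (rule computable_base | simp add: True)+
    then show ?thesis
      by (rule computable_cong[THEN iffD1, rotated]) (simp add: True)
  next
    case False
    show ?thesis
      by (rule computable_cong[THEN iffD1, rotated, OF computable_const[of _ 0]]) (use False in simp)
  qed
next
  case (Proj i)
  show ?case
  proof (cases "i < n")
    case True
    have "computable (Suc n) (\<lambda>xs. Suc (xs ! Suc i))"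
      by (intro computable_Suc computable_nth) (simp add: True)
    then show ?thesis
      by (rule computable_cong[THEN iffD1, rotated]) (simp add: True nth_tl)
  next
    case False
    show ?thesis
      by (rule computable_cong[THEN iffD1, rotated, OF computable_const[of _ 0]]) (use False in simp)
  qed
next
  case (Comp r gs)
  have g: "computable (Suc n) (\<lambda>xs. eval_steps g (hd xs) (tl xs))" if "g \<in> set gs" for g
    using Comp.IH(2)[OF that] .
  have V: "computable_list (Suc n) (Suc (length gs))
      (\<lambda>xs. hd xs # map (\<lambda>g. eval_steps g (hd xs) (tl xs) - 1) gs)"
    by (intro computable_list_Cons computable_list_map computable_diff computable_const g)
      (rule computable_base | simp)+
  have "computable (Suc n) (\<lambda>xs. eval_steps r (hd xs) (map (\<lambda>g. eval_steps g (hd xs) (tl xs) - 1) gs))"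
    using computable_app[OF Comp.IH(1) V] by simp
  moreover have "decidable (Suc n) (\<lambda>xs. \<not> (\<forall>g\<in>set gs. \<not> eval_steps g (hd xs) (tl xs) = 0))"
    by (intro decidable_not decidable_ball decidable_eq g computable_const)
  ultimately show ?case by (simp add: computable_if computable_const)
next
  case (PrimRec g h)
  show ?case
  proof (cases n)
    case 0
    show ?thesis
      by (rule computable_cong[THEN iffD1, rotated, OF computable_const[of _ 0]]) (simp add: 0)
  next
    case (Suc k)
    have V: "computable_list (Suc n) (Suc k) (\<lambda>xs. hd xs # tl (tl xs))"
      using computable_list_Cons[OF computable_hd[OF computable_list_id]
          computable_list_tl[OF computable_list_tl[OF computable_list_id, of "Suc n"]]] Suc by simp
    have G: "computable (Suc n) (\<lambda>xs. eval_steps g (hd xs) (tl (tl xs)))"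
      using computable_app[OF PrimRec.IH(1) V] by simp
    have D: "computable_list (Suc (Suc (Suc n))) k (\<lambda>xs. tl (tl (tl (tl xs))))"
      using computable_list_tl[OF computable_list_tl[OF computable_list_tl[OF computable_list_tl[OF
          computable_list_id, of "Suc (Suc (Suc n))"]]]] Suc by simp
    have W: "computable_list (Suc (Suc (Suc n))) (Suc (Suc (Suc k)))
        (\<lambda>xs. hd (tl (tl xs)) # hd xs # (hd (tl xs) - 1) # tl (tl (tl (tl xs))))"
      by (intro computable_list_Cons computable_diff computable_const D)
        (rule computable_base | simp)+
    have H: "computable (Suc (Suc (Suc n))) (\<lambda>xs. eval_steps h (hd (tl (tl xs)))
        (hd xs # (hd (tl xs) - 1) # tl (tl (tl (tl xs)))))"
      using computable_app[OF PrimRec.IH(2) W] by simp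
    have "computable (Suc n) (\<lambda>xs. rec_nat (eval_steps g (hd xs) (tl (tl xs)))
        (\<lambda>i y. if y = 0 then 0 else eval_steps h (hd xs) (i # (y - 1) # tl (tl xs))) (hd (tl xs)))"
      by (intro computable_rec G computable_if decidable_eq computable_const H)
        (rule computable_base | simp add: Suc)+
    then show ?thesis
      by (rule computable_cong[THEN iffD1, rotated]) (auto simp: Suc)
  qed
next
  case (Mu r)
  have tl2: "computable_list (Suc (Suc n)) n (\<lambda>xs. tl (tl xs))"
    using computable_list_tl[OF computable_list_tl[OF computable_list_id, of "Suc (Suc n)"]] by simp
  have tl3: "computable_list (Suc (Suc (Suc n))) n (\<lambda>xs. tl (tl (tl xs)))"
    using computable_list_tl[OF computable_list_tl[OF computable_list_tl[OF computable_list_id, of "Suc (Suc (Suc n))"]]] by simp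
  have V: "computable_list (Suc (Suc n)) (Suc (Suc n)) (\<lambda>xs. hd (tl xs) # hd xs # tl (tl xs))"
    by (intro computable_list_Cons tl2) (rule computable_base | simp)+
  have 1: "computable (Suc (Suc n)) (\<lambda>xs. eval_steps r (hd (tl xs)) (hd xs # tl (tl xs)))"
    using computable_app[OF Mu.IH V] by simp
  have W: "computable_list (Suc (Suc (Suc n))) (Suc (Suc n)) (\<lambda>xs. hd (tl (tl xs)) # hd xs # tl (tl (tl xs)))"
    by (intro computable_list_Cons tl3) (rule computable_base | simp)+
  have 2: "computable (Suc (Suc (Suc n))) (\<lambda>xs. eval_steps r (hd (tl (tl xs))) (hd xs # tl (tl (tl xs))))"
    using computable_app[OF Mu.IH W] by simp
  show ?case unfolding eval_steps.simps
    by (intro computable_sum_lessThan computable_if decidable_conj decidable_eq decidable_all_less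
        decidable_le computable_const computable_Suc 1 2)
      (rule computable_base | simp)+
qed

lemma computable_hd_tl:
  "0 < n \<Longrightarrow> computable n (\<lambda>xs. hd xs)"
  "1 < n \<Longrightarrow> computable n (\<lambda>xs. hd (tl xs))"
  "2 < n \<Longrightarrow> computable n (\<lambda>xs. hd (tl (tl xs)))"
  "3 < n \<Longrightarrow> computable n (\<lambda>xs. hd (tl (tl (tl xs))))"
  "4 < n \<Longrightarrow> computable n (\<lambda>xs. hd (tl (tl (tl (tl xs)))))"
  by ((rule computable_base | simp)+)

lemmas computable_intros =
  computable_Suc computable_add computable_mult computable_diff computable_power computable_div
  computable_mod computable_card computable_if computable_sum_lessThan decidable_conj decidable_not
  decidable_le decidable_less decidable_eq decidable_all_less decidable_ex_less
  computable_hd_tl computable_const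

section \<open>Complexity of natural numbers\<close>

definition string_length :: "nat \<Rightarrow> nat" where
  "string_length w = length (inv string_nat w)"

lemma string_nat_inv [simp]: "string_nat (inv string_nat w) = w"
  by (simp add: bij_is_surj[OF bij_string_nat] surj_f_inv_f)

lemma inv_string_nat [simp]: "inv string_nat (string_nat p) = p"
  by (simp add: bij_is_inj[OF bij_string_nat])

lemma string_nat_length_bounds:
  "2 ^ length p \<le> Suc (string_nat p)" "Suc (string_nat p) < 2 ^ Suc (length p)"
  by (induction p) auto

text \<open>The numeration lists strings by length, so the programs of length at most
  \<open>k\<close> form an initial segment. A search through short programs thereby becomes a
  bounded quantifier.\<close>

lemma string_length_le_iff: "string_length w \<le> k \<longleftrightarrow> w < 2 ^ Suc k - 1"
proof -
  let ?p = "inv string_nat w"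
  have b: "2 ^ length ?p \<le> Suc w" "Suc w < 2 ^ Suc (length ?p)"
    using string_nat_length_bounds[of ?p] by simp_all
  show ?thesis
  proof
    assume "string_length w \<le> k"
    then have "(2::nat) ^ Suc (length ?p) \<le> 2 ^ Suc k"
      unfolding string_length_def by (intro power_increasing) auto
    then show "w < 2 ^ Suc k - 1" using b(2) by linarith
  next
    assume "w < 2 ^ Suc k - 1"
    then have "(2::nat) ^ length ?p < 2 ^ Suc k" using b(1) by linarith
    then have "length ?p < Suc k" by (rule power_less_imp_less_exp[rotated]) simp
    then show "string_length w \<le> k" unfolding string_length_def by simp
  qed
qed

definition nat_complexity :: "language \<Rightarrow> nat \<Rightarrow> nat" where
  "nat_complexity U x = the_enat (cond_complexity U (inv string_nat x) [])"

lemma complexity_eq_nat_complexity: "complexity U s = real (nat_complexity U (string_nat s))"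
  by (simp add: complexity_def nat_complexity_def)

lemma cond_complexity_le:
  assumes "L p y = Some x"
  shows "cond_complexity L x y \<le> enat (length p)"
  unfolding cond_complexity_def by (rule INF_lower) (simp add: assms)

lemma nat_complexity_attained:
  assumes "universal U"
  obtains p where "length p = nat_complexity U x" "U p [] = Some (inv string_nat x)"
proof -
  let ?S = "(\<lambda>p. enat (length p)) ` {p. U p [] = Some (inv string_nat x)}"
  have fin: "cond_complexity U (inv string_nat x) [] \<noteq> \<infinity>"
    by (rule universal_cond_complexity_finite[OF assms])
  have "?S \<noteq> {}"
  proof
    assume "?S = {}"
    then have "cond_complexity U (inv string_nat x) [] = \<infinity>"
      unfolding cond_complexity_def by (simp add: top_enat_def)
    then show False using fin by simp
  qed
  then have "Inf ?S \<in> ?S" by (rule wellorder_InfI[of _ ?S, OF ex_in_conv[THEN iffD2, THEN someI_ex]])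
  then obtain p where p: "U p [] = Some (inv string_nat x)"
    and e: "cond_complexity U (inv string_nat x) [] = enat (length p)"
    unfolding cond_complexity_def by auto
  show ?thesis by (rule that[OF _ p]) (simp add: nat_complexity_def e)
qed

lemma computes_CompE:
  assumes "computes (Comp r gs) xs z"
  obtains ys where "list_all2 (\<lambda>g y. computes g xs y) gs ys" "computes r ys z"
  using assms by cases auto

lemma computes_MuE:
  assumes "computes (Mu r) xs m"
  shows "computes r (m # xs) 0" "\<forall>i<m. \<exists>y. computes r (i # xs) (Suc y)"
  using assms by (cases, auto)+

text \<open>\<open>w\<close> is read as a program that searches for the least \<open>t\<close> with
  \<open>P w t\<close> and prints \<open>G w t\<close>; universality turns its length into a bound
  on the complexity. All upper bounds on complexities come from here.\<close>

lemma complexity_search: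
  assumes U: "universal U"
    and P: "decidable 2 (\<lambda>xs. P (hd xs) (hd (tl xs)))"
    and G: "computable 2 (\<lambda>xs. G (hd xs) (hd (tl xs)))"
  obtains c where "\<And>w t. P w t \<Longrightarrow> (\<And>t'. t' < t \<Longrightarrow> \<not> P w t') \<Longrightarrow>
    nat_complexity U (G w t) \<le> string_length w + c"
proof -
  have "decidable 3 (\<lambda>xs. P (hd (tl xs)) (hd xs))"
    unfolding decidable_def
    by (rule computable_app2[of "\<lambda>a b. if P a b then 1 else 0", OF P[unfolded decidable_def]];
        intro computable_intros; simp)
  \<comment> \<open>\<open>Mu\<close> looks for a zero and varies the first argument; the third one
    is the conditional string, which the program ignores.\<close>
  then have "computable 3 (\<lambda>xs. if P (hd (tl xs)) (hd xs) then 0 else 1)"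
    by (intro computable_intros)
  then obtain rP where rP0: "\<And>xs. length xs = 3 \<Longrightarrow> computes rP xs (if P (hd (tl xs)) (hd xs) then 0 else 1)"
    unfolding computable_def by blast
  have rP: "computes rP [t, w, y] (if P w t then 0 else 1)" for t w y
    using rP0[of "[t, w, y]"] by simp
  obtain rG where rG0: "\<And>xs. length xs = 2 \<Longrightarrow> computes rG xs (G (hd xs) (hd (tl xs)))"
    using G unfolding computable_def by blast
  have rG: "computes rG [w, t] (G w t)" for t w
    using rG0[of "[w, t]"] by simp
  define r where "r = Comp rG [Proj 0, Mu rP]"
  have run: "computes r [w, y] (G w t)" if "P w t" "\<forall>t'<t. \<not> P w t'" for w y t
  proof -
    have "computes rP [i, w, y] (Suc 0)" if "i < t" for i
      using rP[of i w y] \<open>\<forall>t'<t. \<not> P w t'\<close> that by simp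
    moreover have "computes rP [t, w, y] 0" using rP[of t w y] that(1) by simp
    ultimately have "computes (Mu rP) [w, y] t"
      by (intro computes.Mu) blast+
    moreover have "computes (Proj 0) [w, y] w" using computes.Proj[of 0 "[w, y]"] by simp
    ultimately show ?thesis unfolding r_def using rG[of w t] by (intro computes.Comp[of _ _ "[w, t]"]) auto
  qed
  \<comment> \<open>\<open>partial_computable\<close> asks for an equivalence, so \<open>r\<close>
    must also have no value where the search has no solution.\<close>
  have halt: "\<exists>t. P w t" if r: "computes r [w, y] z" for w y z
  proof -
    obtain ys where "list_all2 (\<lambda>g y'. computes g [w, y] y') [Proj 0, Mu rP] ys"
      using computes_CompE[OF r[unfolded r_def]] by blast
    then obtain b where "computes (Mu rP) [w, y] b" by (auto simp: list_all2_Cons1)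
    then have "computes rP [b, w, y] 0" by (rule computes_MuE)
    then have "P w b" using computes_det[OF _ rP[of b w y]] by (metis zero_neq_one)
    then show ?thesis by blast
  qed
  define L :: language where
    "L = (\<lambda>p y. if \<exists>t. P (string_nat p) t
       then Some (inv string_nat (G (string_nat p) (LEAST t. P (string_nat p) t))) else None)"
  have L: "L p y = Some x \<longleftrightarrow> computes r [string_nat p, string_nat y] (string_nat x)" for p y x
  proof (cases "\<exists>t. P (string_nat p) t")
    case True
    let ?t = "LEAST t. P (string_nat p) t"
    have "computes r [string_nat p, string_nat y] (G (string_nat p) ?t)"
      by (rule run) (use True in \<open>auto intro: LeastI_ex dest: not_less_Least\<close>)
    moreover have "L p y = Some (inv string_nat (G (string_nat p) ?t))"
      using True by (simp add: L_def)
    ultimately show ?thesis using computes_det by (metis inv_string_nat option.inject string_nat_inv)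
  next
    case False
    then show ?thesis using halt[of "string_nat p" "string_nat y" "string_nat x"] by (auto simp: L_def)
  qed
  then have "partial_computable L" unfolding partial_computable_def by blast
  then obtain c where c: "\<And>x y. cond_complexity U x y \<le> cond_complexity L x y + enat c"
    using U unfolding universal_def by blast
  show ?thesis
  proof (rule that)
    fix w t assume "P w t" "\<And>t'. t' < t \<Longrightarrow> \<not> P w t'"
    then have "computes r [w, 0] (G w t)" by (intro run) auto
    then have "L (inv string_nat w) [] = Some (inv string_nat (G w t))" by (simp add: L)
    then have "cond_complexity L (inv string_nat (G w t)) [] \<le> enat (string_length w)"
      unfolding string_length_def by (rule cond_complexity_le)
    then have "cond_complexity U (inv string_nat (G w t)) [] \<le> enat (string_length w) + enat c"
      using c by (meson add_mono dual_order.refl order_trans)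
    then show "nat_complexity U (G w t) \<le> string_length w + c"
      unfolding nat_complexity_def
      by (metis enat_ile enat_ord_simps(1) plus_enat_simps(1) the_enat.simps)
  qed
qed

text \<open>A number \<open>2 ^ l * (2 * u + 1)\<close> encodes the base \<open>2 ^ l\<close> digits of \<open>u\<close>. Reading off \<open>b\<close> as the
  part of \<open>u\<close> above a fixed number of digits makes \<open>b\<close> cost its own length in bits and the digits only
  \<open>O(l)\<close> bits.\<close>

definition val2 :: "nat \<Rightarrow> nat" where
  "val2 w = card {i. i < w \<and> w mod 2 ^ Suc i = 0}"

definition digit :: "nat \<Rightarrow> nat \<Rightarrow> nat" where
  "digit w i = w div 2 ^ Suc (val2 w) div 2 ^ (val2 w * i) mod 2 ^ val2 w"

definition remainder :: "nat \<Rightarrow> nat \<Rightarrow> nat" where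
  "remainder w i = w div 2 ^ Suc (val2 w) div 2 ^ (val2 w * i)"

fun pack_digits :: "nat \<Rightarrow> nat list \<Rightarrow> nat \<Rightarrow> nat" where
  "pack_digits l [] b = b"
| "pack_digits l (d # ds) b = d + 2 ^ l * pack_digits l ds b"

definition pack :: "nat \<Rightarrow> nat list \<Rightarrow> nat \<Rightarrow> nat" where
  "pack l ds b = 2 ^ l * (2 * pack_digits l ds b + 1)"

text \<open>The cofactor of \<open>2 ^ l\<close> is odd, so exactly the exponents up to
  \<open>l\<close> divide. The range \<open>i < w\<close>, which makes the count in
  \<open>val2\<close> bounded, misses none of them because \<open>l < 2 ^ l\<close>.\<close>

lemma val2_pack: "val2 (pack l ds b) = l"
proof -
  let ?w = "pack l ds b"
  have "?w mod 2 ^ Suc i = 0 \<longleftrightarrow> i < l" for i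
  proof
    assume "?w mod 2 ^ Suc i = 0"
    then have d: "2 ^ Suc i dvd ?w" by (simp add: dvd_eq_mod_eq_0)
    show "i < l"
    proof (rule ccontr)
      assume "\<not> i < l"
      then have "(2::nat) ^ Suc l dvd 2 ^ Suc i" by (intro le_imp_power_dvd) simp
      then have "2 ^ l * 2 dvd 2 ^ l * (2 * pack_digits l ds b + 1)"
        using d unfolding pack_def by (metis dvd_trans power_Suc2)
      then have "2 dvd 2 * pack_digits l ds b + 1"
        using dvd_times_left_cancel_iff[of "2 ^ l :: nat" 2 "2 * pack_digits l ds b + 1"] by simp
      then show False by presburger
    qed
  next
    assume "i < l"
    then have "(2::nat) ^ Suc i dvd 2 ^ l" by (intro le_imp_power_dvd) simp
    then show "?w mod 2 ^ Suc i = 0" unfolding pack_def by (simp add: dvd_mult2 mod_0_imp_dvd dvd_imp_mod_0)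
  qed
  moreover have "l < ?w"
  proof -
    have "l < 2 ^ l" by simp
    also have "\<dots> \<le> ?w" unfolding pack_def by simp
    finally show ?thesis .
  qed
  ultimately have "{i. i < ?w \<and> ?w mod 2 ^ Suc i = 0} = {i. i < ?w \<and> i < l}" and "l < ?w"
    by (simp_all only:)
  moreover have "{i. i < ?w \<and> i < l} = {..<l}" if "l < ?w"
    using that by (intro set_eqI) (simp add: conj_absorb, linarith)
  ultimately show ?thesis unfolding val2_def by simp
qed

lemma pack_div: "pack l ds b div 2 ^ Suc l = pack_digits l ds b"
proof -
  have "pack l ds b div 2 ^ Suc l = (2 ^ l * (2 * pack_digits l ds b + 1)) div 2 ^ l div 2"
    unfolding pack_def by (simp add: div_mult2_eq power_Suc2 del: power_Suc)
  then show ?thesis by simp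
qed

lemma digit_pack:
  assumes "\<forall>d\<in>set ds. d < 2 ^ l" "i < length ds"
  shows "digit (pack l ds b) i = ds ! i"
proof -
  have "pack_digits l ds b div 2 ^ (l * i) mod 2 ^ l = ds ! i"
    using assms
  proof (induction ds arbitrary: i)
    case (Cons d ds)
    show ?case
    proof (cases i)
      case 0
      then show ?thesis using Cons.prems by simp
    next
      case (Suc k)
      have "pack_digits l (d # ds) b div 2 ^ (l * i) = (d + 2 ^ l * pack_digits l ds b) div 2 ^ l div 2 ^ (l * k)"
        unfolding Suc by (simp add: div_mult2_eq power_add)
      also have "(d + 2 ^ l * pack_digits l ds b) div 2 ^ l = pack_digits l ds b"
        using Cons.prems by simp
      finally show ?thesis using Cons Suc by simp
    qed
  qed simp
  then show ?thesis unfolding digit_def val2_pack pack_div .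
qed

lemma remainder_pack:
  assumes "\<forall>d\<in>set ds. d < 2 ^ l"
  shows "remainder (pack l ds b) (length ds) = b"
proof -
  have "pack_digits l ds b div 2 ^ (l * length ds) = b"
    using assms
  proof (induction ds)
    case (Cons d ds)
    have "pack_digits l (d # ds) b div 2 ^ (l * length (d # ds)) =
        (d + 2 ^ l * pack_digits l ds b) div 2 ^ l div 2 ^ (l * length ds)"
      by (simp add: div_mult2_eq power_add)
    also have "(d + 2 ^ l * pack_digits l ds b) div 2 ^ l = pack_digits l ds b"
      using Cons.prems by simp
    finally show ?case using Cons by simp
  qed simp
  then show ?thesis unfolding remainder_def val2_pack pack_div .
qed

lemma pack_digits_bound:
  assumes "\<forall>d\<in>set ds. d < 2 ^ l"
  shows "Suc (pack_digits l ds b) \<le> 2 ^ (l * length ds) * Suc b"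
  using assms
proof (induction ds)
  case (Cons d ds)
  have "Suc (pack_digits l (d # ds) b) \<le> 2 ^ l * Suc (pack_digits l ds b)"
    using Cons.prems by simp
  also have "\<dots> \<le> 2 ^ l * (2 ^ (l * length ds) * Suc b)"
    by (intro mult_left_mono Cons) (use Cons.prems in auto)
  also have "\<dots> = 2 ^ (l * length (d # ds)) * Suc b" by (simp add: power_add algebra_simps)
  finally show ?case .
qed simp

lemma string_length_pack:
  assumes "\<forall>d\<in>set ds. d < 2 ^ l" "Suc b \<le> 2 ^ q"
  shows "string_length (pack l ds b) \<le> l * Suc (length ds) + 1 + q"
proof -
  have "Suc (pack l ds b) \<le> 2 ^ Suc l * Suc (pack_digits l ds b)"
    unfolding pack_def by simp
  also have "\<dots> \<le> 2 ^ Suc l * (2 ^ (l * length ds) * 2 ^ q)"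
    using pack_digits_bound[OF assms(1), of b] assms(2)
    by (meson le_trans mult_le_mono2 mult_left_mono zero_le)
  also have "\<dots> = 2 ^ (l * Suc (length ds) + 1 + q)" by (simp add: power_add)
  also have "\<dots> < 2 ^ Suc (l * Suc (length ds) + 1 + q)" by simp
  finally have "pack l ds b < 2 ^ Suc (l * Suc (length ds) + 1 + q) - 1" by linarith
  then show ?thesis unfolding string_length_le_iff .
qed

lemma computable_val2: "computable n f \<Longrightarrow> computable n (\<lambda>xs. val2 (f xs))"
  unfolding val2_def by (intro computable_intros computable_drop1) simp_all

lemma computable_digit:
  "computable n f \<Longrightarrow> computable n g \<Longrightarrow> computable n (\<lambda>xs. digit (f xs) (g xs))"
  unfolding digit_def by (intro computable_intros computable_val2) 

lemma computable_remainder: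
  "computable n f \<Longrightarrow> computable n g \<Longrightarrow> computable n (\<lambda>xs. remainder (f xs) (g xs))"
  unfolding remainder_def by (intro computable_intros computable_val2)

section \<open>Greedy selection of typical tuples\<close>

text \<open>Stages are scanned in increasing order. A candidate is chosen unless one of its values \<open>val j\<close>
  has already been taken by \<open>2 ^ m j\<close> chosen stages.\<close>

locale greedy =
  fixes cand :: "nat \<Rightarrow> bool" and val :: "nat \<Rightarrow> nat \<Rightarrow> nat" and J :: nat and m :: "nat \<Rightarrow> nat"
begin

primrec acc :: "nat \<Rightarrow> nat set" where
  "acc 0 = {}"
| "acc (Suc t) =
     (if cand t \<and> (\<forall>j<J. card {s. s < t \<and> s \<in> acc t \<and> val j s = val j t} < 2 ^ m j)
      then insert t (acc t) else acc t)"

definition chosen :: "nat set" where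
  "chosen = (\<Union>t. acc t)"

text \<open>The stage \<open>t\<close> uses up the capacity of its value, so a full value is named
  by the rank of its filling stage. In terms of \<open>acc\<close> instead of \<open>chosen\<close>
  this depends only on stages up to \<open>t\<close> and stays decidable.\<close>

definition fill :: "nat \<Rightarrow> nat \<Rightarrow> bool" where
  "fill j t \<longleftrightarrow> t \<in> acc (Suc t) \<and> Suc (card {s. s < t \<and> s \<in> acc t \<and> val j s = val j t}) = 2 ^ m j"

lemma acc_less: "s \<in> acc t \<Longrightarrow> s < t"
  by (induction t) (auto split: if_splits)

lemma finite_acc: "finite (acc t)"
  using acc_less by (meson finite_lessThan finite_subset lessThan_iff subsetI)

lemma acc_mono: "t \<le> t' \<Longrightarrow> acc t \<subseteq> acc t'"
  by (induction t' rule: dec_induct) auto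

lemma acc_stable: "s \<in> acc t' \<Longrightarrow> s < t \<Longrightarrow> t \<le> t' \<Longrightarrow> s \<in> acc t"
proof (induction t')
  case (Suc t')
  then show ?case by (cases "t = Suc t'") (auto split: if_splits)
qed simp

lemma acc_iff: "s \<in> acc t \<longleftrightarrow> s \<in> chosen \<and> s < t"
  unfolding chosen_def using acc_less acc_stable acc_mono by (metis UN_iff UNIV_I in_mono nat_le_linear)

lemma chosen_iff:
  "t \<in> chosen \<longleftrightarrow> cand t \<and> (\<forall>j<J. card {s \<in> chosen. s < t \<and> val j s = val j t} < 2 ^ m j)"
proof -
  have eq: "{s. s < t \<and> s \<in> acc t \<and> val j s = val j t} = {s \<in> chosen. s < t \<and> val j s = val j t}" for j
    using acc_iff by blast
  have "t \<in> chosen \<longleftrightarrow> t \<in> acc (Suc t)" by (simp only: acc_iff lessI simp_thms)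
  also have "\<dots> \<longleftrightarrow> cand t \<and> (\<forall>j<J. card {s. s < t \<and> s \<in> acc t \<and> val j s = val j t} < 2 ^ m j)"
    using acc_less by auto
  finally show ?thesis unfolding eq .
qed

lemma fill_iff:
  "fill j t \<longleftrightarrow> t \<in> chosen \<and> Suc (card {s \<in> chosen. s < t \<and> val j s = val j t}) = 2 ^ m j"
proof -
  have "{s. s < t \<and> s \<in> acc t \<and> val j s = val j t} = {s \<in> chosen. s < t \<and> val j s = val j t}"
    using acc_iff by blast
  then show ?thesis unfolding fill_def by (simp only: acc_iff lessI simp_thms)
qed

lemma inj_on_val:
  assumes "j < J" "m j = 0"
  shows "inj_on (val j) chosen"
proof -
  have "val j s \<noteq> val j t" if "s \<in> chosen" "t \<in> chosen" "s < t" for s t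
  proof
    assume "val j s = val j t"
    then have "s \<in> {s \<in> chosen. s < t \<and> val j s = val j t}" using that by simp
    moreover have "finite {s \<in> chosen. s < t \<and> val j s = val j t}" by simp
    ultimately have "card {s \<in> chosen. s < t \<and> val j s = val j t} \<noteq> 0" by (metis card_0_eq empty_iff)
    then show False using that(2) chosen_iff[of t] assms by auto
  qed
  then show ?thesis unfolding inj_on_def by (metis linorder_neqE_nat)
qed

text \<open>The number of fibre elements below \<open>x\<close> grows by at most one when
  \<open>x\<close> does, so it hits the capacity exactly; the stage where this happens fills the
  fibre.\<close>

lemma fill_exists:
  assumes "finite chosen" "2 ^ m j \<le> card {s \<in> chosen. val j s = v}"
  shows "\<exists>t. fill j t \<and> val j t = v"
proof -
  define F where "F = {s \<in> chosen. val j s = v}"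
  define x where "x = (LEAST x. 2 ^ m j \<le> card {s \<in> F. s < x})"
  have fF: "finite F" unfolding F_def using assms(1) by simp
  obtain b where b: "\<forall>s\<in>F. s < b" using fF by (metis finite_nat_set_iff_bounded)
  then have "{s \<in> F. s < b} = F" by auto
  then have "2 ^ m j \<le> card {s \<in> F. s < b}" using assms(2) unfolding F_def by simp
  then have x: "2 ^ m j \<le> card {s \<in> F. s < x}" unfolding x_def by (rule LeastI)
  have "x \<noteq> 0" using x by (metis (no_types, lifting) card.empty empty_Collect_eq not_less0 not_one_le_zero one_le_numeral one_le_power order_trans)
  then obtain t where t: "x = Suc t" by (metis not0_implies_Suc)
  have lt: "card {s \<in> F. s < t} < 2 ^ m j"
    using not_less_Least[of t "\<lambda>x. 2 ^ m j \<le> card {s \<in> F. s < x}"] t unfolding x_def[symmetric] by simp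
  have tF: "t \<in> F"
  proof (rule ccontr)
    assume "t \<notin> F"
    then have "{s \<in> F. s < Suc t} = {s \<in> F. s < t}" by (auto simp: less_Suc_eq)
    then show False using x lt t by simp
  qed
  have "{s \<in> F. s < Suc t} = insert t {s \<in> F. s < t}" using tF by auto
  then have "card {s \<in> F. s < Suc t} = Suc (card {s \<in> F. s < t})" using fF by simp
  then have "Suc (card {s \<in> F. s < t}) = 2 ^ m j" using x lt t by simp
  moreover have "{s \<in> F. s < t} = {s \<in> chosen. s < t \<and> val j s = val j t}"
    using tF unfolding F_def by auto
  ultimately have "fill j t" using tF unfolding fill_iff F_def by simp
  then show ?thesis using tF unfolding F_def by blast
qed

text \<open>Each filling stage owns the block of \<open>2 ^ m j\<close> chosen stages of its value
  up to itself. Two blocks that meet share the value, so one would be properly contained in the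
  other although both have the same size.\<close>

lemma card_fill:
  assumes "finite chosen"
  shows "card {t. fill j t} * 2 ^ m j \<le> card chosen"
proof -
  let ?B = "\<lambda>t. {s \<in> chosen. s \<le> t \<and> val j s = val j t}"
  let ?E = "{t. fill j t}"
  have fin: "finite ?E" using assms by (rule finite_subset[rotated]) (auto simp: fill_iff)
  have cB: "card (?B t) = 2 ^ m j" if "fill j t" for t
  proof -
    have "?B t = insert t {s \<in> chosen. s < t \<and> val j s = val j t}"
      using that unfolding fill_iff by auto
    then show ?thesis using that unfolding fill_iff by (simp add: assms)
  qed
  have disj: "?B t \<inter> ?B t' = {}" if "fill j t" "fill j t'" "t < t'" for t t'
  proof (rule ccontr)
    assume "?B t \<inter> ?B t' \<noteq> {}"
    then have "?B t \<subseteq> ?B t'" using that by auto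
    moreover have "t' \<in> ?B t' - ?B t" using that unfolding fill_iff by auto
    ultimately have "?B t \<subset> ?B t'" by blast
    then have "card (?B t) < card (?B t')" using assms by (intro psubset_card_mono) auto
    then show False using cB that by simp
  qed
  have "card ?E * 2 ^ m j = (\<Sum>t\<in>?E. card (?B t))" using cB by simp
  also have "\<dots> = card (\<Union>t\<in>?E. ?B t)"
  proof (rule card_UN_disjoint[symmetric, OF fin])
    show "\<forall>t\<in>?E. finite (?B t)" using assms by simp
    show "\<forall>t\<in>?E. \<forall>t'\<in>?E. t \<noteq> t' \<longrightarrow> ?B t \<inter> ?B t' = {}"
    proof (intro ballI impI)
      fix t t' assume "t \<in> ?E" "t' \<in> ?E" "t \<noteq> t'"
      then show "?B t \<inter> ?B t' = {}" using disj[of t t'] disj[of t' t] by (cases "t < t'") auto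
    qed
  qed
  also have "\<dots> \<le> card chosen" by (rule card_mono[OF assms]) auto
  finally show ?thesis .
qed

lemma card_fiber_le:
  assumes "finite chosen" "j < J"
  shows "card {s \<in> chosen. val j s = v} \<le> 2 ^ m j"
proof (cases "{s \<in> chosen. val j s = v} = {}")
  case False
  let ?F = "{s \<in> chosen. val j s = v}"
  have fin: "finite ?F" using assms by simp
  define t where "t = Max ?F"
  have t: "t \<in> ?F" unfolding t_def by (rule Max_in[OF fin False])
  have "s \<le> t" if "s \<in> ?F" for s using Max_ge[OF fin that] unfolding t_def .
  then have "?F = insert t {s \<in> chosen. s < t \<and> val j s = val j t}"
    using t by (auto simp: le_less)
  then have "card ?F = Suc (card {s \<in> chosen. s < t \<and> val j s = val j t})"
    using assms by simp
  then show ?thesis using t assms(2) chosen_iff[of t] by auto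
next
  case True
  then show ?thesis by (simp only: card.empty zero_le)
qed

end

text \<open>A stage carries a tuple \<open>z\<close> as digit 0 and a time bound as digit 1.
  \<open>S s p = Suc x\<close> means that program \<open>p\<close> is seen to print \<open>x\<close>
  within bound \<open>s\<close>, so the range of \<open>p\<close> covers the programs of length at
  most \<open>k j\<close>.\<close>

definition low_complexity :: "(nat \<Rightarrow> nat \<Rightarrow> nat) \<Rightarrow> (nat \<Rightarrow> nat \<Rightarrow> nat) \<Rightarrow> nat \<Rightarrow> (nat \<Rightarrow> nat) \<Rightarrow> nat \<Rightarrow> bool" where
  "low_complexity S \<pi> J k t \<longleftrightarrow>
     (\<forall>j<J. \<exists>p<2 ^ Suc (k j) - 1. S (digit t 1) p = Suc (\<pi> j (digit t 0)))"

text \<open>The set \<open>acc t\<close> as a bit mask, so that the selection is a primitive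
  recursion on numbers. Digits \<open>0\<close> to \<open>J - 1\<close> of \<open>w\<close> are the
  complexity bounds, digits \<open>J\<close> to \<open>2 * J - 1\<close> the capacities.\<close>

definition history :: "(nat \<Rightarrow> nat \<Rightarrow> nat) \<Rightarrow> (nat \<Rightarrow> nat \<Rightarrow> nat) \<Rightarrow> nat \<Rightarrow> nat \<Rightarrow> nat \<Rightarrow> nat" where
  "history S \<pi> J w t = rec_nat 0 (\<lambda>t h.
     if low_complexity S \<pi> J (digit w) t \<and>
       (\<forall>j<J. card {s. s < t \<and> (h div 2 ^ s) mod 2 = 1 \<and> \<pi> j (digit s 0) = \<pi> j (digit t 0)}
          < 2 ^ digit w (J + j))
     then h + 2 ^ t else h) t"

context
  fixes S :: "nat \<Rightarrow> nat \<Rightarrow> nat" and \<pi> :: "nat \<Rightarrow> nat \<Rightarrow> nat" and J :: nat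
  assumes S: "computable 2 (\<lambda>xs. S (hd xs) (hd (tl xs)))"
    and \<pi>: "\<And>j. j < J \<Longrightarrow> computable 1 (\<lambda>xs. \<pi> j (hd xs))"
begin

text \<open>From index \<open>J\<close> on, the digits of \<open>w\<close> would run into the part
  that holds the rank. The default 0 makes the selection depend on the parameters alone.\<close>

abbreviation "acc_of w \<equiv> greedy.acc (low_complexity S \<pi> J (digit w)) (\<lambda>j t. \<pi> j (digit t 0)) J
   (\<lambda>j. if j < J then digit w (J + j) else 0)"
abbreviation "fill_of w \<equiv> greedy.fill (low_complexity S \<pi> J (digit w)) (\<lambda>j t. \<pi> j (digit t 0)) J
   (\<lambda>j. if j < J then digit w (J + j) else 0)"

lemma set_encode_bit:
  assumes "finite A"
  shows "(set_encode A div 2 ^ s) mod 2 = 1 \<longleftrightarrow> s \<in> A"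
proof -
  have "s \<in> set_decode (set_encode A) \<longleftrightarrow> odd (set_encode A div 2 ^ s)" by (simp add: set_decode_def)
  then show ?thesis using assms by (simp add: odd_iff_mod_2_eq_one)
qed

lemma history_eq: "history S \<pi> J w t = set_encode (acc_of w t)"
proof (induction t)
  case 0
  then show ?case by (simp add: history_def greedy.acc.simps)
next
  case (Suc t)
  have fin: "finite (acc_of w t)" by (rule greedy.finite_acc)
  have "t \<notin> acc_of w t" using greedy.acc_less by blast
  then have "set_encode (insert t (acc_of w t)) = set_encode (acc_of w t) + 2 ^ t"
    using fin by (simp add: set_encode_insert)
  then show ?case
    unfolding greedy.acc.simps history_def old.nat.simps
    unfolding history_def[symmetric] Suc set_encode_bit[OF fin] by simp
qed

lemma computable_\<pi>: "j < J \<Longrightarrow> computable n f \<Longrightarrow> computable n (\<lambda>xs. \<pi> j (f xs))"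
  by (rule computable_app1[OF \<pi>])

lemma decidable_low_complexity:
  assumes "computable n f" "computable n g"
  shows "decidable n (\<lambda>xs. low_complexity S \<pi> J (digit (f xs)) (g xs))"
  unfolding low_complexity_def
  by (intro decidable_all_finite computable_intros computable_digit computable_app2[OF S]
      computable_\<pi> computable_drop1 assms) simp_all

lemma computable_history:
  assumes "computable n f" "computable n g"
  shows "computable n (\<lambda>xs. history S \<pi> J (f xs) (g xs))"
  unfolding history_def
  by (intro computable_rec assms decidable_low_complexity computable_intros decidable_all_finite
      computable_digit computable_\<pi> computable_drop1[OF computable_drop2] computable_drop2) simp_all

lemma decidable_fill:
  assumes "computable n f" "computable n g" "j < J"
  shows "decidable n (\<lambda>xs. fill_of (f xs) j (g xs))"
  unfolding greedy.fill_def set_encode_bit[OF greedy.finite_acc, symmetric] history_eq[symmetric] if_P[OF assms(3)]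
  by (intro computable_intros computable_history computable_digit computable_\<pi> computable_drop1 assms) simp_all

text \<open>A value that fills up is computed from the parameters of the selection and the rank of
  its filling stage, both packed into \<open>w\<close>.\<close>

lemma complexity_fill:
  assumes "universal U"
  shows "\<exists>c. \<forall>j<J. \<forall>w t. fill_of w j t \<and> card {s. s < t \<and> fill_of w j s} = remainder w (2 * J)
    \<longrightarrow> nat_complexity U (\<pi> j (digit t 0)) \<le> string_length w + c"
proof (rule bounded_stages)
  show "\<forall>j<J. \<exists>c. \<forall>w t. fill_of w j t \<and> card {s. s < t \<and> fill_of w j s} = remainder w (2 * J)
    \<longrightarrow> nat_complexity U (\<pi> j (digit t 0)) \<le> string_length w + c"
  proof (intro allI impI)
    fix j assume j: "j < J"
    let ?P = "\<lambda>w t. fill_of w j t \<and> card {s. s < t \<and> fill_of w j s} = remainder w (2 * J)"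
    have "decidable 2 (\<lambda>xs. ?P (hd xs) (hd (tl xs)))"
      by (intro computable_intros decidable_fill computable_remainder j) simp_all
    moreover have "computable 2 (\<lambda>xs. \<pi> j (digit (hd (tl xs)) 0))"
      by (intro computable_\<pi>[OF j] computable_digit computable_intros) simp
    ultimately obtain c where c: "\<And>w t. ?P w t \<Longrightarrow> (\<And>t'. t' < t \<Longrightarrow> \<not> ?P w t') \<Longrightarrow>
        nat_complexity U (\<pi> j (digit t 0)) \<le> string_length w + c"
      by (rule complexity_search[OF assms]) blast
    \<comment> \<open>The rank increases strictly along the filling stages, so a stage of the
      prescribed rank is also the first one the search meets.\<close>
    have "nat_complexity U (\<pi> j (digit t 0)) \<le> string_length w + c" if P: "?P w t" for w t
    proof (rule c[OF P])
      fix t' assume "t' < t"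
      show "\<not> ?P w t'"
      proof
        assume P': "?P w t'"
        then have "{s. s < t' \<and> fill_of w j s} \<subset> {s. s < t \<and> fill_of w j s}"
          using \<open>t' < t\<close> by auto
        then have "card {s. s < t' \<and> fill_of w j s} < card {s. s < t \<and> fill_of w j s}"
          by (intro psubset_card_mono) auto
        then show False using P P' by simp
      qed
    qed
    then show "\<exists>c. \<forall>w t. ?P w t \<longrightarrow> nat_complexity U (\<pi> j (digit t 0)) \<le> string_length w + c"
      by blast
  qed
qed (meson add_left_mono order_trans)

end

section \<open>Existence of a typical set\<close>

lemma exists_linear_less_power:
  fixes a b :: nat
  shows "\<exists>l. a * l + b < 2 ^ l"
proof -
  define k where "k = a + b + 1"
  have "a * (3 * k) + b < (Suc k) ^ 3"
  proof -
    have "a * (3 * k) \<le> k * (3 * k)" unfolding k_def by (intro mult_right_mono) auto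
    moreover have "b < 3 * k + 1" unfolding k_def by simp
    moreover have "(Suc k) ^ 3 = k * k * k + k * (3 * k) + 3 * k + 1"
      by (simp add: power3_eq_cube algebra_simps)
    ultimately show ?thesis by linarith
  qed
  also have "(Suc k) ^ 3 \<le> (2 ^ k) ^ 3"
    by (intro power_mono) (auto simp: Suc_le_eq)
  also have "(2 ^ k) ^ 3 = (2::nat) ^ (3 * k)" by (simp add: power_mult[symmetric] mult.commute)
  finally show ?thesis by blast
qed

lemma exists_power_between:
  assumes "0 < (n::nat)"
  obtains q where "n \<le> 2 ^ q" "2 ^ q \<le> 2 * n"
proof -
  define q where "q = (LEAST q. n \<le> 2 ^ q)"
  have q: "n \<le> 2 ^ q" unfolding q_def by (rule LeastI[of _ n]) (simp add: less_imp_le)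
  have "2 ^ q \<le> 2 * n"
  proof (cases q)
    case 0
    then show ?thesis using assms by simp
  next
    case (Suc p)
    then have "\<not> n \<le> 2 ^ p" using not_less_Least[of p "\<lambda>q. n \<le> 2 ^ q"] unfolding q_def by simp
    then show ?thesis using Suc by simp
  qed
  then show ?thesis using q that by blast
qed

text \<open>The greedy selection is run with the complexities of the values of \<open>z\<close> as parameters. The values
  whose fibre fills up are few and enumerable, hence simple, so the fibres of \<open>z\<close> do not fill up. For
  \<open>j = 0\<close> fibres have capacity 1, hence some stage with the same value \<open>\<pi> 0 z\<close> is chosen. Since it is
  described by its rank, the chosen set has almost \<open>2 ^ nat_complexity U (\<pi> 0 z)\<close> elements.\<close>

lemma typical_set:
  fixes \<pi> :: "nat \<Rightarrow> nat \<Rightarrow> nat"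
  assumes U: "universal U" and J: "0 < J"
    and \<pi>: "\<And>j. j < J \<Longrightarrow> computable 1 (\<lambda>xs. \<pi> j (hd xs))"
    and det: "\<And>j z z'. j < J \<Longrightarrow> \<pi> 0 z = \<pi> 0 z' \<Longrightarrow> \<pi> j z = \<pi> j z'"
  shows "\<exists>c. \<forall>z r. (\<forall>j<J. nat_complexity U (\<pi> j z) < 2 ^ r) \<longrightarrow>
    (\<exists>(A :: nat set) g m. finite A \<and> A \<noteq> {} \<and>
      2 ^ nat_complexity U (\<pi> 0 z) \<le> card A * 2 ^ (c * Suc r) \<and>
      (\<forall>j<J. card ((\<lambda>t. \<pi> j (g t)) ` A) \<le> 2 ^ Suc (nat_complexity U (\<pi> j z)) \<and>
        m j + nat_complexity U (\<pi> j z) \<le> nat_complexity U (\<pi> 0 z) + c * Suc r \<and>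
        (\<forall>v. card {t \<in> A. \<pi> j (g t) = v} \<le> 2 ^ m j)))"
proof -
  obtain rU where rU: "\<And>p y x. U p y = Some x \<longleftrightarrow> computes rU [string_nat p, string_nat y] (string_nat x)"
    using U unfolding universal_def partial_computable_def by blast
  define S where "S s p = eval_steps rU s [p, 0]" for s p
  have "computable_list 2 3 (\<lambda>xs. [hd xs, hd (tl xs), 0])"
    using computable_list_Cons[OF _ computable_list_Cons[OF _ computable_list_Cons[OF _ computable_list_Nil]],
        of 2 "\<lambda>xs. hd xs" "\<lambda>xs. hd (tl xs)" "\<lambda>_. 0"]
    by (simp add: computable_hd_tl computable_const numeral_3_eq_3)
  from computable_app[OF computable_eval_steps[of 2 rU, unfolded Suc_numeral, simplified] this]
  have S: "computable 2 (\<lambda>xs. S (hd xs) (hd (tl xs)))" unfolding S_def by simp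
  have S_sound: "computes rU [p, 0] x" if "S s p = Suc x" for s p x
    using eval_steps_sound that unfolding S_def by blast
  let ?K = "nat_complexity U"
  have S_complete: "\<exists>p<2 ^ Suc k - 1. \<exists>s. \<forall>s'\<ge>s. S s' p = Suc x" if k: "?K x \<le> k" for k x
  proof -
    obtain p where p: "length p = ?K x" "U p [] = Some (inv string_nat x)"
      using nat_complexity_attained[OF U] .
    then have "computes rU [string_nat p, 0] x" using rU[of p "[]" "inv string_nat x"] by simp
    then obtain s where "S s (string_nat p) = Suc x" unfolding S_def using eval_steps_complete by blast
    then have "\<forall>s'\<ge>s. S s' (string_nat p) = Suc x" unfolding S_def using eval_steps_mono by blast
    moreover have "string_nat p < 2 ^ Suc k - 1"
      using string_length_le_iff[of "string_nat p" k] p(1) k by (simp add: string_length_def)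
    ultimately show ?thesis by blast
  qed
  \<comment> \<open>One factor \<open>l\<close> for each of the \<open>2 * J\<close> parameters and
    one for the prefix that fixes the digit width.\<close>
  define D where "D = Suc (2 * J)"
  define val where "val j t = \<pi> j (digit t 0)" for j t
  let ?fill = "\<lambda>w. greedy.fill (low_complexity S \<pi> J (digit w)) val J (\<lambda>j. if j < J then digit w (J + j) else 0)"
  obtain c where c: "\<And>j w t. j < J \<Longrightarrow> ?fill w j t \<Longrightarrow>
      card {s. s < t \<and> ?fill w j s} = remainder w (2 * J) \<Longrightarrow> ?K (val j t) \<le> string_length w + c"
    using complexity_fill[of S J \<pi>, OF S \<pi> U] unfolding val_def by blast
  \<comment> \<open>The last summand \<open>D\<close> absorbs the term \<open>D * r\<close> that
    arises from \<open>l = r + l0\<close>, so that \<open>e\<close> is at most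
    \<open>Y l0 * Suc r\<close>.\<close>
  define Y where "Y l = D * l + (c + 4 + D)" for l
  \<comment> \<open>The parameters include \<open>e\<close>, which grows linearly with the digit
    width in which they must fit; \<open>l0\<close> resolves this circularity.\<close>
  obtain l0 where l0: "Y l0 < 2 ^ l0"
    using exists_linear_less_power[of D "c + 4 + D"] unfolding Y_def by blast
  show ?thesis
  proof (intro exI[of _ "Y l0"] allI impI)
    fix z r
    assume small: "\<forall>j<J. ?K (\<pi> j z) < 2 ^ r"
    define k where "k j = ?K (\<pi> j z)" for j
    define l where "l = r + l0"
    \<comment> \<open>The slack exceeds the \<open>D * l + c + 2\<close> bits that the description
      of a filling stage costs besides \<open>k 0 - m j\<close>, and leaves one bit to spare for
      rounding in \<open>card_lower\<close>.\<close>
    define e where "e = D * l + c + 4"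
    \<comment> \<open>The expected size of a fibre is about \<open>2 ^ (k 0 - k j)\<close>, enlarged
      by the slack. Capacity one at \<open>j = 0\<close> makes chosen stages differ in
      \<open>\<pi> 0\<close>.\<close>
    define m where "m j = (if j = 0 then 0 else k 0 + e - k j)" for j :: nat
    have e_le: "e \<le> Y l0 * Suc r" unfolding e_def l_def Y_def by (simp add: algebra_simps)
    have bound: "k 0 + e < 2 ^ l"
    proof -
      have "k 0 < 2 ^ r" using small J unfolding k_def by simp
      moreover have "e \<le> 2 ^ r * (2 ^ l0 - 1)"
      proof -
        have "Suc r \<le> 2 ^ r" by (simp add: Suc_le_eq)
        moreover have "Y l0 \<le> 2 ^ l0 - 1" using l0 by simp
        ultimately have "Suc r * Y l0 \<le> 2 ^ r * (2 ^ l0 - 1)" by (rule mult_le_mono)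
        then show ?thesis using e_le by (simp add: mult.commute)
      qed
      moreover have "2 ^ r * (2 ^ l0 - 1) + 2 ^ r = (2::nat) ^ l"
        unfolding l_def power_add by (simp add: diff_mult_distrib2)
      ultimately show ?thesis by linarith
    qed
    have k_l: "k j < 2 ^ l" if "j < J" for j
    proof -
      have "k j < 2 ^ r" using small that unfolding k_def by simp
      also have "(2::nat) ^ r \<le> 2 ^ l" unfolding l_def by simp
      finally show ?thesis .
    qed
    have m_l: "m j < 2 ^ l" for j using bound unfolding m_def by auto
    define ds where "ds = map k [0..<J] @ map m [0..<J]"
    have ds: "\<forall>d\<in>set ds. d < 2 ^ l" "length ds = 2 * J" unfolding ds_def using k_l m_l by auto
    have dk: "digit (pack l ds b) j = k j" and dm: "digit (pack l ds b) (J + j) = m j" if "j < J" for j b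
      using that digit_pack[OF ds(1), of j b] digit_pack[OF ds(1), of "J + j" b] ds(2)
      by (simp_all add: ds_def nth_append)
    define cand where "cand = low_complexity S \<pi> J k"
    define m' where "m' j = (if j < J then m j else 0)" for j
    interpret greedy cand val J m' .
    have cand_eq: "low_complexity S \<pi> J (digit (pack l ds b)) = cand" for b
      unfolding cand_def by (intro ext) (simp add: low_complexity_def dk)
    have m_eq: "(\<lambda>j. if j < J then digit (pack l ds b) (J + j) else 0) = m'" for b
      unfolding m'_def using dm by auto
    have complexity_bound: "?K (val j t) \<le> string_length (pack l ds (card {s. s < t \<and> fill j s})) + c"
      if "j < J" "fill j t" for j t
      by (rule c[OF that(1)]) (use that(2) in \<open>simp_all add: cand_eq m_eq remainder_pack[OF ds(1)] flip: ds(2)\<close>)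
    have computes_val: "\<exists>p<2 ^ Suc (k j). computes rU [p, 0] (val j t)" if t: "t \<in> chosen" and j: "j < J" for t j
    proof -
      have "cand t" using t chosen_iff by blast
      then obtain p where p: "p < 2 ^ Suc (k j) - 1" "S (digit t 1) p = Suc (val j t)"
        using j unfolding cand_def low_complexity_def val_def by blast
      have "p < 2 ^ Suc (k j)" using p(1) by simp
      then show ?thesis using S_sound[OF p(2)] by blast
    qed
    have image_bound: "finite (val j ` chosen)" "card (val j ` chosen) \<le> 2 ^ Suc (k j)" if j: "j < J" for j
    proof -
      have "val j ` chosen \<subseteq> (\<lambda>p. THE v. computes rU [p, 0] v) ` {..<2 ^ Suc (k j)}"
      proof
        fix v assume "v \<in> val j ` chosen"
        then obtain p where p: "p < 2 ^ Suc (k j)" "computes rU [p, 0] v" using computes_val[OF _ j] by blast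
        then have "(THE v. computes rU [p, 0] v) = v" using computes_det by blast
        then show "v \<in> (\<lambda>p. THE v. computes rU [p, 0] v) ` {..<2 ^ Suc (k j)}" using p(1) by blast
      qed
      from finite_subset[OF this] surj_card_le[OF _ this]
      show "finite (val j ` chosen)" "card (val j ` chosen) \<le> 2 ^ Suc (k j)" by simp_all
    qed
    have inj: "inj_on (val 0) chosen" by (rule inj_on_val[OF J]) (simp add: m'_def m_def)
    \<comment> \<open>There are infinitely many stages, since every tuple recurs with all time
      bounds; finiteness comes from the few possible values of \<open>val 0\<close>.\<close>
    have fin: "finite chosen" by (rule finite_imageD[OF image_bound(1)[OF J] inj])
    have card_chosen: "card chosen \<le> 2 ^ Suc (k 0)"
      using image_bound(2)[OF J] card_image[OF inj] by simp
    have Suc_index: "Suc (card {s. s < t \<and> fill j s}) \<le> card {t. fill j t}" if "fill j t" for j t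
    proof -
      have "finite {t. fill j t}" using fin by (rule finite_subset[rotated]) (auto simp: fill_iff)
      then have "card {s. s < t \<and> fill j s} < card {t. fill j t}"
        by (rule psubset_card_mono) (use that in auto)
      then show ?thesis by simp
    qed
    \<comment> \<open>The blocks of the filling stages are disjoint inside at most
      \<open>2 ^ Suc (k 0)\<close> chosen stages, so a rank takes only
      \<open>Suc (k 0) - m j\<close> bits.\<close>
    have complexity_fill_le: "?K (val j t) + m j \<le> D * l + c + 2 + k 0" if j: "j < J" and t: "fill j t" for j t
    proof -
      let ?b = "card {s. s < t \<and> fill j s}"
      have "Suc ?b * 2 ^ m j \<le> card {t. fill j t} * 2 ^ m j"
        by (rule mult_right_mono[OF Suc_index[OF t]]) simp
      also have "\<dots> \<le> card chosen" using card_fill[OF fin, of j] j by (simp add: m'_def)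
      also note card_chosen
      finally have le: "Suc ?b * 2 ^ m j \<le> 2 ^ Suc (k 0)" .
      have "2 ^ m j \<le> Suc ?b * 2 ^ m j" by simp
      then have "2 ^ m j \<le> (2::nat) ^ Suc (k 0)" using le by (rule order_trans)
      then have mk: "m j \<le> Suc (k 0)" by (rule power_le_imp_le_exp[rotated]) simp
      then have "(2::nat) ^ Suc (k 0) = 2 ^ (Suc (k 0) - m j) * 2 ^ m j" by (simp flip: power_add)
      then have "Suc ?b \<le> 2 ^ (Suc (k 0) - m j)" using le by (metis mult_le_cancel2 pos2 zero_less_power)
      from string_length_pack[OF ds(1) this]
      have "?K (val j t) \<le> l * D + 1 + (Suc (k 0) - m j) + c"
        using complexity_bound[OF j t] unfolding ds(2) D_def by linarith
      then show ?thesis using mk by (simp add: mult.commute)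
    qed
    \<comment> \<open>At the given tuple the capacity is so large that a full fibre would yield a
      description of \<open>\<pi> j z\<close> shorter than \<open>k j\<close>.\<close>
    have no_fill: False if "j < J" "j \<noteq> 0" "fill j t" "val j t = \<pi> j z" for j t
    proof -
      have "k j + m j \<le> D * l + c + 2 + k 0"
        using complexity_fill_le[OF that(1,3)] that(4) by (simp add: k_def)
      then show False using that(2) unfolding m_def e_def by auto
    qed
    obtain t1 where t1: "cand t1" "digit t1 0 = z"
    proof -
      have "\<exists>s. \<forall>j<J. \<exists>p<2 ^ Suc (k j) - 1. \<forall>s'\<ge>s. S s' p = Suc (\<pi> j z)"
      proof (rule bounded_stages)
        show "\<forall>j<J. \<exists>s. \<exists>p<2 ^ Suc (k j) - 1. \<forall>s'\<ge>s. S s' p = Suc (\<pi> j z)"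
        proof (intro allI impI)
          fix j
          obtain p s where "p < 2 ^ Suc (k j) - 1" "\<forall>s'\<ge>s. S s' p = Suc (\<pi> j z)"
            using S_complete[of "\<pi> j z" "k j"] unfolding k_def by blast
          then show "\<exists>s. \<exists>p<2 ^ Suc (k j) - 1. \<forall>s'\<ge>s. S s' p = Suc (\<pi> j z)" by blast
        qed
      qed (meson order_trans)
      then obtain s where s: "\<forall>j<J. \<exists>p<2 ^ Suc (k j) - 1. S s p = Suc (\<pi> j z)" by blast
      \<comment> \<open>The stage that pairs \<open>z\<close> with the time bound \<open>s\<close>;
        both numbers fit into digits of width \<open>z + s\<close>.\<close>
      have "z < 2 ^ (z + s)" "s < 2 ^ (z + s)"
        by (metis le_add1 le_add2 less_exp less_le_trans one_le_numeral power_increasing)+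
      then have "digit (pack (z + s) [z, s] 0) 0 = z" "digit (pack (z + s) [z, s] 0) 1 = s"
        using digit_pack[of "[z, s]" "z + s" 0 0] digit_pack[of "[z, s]" "z + s" 1 0] by auto
      then show ?thesis using s by (intro that[of "pack (z + s) [z, s] 0"]) (simp_all add: cand_def low_complexity_def)
    qed
    have full: "\<exists>t. fill j t \<and> val j t = \<pi> j z"
      if j: "j < J" and card: "2 ^ m' j \<le> card {s \<in> chosen. val j s = \<pi> j z}" for j
      by (rule fill_exists[OF fin card])
    \<comment> \<open>If the stage \<open>t1\<close> of \<open>z\<close> was rejected, one of its
      values was already full. This can happen only for \<open>j = 0\<close>, and then the stage
      that filled it carries the same value \<open>\<pi> 0 z\<close>.\<close>
    obtain t0 where t0: "t0 \<in> chosen" "val 0 t0 = \<pi> 0 z"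
    proof (cases "t1 \<in> chosen")
      case True
      then show ?thesis using that t1(2) by (simp add: val_def)
    next
      case False
      then obtain j where j: "j < J" "2 ^ m' j \<le> card {s \<in> chosen. s < t1 \<and> val j s = val j t1}"
        using t1(1) chosen_iff[of t1] by (meson not_less)
      have "card {s \<in> chosen. s < t1 \<and> val j s = val j t1} \<le> card {s \<in> chosen. val j s = \<pi> j z}"
        by (rule card_mono) (use fin t1(2) in \<open>auto simp: val_def\<close>)
      then obtain t where t: "fill j t" "val j t = \<pi> j z" using full[OF j(1)] j(2) by (meson order_trans)
      then have "j = 0" using no_fill[OF j(1)] by blast
      then show ?thesis using that t fill_iff by blast
    qed
    have card_pos: "1 \<le> card {s \<in> chosen. val j s = \<pi> j z}" if "j < J" for j
    proof -
      have "val j t0 = \<pi> j z" using det[OF that, of "digit t0 0" z] t0(2) unfolding val_def by simp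
      then have "{s \<in> chosen. val j s = \<pi> j z} \<noteq> {}" using t0(1) by blast
      then show ?thesis using fin by (simp add: Suc_le_eq card_gt_0_iff)
    qed
    \<comment> \<open>The subtraction in \<open>m\<close> truncates. If \<open>k j\<close> exceeded
      \<open>k 0 + e\<close>, the capacity would be one and the fibre, nonempty because of
      \<open>t0\<close>, would be full.\<close>
    have m_bound: "m j + k j \<le> k 0 + e" if j: "j < J" for j
    proof (rule ccontr)
      assume "\<not> m j + k j \<le> k 0 + e"
      then have "j \<noteq> 0" "m j = 0" unfolding m_def by (auto split: if_splits)
      have m0: "m' j = 0" using \<open>m j = 0\<close> by (simp add: m'_def)
      have "\<exists>t. fill j t \<and> val j t = \<pi> j z"
        by (rule full[OF j]) (use card_pos[OF j] m0 in simp)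
      then show False using no_fill[OF j \<open>j \<noteq> 0\<close>] by blast
    qed
    \<comment> \<open>For \<open>j = 0\<close> every chosen stage fills its value, so the rank is
      taken among the chosen stages. Rounding their number up to a power of two costs one bit, which
      is why \<open>e - 1\<close> appears.\<close>
    have card_lower: "2 ^ k 0 \<le> card chosen * 2 ^ e"
    proof -
      have m0: "m' 0 = 0" by (simp add: m'_def m_def)
      have "\<exists>t. fill 0 t \<and> val 0 t = \<pi> 0 z"
        by (rule full[OF J]) (use card_pos[OF J] m0 in simp)
      then obtain t where t: "fill 0 t" "val 0 t = \<pi> 0 z" by blast
      have pos: "0 < card chosen" using t0(1) fin by (auto simp: card_gt_0_iff)
      obtain q where q: "card chosen \<le> 2 ^ q" "2 ^ q \<le> 2 * card chosen" using exists_power_between[OF pos] .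
      have "card {t. fill 0 t} \<le> card chosen" using card_fill[OF fin, of 0] m0 by simp
      then have "Suc (card {s. s < t \<and> fill 0 s}) \<le> 2 ^ q" using Suc_index[OF t(1)] q(1) by linarith
      from string_length_pack[OF ds(1) this] complexity_bound[OF J t(1)] t(2)
      have "k 0 \<le> (e - 1) + q" unfolding ds(2) k_def e_def D_def by (simp add: algebra_simps)
      then have "2 ^ k 0 \<le> (2::nat) ^ ((e - 1) + q)" by (rule power_increasing) simp
      also have "\<dots> \<le> 2 ^ (e - 1) * (2 * card chosen)" unfolding power_add using q(2) by simp
      also have "\<dots> = card chosen * 2 ^ Suc (e - 1)" by simp
      also have "Suc (e - 1) = e" unfolding e_def by simp
      finally show ?thesis .
    qed
    have e_power: "2 ^ e \<le> (2::nat) ^ (Y l0 * Suc r)" by (rule power_increasing[OF e_le]) simp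
    have "finite chosen \<and> chosen \<noteq> {} \<and>
      2 ^ k 0 \<le> card chosen * 2 ^ (Y l0 * Suc r) \<and>
      (\<forall>j<J. card ((\<lambda>t. \<pi> j (digit t 0)) ` chosen) \<le> 2 ^ Suc (k j) \<and>
        m j + k j \<le> k 0 + Y l0 * Suc r \<and>
        (\<forall>v. card {t \<in> chosen. \<pi> j (digit t 0) = v} \<le> 2 ^ m j))"
    proof (intro conjI allI impI)
      show "finite chosen" "chosen \<noteq> {}" using fin t0(1) by auto
      show "2 ^ k 0 \<le> card chosen * 2 ^ (Y l0 * Suc r)"
        using card_lower e_power by (meson le_trans mult_le_mono2)
    next
      fix j assume j: "j < J"
      show "card ((\<lambda>t. \<pi> j (digit t 0)) ` chosen) \<le> 2 ^ Suc (k j)"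
        using image_bound(2)[OF j] unfolding val_def .
      show "m j + k j \<le> k 0 + Y l0 * Suc r" using m_bound[OF j] e_le by linarith
      fix v
      show "card {t \<in> chosen. \<pi> j (digit t 0) = v} \<le> 2 ^ m j"
        using card_fiber_le[OF fin j, of v] j unfolding val_def m'_def by simp
    qed
    then show "\<exists>(A :: nat set) g m. finite A \<and> A \<noteq> {} \<and>
      2 ^ ?K (\<pi> 0 z) \<le> card A * 2 ^ (Y l0 * Suc r) \<and>
      (\<forall>j<J. card ((\<lambda>t. \<pi> j (g t)) ` A) \<le> 2 ^ Suc (?K (\<pi> j z)) \<and>
        m j + ?K (\<pi> j z) \<le> ?K (\<pi> 0 z) + Y l0 * Suc r \<and>
        (\<forall>v. card {t \<in> A. \<pi> j (g t) = v} \<le> 2 ^ m j))"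
      unfolding k_def by (intro exI[of _ chosen] exI[of _ "\<lambda>t. digit t 0"] exI[of _ m])
  qed
qed

section \<open>Entropy of finite distributions\<close>

text \<open>Random variables are functions on the sample space. The entropy of a set \<open>F\<close> of them is that of
  the joint variable, so that set operations on \<open>F\<close> express joint entropies.\<close>

definition agree :: "('w \<Rightarrow> 'v) set \<Rightarrow> 'w \<Rightarrow> 'w \<Rightarrow> bool" where
  "agree F x y \<longleftrightarrow> (\<forall>f\<in>F. f x = f y)"

definition mass :: "'w set \<Rightarrow> ('w \<Rightarrow> real) \<Rightarrow> ('w \<Rightarrow> 'v) set \<Rightarrow> 'w \<Rightarrow> real" where
  "mass \<Omega> w F x = (\<Sum>y\<in>{y\<in>\<Omega>. agree F x y}. w y)"

definition entropy :: "'w set \<Rightarrow> ('w \<Rightarrow> real) \<Rightarrow> ('w \<Rightarrow> 'v) set \<Rightarrow> real" where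
  "entropy \<Omega> w F = - (\<Sum>x\<in>\<Omega>. w x * log 2 (mass \<Omega> w F x))"

text \<open>Strict positivity of the weights keeps every mass positive, so all logarithms are taken
  in their proper domain.\<close>

definition distribution :: "'w set \<Rightarrow> ('w \<Rightarrow> real) \<Rightarrow> bool" where
  "distribution \<Omega> w \<longleftrightarrow> finite \<Omega> \<and> (\<forall>x\<in>\<Omega>. 0 < w x) \<and> sum w \<Omega> = 1"

text \<open>\<open>Z\<close> may be smaller than the intersection. The case \<open>F = G\<close> is
  monotonicity, and instances with explicitly listed variables stay valid when some of the variables
  coincide.\<close>

definition submodular :: "('f set \<Rightarrow> real) \<Rightarrow> bool" where
  "submodular h \<longleftrightarrow> (\<forall>F G Z. Z \<subseteq> F \<longrightarrow> Z \<subseteq> G \<longrightarrow> h (F \<union> G) + h Z \<le> h F + h G)"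

lemma submodularD:
  "submodular h \<Longrightarrow> Z \<subseteq> F \<Longrightarrow> Z \<subseteq> G \<Longrightarrow> F \<union> G = T \<Longrightarrow> h T + h Z \<le> h F + h G"
  unfolding submodular_def by blast

definition info :: "('f set \<Rightarrow> real) \<Rightarrow> 'f \<Rightarrow> 'f \<Rightarrow> real" where
  "info h x y = h {x} + h {y} - h {x, y}"

definition cond_info :: "('f set \<Rightarrow> real) \<Rightarrow> 'f \<Rightarrow> 'f \<Rightarrow> 'f \<Rightarrow> real" where
  "cond_info h x y z = h {x, z} + h {y, z} - h {x, y, z} - h {z}"

definition ingleton :: "('f set \<Rightarrow> real) \<Rightarrow> 'f \<Rightarrow> 'f \<Rightarrow> 'f \<Rightarrow> 'f \<Rightarrow> real" where
  "ingleton h a b c d = cond_info h c d a + cond_info h c d b + info h a b - info h c d"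

lemma agree_sym: "agree F x y \<longleftrightarrow> agree F y x"
  unfolding agree_def by metis

lemma agree_trans: "agree F x y \<Longrightarrow> agree F y z \<Longrightarrow> agree F x z"
  unfolding agree_def by metis

lemma agree_refl [simp]: "agree F x x"
  unfolding agree_def by simp

lemma agree_mono: "agree F x y \<Longrightarrow> G \<subseteq> F \<Longrightarrow> agree G x y"
  unfolding agree_def by blast

lemma agree_Un: "agree (F \<union> G) x y \<longleftrightarrow> agree F x y \<and> agree G x y"
  unfolding agree_def by blast

lemma mass_cong: "agree F x y \<Longrightarrow> mass \<Omega> w F x = mass \<Omega> w F y"
  unfolding mass_def by (metis agree_sym agree_trans)

lemma mass_pos:
  assumes "distribution \<Omega> w" "x \<in> \<Omega>"
  shows "0 < mass \<Omega> w F x"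
proof -
  have "0 < w x" using assms unfolding distribution_def by blast
  also have "w x \<le> mass \<Omega> w F x"
    unfolding mass_def using assms
    by (intro member_le_sum) (auto simp: distribution_def less_imp_le)
  finally show ?thesis .
qed

lemma entropy_cong:
  assumes "\<And>x y. x \<in> \<Omega> \<Longrightarrow> y \<in> \<Omega> \<Longrightarrow> agree F x y \<longleftrightarrow> agree G x y"
  shows "entropy \<Omega> w F = entropy \<Omega> w G"
proof -
  have "mass \<Omega> w F x = mass \<Omega> w G x" if "x \<in> \<Omega>" for x
    unfolding mass_def using assms[OF that] by (intro sum.cong) auto
  then show ?thesis unfolding entropy_def by simp
qed

text \<open>Nonnegativity of conditional mutual information, by Gibbs' inequality: the difference of
  the two sides is the mean of \<open>log 2 (r x)\<close>, and \<open>ln r \<le> r - 1\<close>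
  reduces the claim to the mean of \<open>r\<close> being at most 1.\<close>

lemma submodular_entropy:
  assumes dist: "distribution \<Omega> w"
  shows "submodular (entropy \<Omega> w)"
proof -
  have fin: "finite \<Omega>" and wpos: "\<And>x. x \<in> \<Omega> \<Longrightarrow> 0 < w x" and w1: "sum w \<Omega> = 1"
    using dist unfolding distribution_def by auto
  have "entropy \<Omega> w (F \<union> G) + entropy \<Omega> w Z \<le> entropy \<Omega> w F + entropy \<Omega> w G"
    if Z: "Z \<subseteq> F" "Z \<subseteq> G" for F G Z
  proof -
    let ?m = "mass \<Omega> w"
    let ?i = "\<lambda>P. if P then 1 else (0::real)"
    have mass_eq: "?m K x = (\<Sum>y\<in>\<Omega>. ?i (agree K x y) * w y)" for K x
      unfolding mass_def using fin by (auto simp: sum.inter_filter intro!: sum.cong)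
    define r where "r x = ?m F x * ?m G x / (?m (F \<union> G) x * ?m Z x)" for x
    have rpos: "0 < r x" if "x \<in> \<Omega>" for x
      unfolding r_def by (intro divide_pos_pos mult_pos_pos mass_pos[OF dist that])
    have nz: "?m K x \<noteq> 0" if "x \<in> \<Omega>" for K x
      using mass_pos[OF dist that, of K] by simp
    \<comment> \<open>For fixed \<open>y\<close> and \<open>u\<close> the points agreeing with
      \<open>y\<close> on \<open>F\<close> and with \<open>u\<close> on \<open>G\<close> are none or
      exactly one class of \<open>F \<union> G\<close>, on which the denominator is constant; in the
      second case \<open>y\<close> and \<open>u\<close> agree on \<open>Z\<close>.\<close>
    have inner: "(\<Sum>x\<in>\<Omega>. w x / (?m (F \<union> G) x * ?m Z x) * (?i (agree F x y) * ?i (agree G x u)))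
        \<le> ?i (agree Z y u) / ?m Z y" if y: "y \<in> \<Omega>" for y u
    proof (cases "\<exists>x0\<in>\<Omega>. agree F x0 y \<and> agree G x0 u")
      case True
      then obtain x0 where x0: "x0 \<in> \<Omega>" "agree F x0 y" "agree G x0 u" by blast
      have Zyu: "agree Z y u"
        using x0 Z by (meson agree_mono agree_sym agree_trans)
      have iff: "agree F x y \<and> agree G x u \<longleftrightarrow> agree (F \<union> G) x0 x" for x
        using x0 unfolding agree_Un by (meson agree_sym agree_trans)
      have "(\<Sum>x\<in>\<Omega>. w x / (?m (F \<union> G) x * ?m Z x) * (?i (agree F x y) * ?i (agree G x u)))
          = (\<Sum>x\<in>\<Omega>. ?i (agree (F \<union> G) x0 x) * w x / (?m (F \<union> G) x0 * ?m Z y))"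
      proof (rule sum.cong[OF refl])
        fix x assume "x \<in> \<Omega>"
        show "w x / (?m (F \<union> G) x * ?m Z x) * (?i (agree F x y) * ?i (agree G x u)) =
            ?i (agree (F \<union> G) x0 x) * w x / (?m (F \<union> G) x0 * ?m Z y)"
        proof (cases "agree (F \<union> G) x0 x")
          case True
          then have xy: "agree F x y" "agree G x u" using iff by blast+
          moreover have "?m (F \<union> G) x = ?m (F \<union> G) x0" using mass_cong[OF True] by simp
          moreover have "?m Z x = ?m Z y" by (rule mass_cong[OF agree_mono[OF xy(1) Z(1)]])
          ultimately show ?thesis using True xy by simp
        next
          case False
          then show ?thesis using iff[of x] by auto
        qed
      qed
      also have "\<dots> = ?m (F \<union> G) x0 / (?m (F \<union> G) x0 * ?m Z y)"
        unfolding mass_eq[of "F \<union> G" x0] by (rule sum_divide_distrib[symmetric])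
      also have "\<dots> = 1 / ?m Z y" using mass_pos[OF dist x0(1), of "F \<union> G"] by simp
      finally show ?thesis using Zyu by simp
    next
      case False
      then have "(\<Sum>x\<in>\<Omega>. w x / (?m (F \<union> G) x * ?m Z x) * (?i (agree F x y) * ?i (agree G x u))) = 0"
        by (intro sum.neutral) auto
      then show ?thesis using mass_pos[OF dist y, of Z] by simp
    qed
    \<comment> \<open>Both masses in the numerator of \<open>r\<close> become sums over
      \<open>y\<close> and \<open>u\<close>, so that the sum over \<open>x\<close> can be taken
      innermost.\<close>
    have "(\<Sum>x\<in>\<Omega>. w x * r x) = (\<Sum>x\<in>\<Omega>. \<Sum>y\<in>\<Omega>. \<Sum>u\<in>\<Omega>.
        w y * w u * (w x / (?m (F \<union> G) x * ?m Z x) * (?i (agree F x y) * ?i (agree G x u))))"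
      unfolding r_def mass_eq[of F] mass_eq[of G]
      by (intro sum.cong refl) (simp add: sum_product sum_distrib_left sum_divide_distrib mult_ac,
          subst sum.swap, simp add: mult_ac)
    also have "\<dots> = (\<Sum>y\<in>\<Omega>. \<Sum>u\<in>\<Omega>. w y * w u *
        (\<Sum>x\<in>\<Omega>. w x / (?m (F \<union> G) x * ?m Z x) * (?i (agree F x y) * ?i (agree G x u))))"
      unfolding sum_distrib_left
      by (subst sum.swap, rule sum.cong[OF refl], subst sum.swap, rule refl)
    also have "\<dots> \<le> (\<Sum>y\<in>\<Omega>. \<Sum>u\<in>\<Omega>. w y * w u * (?i (agree Z y u) / ?m Z y))"
      by (intro sum_mono mult_left_mono inner) (auto intro!: mult_nonneg_nonneg less_imp_le[OF wpos])
    also have "\<dots> = (\<Sum>y\<in>\<Omega>. w y / ?m Z y * ?m Z y)"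
      unfolding mass_eq[of Z] sum_distrib_left by (intro sum.cong refl) (simp add: mult_ac)
    also have "\<dots> = (\<Sum>y\<in>\<Omega>. w y)"
      by (intro sum.cong refl) (simp add: nz)
    finally have r1: "(\<Sum>x\<in>\<Omega>. w x * r x) \<le> 1" using w1 by simp
    have "(entropy \<Omega> w (F \<union> G) + entropy \<Omega> w Z) - (entropy \<Omega> w F + entropy \<Omega> w G)
        = (\<Sum>x\<in>\<Omega>. w x * log 2 (r x))"
    proof -
      have "w x * log 2 (r x) = w x * log 2 (?m F x) + w x * log 2 (?m G x)
          - w x * log 2 (?m (F \<union> G) x) - w x * log 2 (?m Z x)" if "x \<in> \<Omega>" for x
        unfolding r_def using mass_pos[OF dist that, of F] mass_pos[OF dist that, of G]
          mass_pos[OF dist that, of "F \<union> G"] mass_pos[OF dist that, of Z]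
        by (simp add: log_divide log_mult algebra_simps)
      then have "(\<Sum>x\<in>\<Omega>. w x * log 2 (r x)) = (\<Sum>x\<in>\<Omega>. w x * log 2 (?m F x) + w x * log 2 (?m G x)
          - w x * log 2 (?m (F \<union> G) x) - w x * log 2 (?m Z x))" by (rule sum.cong[OF refl])
      then show ?thesis unfolding entropy_def by (simp add: sum.distrib sum_subtractf)
    qed
    also have "\<dots> \<le> (\<Sum>x\<in>\<Omega>. w x * ((r x - 1) / ln 2))"
    proof (rule sum_mono)
      fix x assume x: "x \<in> \<Omega>"
      have "ln (r x) \<le> r x - 1" by (rule ln_le_minus_one[OF rpos[OF x]])
      then show "w x * log 2 (r x) \<le> w x * ((r x - 1) / ln 2)"
        unfolding log_def using wpos[OF x] by (intro mult_left_mono divide_right_mono) auto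
    qed
    also have "\<dots> = ((\<Sum>x\<in>\<Omega>. w x * r x) - sum w \<Omega>) / ln 2"
      by (simp add: sum_divide_distrib sum_subtractf[symmetric] right_diff_distrib)
    also have "\<dots> \<le> 0" using r1 w1 by (simp add: divide_nonpos_nonneg)
    finally show ?thesis by simp
  qed
  then show ?thesis unfolding submodular_def by blast
qed

text \<open>In the next three lemmas the listed instances of submodularity form a Farkas certificate, found by
  linear programming.\<close>

lemma copy_step1:
  assumes "submodular h"
    and indep: "h {a, b, c, d, e} + h {a, c} = h {a, b, c, d} + h {a, c, e}"
  shows "ingleton h a b d c + cond_info h a d e + cond_info h a e d
      \<le> ingleton h a b c d + cond_info h a c e + cond_info h a e c + (cond_info h a d c + cond_info h a c d)"
    and "cond_info h d e a \<le> ingleton h a b c d + cond_info h a c e + cond_info h a e c + cond_info h c e a"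
proof -
  note sub = submodularD[OF assms(1)]
  note norm = insert_commute[of b a] insert_commute[of c a] insert_commute[of d a] insert_commute[of e a]
    insert_commute[of c b] insert_commute[of d b] insert_commute[of e b]
    insert_commute[of d c] insert_commute[of e c] insert_commute[of e d]
  have
    "h {a, b, c, d, e} + h {a, c, d} \<le> h {a, b, c, d} + h {a, c, d, e}"
    "h {a, c, d, e} + h {d, e} \<le> h {a, d, e} + h {c, d, e}"
    "h {c, d, e} + h {c} \<le> h {c, d} + h {c, e}"
    by (rule sub; auto)+
  then show "ingleton h a b d c + cond_info h a d e + cond_info h a e d
      \<le> ingleton h a b c d + cond_info h a c e + cond_info h a e c + (cond_info h a d c + cond_info h a c d)"
    using indep unfolding ingleton_def info_def cond_info_def norm by argo
  have
    "h {a, b, c, d, e} + h {a, b} \<le> h {a, b, c, d} + h {a, b, e}"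
    "h {a, b, c, d, e} + h {b, c, d} \<le> h {a, b, c, d} + h {b, c, d, e}"
    "h {a, b, c, d, e} + h {a, c, d} \<le> h {a, b, c, d} + h {a, c, d, e}"
    "h {a, c, d, e} + h {d, e} \<le> h {a, d, e} + h {c, d, e}"
    "h {b, c, d, e} + h {b, e} \<le> h {b, c, e} + h {b, d, e}"
    "h {a, b, e} + h {e} \<le> h {a, e} + h {b, e}"
    "h {b, d, e} + h {d} \<le> h {b, d} + h {d, e}"
    "h {b, c, e} + h {c} \<le> h {b, c} + h {c, e}"
    "h {c, d, e} + h {c} \<le> h {c, d} + h {c, e}"
    by (rule sub; auto)+
  then show "cond_info h d e a \<le> ingleton h a b c d + cond_info h a c e + cond_info h a e c + cond_info h c e a"
    using indep unfolding ingleton_def info_def cond_info_def norm by argo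
qed

lemma copy_step2:
  assumes "submodular h"
    and indep: "h {a, b, c, d, e} + h {b, c} = h {a, b, c, d} + h {b, c, e}"
  shows "ingleton h a b c d + cond_info h c d e + cond_info h c e d
      \<le> ingleton h a b c d + cond_info h b c e + cond_info h c e b + (cond_info h b c d + cond_info h c d b)"
    and "cond_info h d e c \<le> ingleton h a b c d + cond_info h b c e + cond_info h c e b + cond_info h b e c"
proof -
  note sub = submodularD[OF assms(1)]
  note norm = insert_commute[of b a] insert_commute[of c a] insert_commute[of d a] insert_commute[of e a]
    insert_commute[of c b] insert_commute[of d b] insert_commute[of e b]
    insert_commute[of d c] insert_commute[of e c] insert_commute[of e d]
  have
    "h {a, b, c, d, e} + h {b, c, d} \<le> h {a, b, c, d} + h {b, c, d, e}"
    "h {b, c, d, e} + h {d, e} \<le> h {b, d, e} + h {c, d, e}"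
    "h {b, d, e} + h {b} \<le> h {b, d} + h {b, e}"
    by (rule sub; auto)+
  then show "ingleton h a b c d + cond_info h c d e + cond_info h c e d
      \<le> ingleton h a b c d + cond_info h b c e + cond_info h c e b + (cond_info h b c d + cond_info h c d b)"
    using indep unfolding ingleton_def info_def cond_info_def norm by argo
  have
    "h {a, b, c, d, e} + h {a, b} \<le> h {a, b, c, d} + h {a, b, e}"
    "h {a, b, c, d, e} + h {b, c, d} \<le> h {a, b, c, d} + h {b, c, d, e}"
    "h {a, b, c, d, e} + h {a, c, d} \<le> h {a, b, c, d} + h {a, c, d, e}"
    "h {b, c, d, e} + h {d, e} \<le> h {b, d, e} + h {c, d, e}"
    "h {a, c, d, e} + h {a, e} \<le> h {a, c, e} + h {a, d, e}"
    "h {a, b, e} + h {e} \<le> h {a, e} + h {b, e}"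
    "h {a, d, e} + h {d} \<le> h {a, d} + h {d, e}"
    "h {a, c, e} + h {c} \<le> h {a, c} + h {c, e}"
    "h {b, d, e} + h {b} \<le> h {b, d} + h {b, e}"
    by (rule sub; auto)+
  then show "cond_info h d e c \<le> ingleton h a b c d + cond_info h b c e + cond_info h c e b + cond_info h b e c"
    using indep unfolding ingleton_def info_def cond_info_def norm by argo
qed

lemma copy_step3:
  assumes "submodular h"
    and indep: "h {a, b, c, d, e} + h {c, d} = h {a, b, c, d} + h {c, d, e}"
  shows "ingleton h a b c d + cond_info h b c e + cond_info h c e b
      \<le> ingleton h a b c d + cond_info h c d e + cond_info h c e d + (cond_info h b c d + cond_info h c d b)"
    and "cond_info h b e c \<le> ingleton h a b c d + cond_info h c d e + cond_info h c e d + cond_info h d e c"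
proof -
  note sub = submodularD[OF assms(1)]
  note norm = insert_commute[of b a] insert_commute[of c a] insert_commute[of d a] insert_commute[of e a]
    insert_commute[of c b] insert_commute[of d b] insert_commute[of e b]
    insert_commute[of d c] insert_commute[of e c] insert_commute[of e d]
  have
    "h {a, b, c, d, e} + h {b, c, d} \<le> h {a, b, c, d} + h {b, c, d, e}"
    "h {b, c, d, e} + h {b, e} \<le> h {b, c, e} + h {b, d, e}"
    "h {b, d, e} + h {d} \<le> h {b, d} + h {d, e}"
    by (rule sub; auto)+
  then show "ingleton h a b c d + cond_info h b c e + cond_info h c e b
      \<le> ingleton h a b c d + cond_info h c d e + cond_info h c e d + (cond_info h b c d + cond_info h c d b)"
    using indep unfolding ingleton_def info_def cond_info_def norm by argo
  have
    "h {a, b, c, d, e} + h {a, b} \<le> h {a, b, c, d} + h {a, b, e}"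
    "h {a, b, c, d, e} + h {b, c, d} \<le> h {a, b, c, d} + h {b, c, d, e}"
    "h {a, b, c, d, e} + h {a, c, d} \<le> h {a, b, c, d} + h {a, c, d, e}"
    "h {b, c, d, e} + h {b, e} \<le> h {b, c, e} + h {b, d, e}"
    "h {a, c, d, e} + h {a, e} \<le> h {a, c, e} + h {a, d, e}"
    "h {a, b, e} + h {e} \<le> h {a, e} + h {b, e}"
    "h {a, d, e} + h {d} \<le> h {a, d} + h {d, e}"
    "h {a, c, e} + h {c} \<le> h {a, c} + h {c, e}"
    "h {b, d, e} + h {d} \<le> h {b, d} + h {d, e}"
    by (rule sub; auto)+
  then show "cond_info h b e c \<le> ingleton h a b c d + cond_info h c d e + cond_info h c e d + cond_info h d e c"
    using indep unfolding ingleton_def info_def cond_info_def norm by argo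
qed

lemma mass_indicator:
  assumes "finite \<Omega>"
  shows "mass \<Omega> w F x = (\<Sum>y\<in>\<Omega>. w y * (if agree F x y then 1 else 0))"
  unfolding mass_def using assms by (auto simp: sum.inter_filter intro!: sum.cong)

lemma entropy_reindex:
  assumes d: "\<And>x. d (p x) = x"
  shows "entropy (p ` \<Omega>) (\<lambda>x. w (d x)) ((\<lambda>f x. f (d x)) ` F) = entropy \<Omega> w F"
    and "distribution \<Omega> w \<Longrightarrow> distribution (p ` \<Omega>) (\<lambda>x. w (d x))"
proof -
  have inj: "inj_on p A" for A using d by (metis inj_onI)
  have ag: "agree ((\<lambda>f x. f (d x)) ` F) (p x) (p y) \<longleftrightarrow> agree F x y" for x y
    unfolding agree_def by (simp add: d)
  have "mass (p ` \<Omega>) (\<lambda>x. w (d x)) ((\<lambda>f x. f (d x)) ` F) (p x) = mass \<Omega> w F x" for x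
  proof -
    have "{y \<in> p ` \<Omega>. agree ((\<lambda>f x. f (d x)) ` F) (p x) y} = p ` {y \<in> \<Omega>. agree F x y}"
      using ag by auto
    then show ?thesis unfolding mass_def by (simp add: sum.reindex[OF inj] d)
  qed
  then show "entropy (p ` \<Omega>) (\<lambda>x. w (d x)) ((\<lambda>f x. f (d x)) ` F) = entropy \<Omega> w F"
    unfolding entropy_def by (simp add: sum.reindex[OF inj] d)
  show "distribution \<Omega> w \<Longrightarrow> distribution (p ` \<Omega>) (\<lambda>x. w (d x))"
    unfolding distribution_def by (auto simp: sum.reindex[OF inj] d)
qed

section \<open>Conditionally independent copies and the inequalities of Matus\<close>

text \<open>With the weight below, a point is a pair of samples that agree on \<open>G\<close> and
  are conditionally independent given their common values there.\<close>

definition fibre_product :: "'w set \<Rightarrow> ('w \<Rightarrow> 'v) set \<Rightarrow> ('w \<times> 'w) set" where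
  "fibre_product \<Omega> G = (SIGMA x:\<Omega>. {y\<in>\<Omega>. agree G x y})"

definition fibre_weight :: "'w set \<Rightarrow> ('w \<Rightarrow> real) \<Rightarrow> ('w \<Rightarrow> 'v) set \<Rightarrow> 'w \<times> 'w \<Rightarrow> real" where
  "fibre_weight \<Omega> w G p = w (fst p) * w (snd p) / mass \<Omega> w G (fst p)"

lemma agree_fst: "agree ((\<lambda>f p. f (fst p)) ` F) p q \<longleftrightarrow> agree F (fst p) (fst q)"
  and agree_snd: "agree ((\<lambda>f p. f (snd p)) ` F) p q \<longleftrightarrow> agree F (snd p) (snd q)"
  unfolding agree_def by auto

context
  fixes \<Omega> :: "'w set" and w :: "'w \<Rightarrow> real" and G :: "('w \<Rightarrow> 'v) set"
  assumes dist: "distribution \<Omega> w"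
begin

lemma finite_\<Omega>: "finite \<Omega>"
  using dist unfolding distribution_def by blast

lemma mass_ne_0: "x \<in> \<Omega> \<Longrightarrow> mass \<Omega> w F x \<noteq> 0"
  using mass_pos[OF dist] by (metis less_irrefl)

lemma finite_fibre_product: "finite (fibre_product \<Omega> G)"
  unfolding fibre_product_def using finite_\<Omega> by auto

lemma sum_fibre_product:
  "(\<Sum>p\<in>fibre_product \<Omega> G. f p) = (\<Sum>x\<in>\<Omega>. \<Sum>y\<in>{y\<in>\<Omega>. agree G x y}. f (x, y))"
  unfolding fibre_product_def using finite_\<Omega> by (subst sum.Sigma) auto

text \<open>Both marginals of the weight are \<open>w\<close>. The form with a test function
  \<open>f\<close> covers masses (indicators) and entropies (logarithms) alike.\<close>

lemma sum_fibre_fst: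
  "(\<Sum>p\<in>fibre_product \<Omega> G. fibre_weight \<Omega> w G p * f (fst p)) = (\<Sum>x\<in>\<Omega>. w x * f x)"
proof -
  have "(\<Sum>y\<in>{y\<in>\<Omega>. agree G x y}. fibre_weight \<Omega> w G (x, y) * f x) = w x * f x" if x: "x \<in> \<Omega>" for x
  proof -
    have "(\<Sum>y\<in>{y\<in>\<Omega>. agree G x y}. fibre_weight \<Omega> w G (x, y) * f x)
        = w x * f x / mass \<Omega> w G x * mass \<Omega> w G x"
      unfolding fibre_weight_def mass_def sum_distrib_left by (intro sum.cong refl) simp
    then show ?thesis using mass_ne_0[OF x, of G] by simp
  qed
  then show ?thesis unfolding sum_fibre_product by simp
qed

lemma sum_fibre_snd:
  "(\<Sum>p\<in>fibre_product \<Omega> G. fibre_weight \<Omega> w G p * f (snd p)) = (\<Sum>x\<in>\<Omega>. w x * f x)"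
proof -
  have "(\<Sum>x\<in>{x\<in>\<Omega>. agree G x y}. fibre_weight \<Omega> w G (x, y) * f y) = w y * f y" if y: "y \<in> \<Omega>" for y
  proof -
    have "(\<Sum>x\<in>{x\<in>\<Omega>. agree G x y}. fibre_weight \<Omega> w G (x, y) * f y)
        = (\<Sum>x\<in>{x\<in>\<Omega>. agree G y x}. w y * f y / mass \<Omega> w G y * w x)"
    proof (rule sum.cong)
      show "{x\<in>\<Omega>. agree G x y} = {x\<in>\<Omega>. agree G y x}" using agree_sym[of G] by blast
    next
      fix x assume "x \<in> {x\<in>\<Omega>. agree G y x}"
      then have "mass \<Omega> w G x = mass \<Omega> w G y" using mass_cong agree_sym by (metis (mono_tags, lifting) mem_Collect_eq)
      then show "fibre_weight \<Omega> w G (x, y) * f y = w y * f y / mass \<Omega> w G y * w x"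
        unfolding fibre_weight_def by simp
    qed
    also have "\<dots> = w y * f y / mass \<Omega> w G y * mass \<Omega> w G y"
      unfolding mass_def sum_distrib_left by (rule refl)
    finally show ?thesis using mass_ne_0[OF y, of G] by simp
  qed
  moreover have "(\<Sum>p\<in>fibre_product \<Omega> G. fibre_weight \<Omega> w G p * f (snd p)) =
      (\<Sum>y\<in>\<Omega>. \<Sum>x\<in>{x\<in>\<Omega>. agree G x y}. fibre_weight \<Omega> w G (x, y) * f y)"
    unfolding sum_fibre_product
    using sum.swap_restrict[OF finite_\<Omega> finite_\<Omega>, of "\<lambda>x y. fibre_weight \<Omega> w G (x, y) * f y" "agree G"] by simp
  ultimately show ?thesis by simp
qed

lemma distribution_fibre: "distribution (fibre_product \<Omega> G) (fibre_weight \<Omega> w G)"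
proof -
  have "0 < fibre_weight \<Omega> w G p" if "p \<in> fibre_product \<Omega> G" for p
    using that dist mass_pos[OF dist, of "fst p" G]
    unfolding fibre_product_def fibre_weight_def distribution_def by auto
  moreover have "sum (fibre_weight \<Omega> w G) (fibre_product \<Omega> G) = 1"
    using sum_fibre_fst[of "\<lambda>_. 1"] dist unfolding distribution_def by simp
  ultimately show ?thesis using finite_fibre_product unfolding distribution_def by blast
qed

lemma entropy_fst:
  "entropy (fibre_product \<Omega> G) (fibre_weight \<Omega> w G) ((\<lambda>f p. f (fst p)) ` F) = entropy \<Omega> w F"
proof -
  have "mass (fibre_product \<Omega> G) (fibre_weight \<Omega> w G) ((\<lambda>f p. f (fst p)) ` F) p = mass \<Omega> w F (fst p)" for p
    unfolding mass_indicator[OF finite_fibre_product] mass_indicator[OF finite_\<Omega>] agree_fst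
    by (rule sum_fibre_fst)
  then show ?thesis unfolding entropy_def by (simp add: sum_fibre_fst[of "\<lambda>x. log 2 (mass \<Omega> w F x)"])
qed

lemma entropy_snd:
  "entropy (fibre_product \<Omega> G) (fibre_weight \<Omega> w G) ((\<lambda>f p. f (snd p)) ` F) = entropy \<Omega> w F"
proof -
  have "mass (fibre_product \<Omega> G) (fibre_weight \<Omega> w G) ((\<lambda>f p. f (snd p)) ` F) p = mass \<Omega> w F (snd p)" for p
    unfolding mass_indicator[OF finite_fibre_product] mass_indicator[OF finite_\<Omega>] agree_snd
    by (rule sum_fibre_snd)
  then show ?thesis unfolding entropy_def by (simp add: sum_fibre_snd[of "\<lambda>x. log 2 (mass \<Omega> w F x)"])
qed

text \<open>Since \<open>F\<close> and \<open>E\<close> contain \<open>G\<close>, the class of a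
  pair is the product of the classes of its components, so its mass is the product of their masses
  over \<open>F\<close> and \<open>E\<close> divided by the mass over \<open>G\<close>.\<close>

lemma entropy_fst_snd:
  assumes "G \<subseteq> F" "G \<subseteq> E"
  shows "entropy (fibre_product \<Omega> G) (fibre_weight \<Omega> w G)
      ((\<lambda>f p. f (fst p)) ` F \<union> (\<lambda>f p. f (snd p)) ` E) =
    entropy \<Omega> w F + entropy \<Omega> w E - entropy \<Omega> w G"
proof -
  let ?P = "fibre_product \<Omega> G" and ?v = "fibre_weight \<Omega> w G"
  let ?K = "(\<lambda>f p. f (fst p)) ` F \<union> (\<lambda>f p. f (snd p)) ` E"
  let ?m = "mass \<Omega> w"
  have m: "mass ?P ?v ?K p = ?m F (fst p) * ?m E (snd p) / ?m G (fst p)" if p: "p \<in> ?P" for p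
  proof -
    obtain x y where p': "p = (x, y)" "x \<in> \<Omega>" "y \<in> \<Omega>" "agree G x y"
      using p unfolding fibre_product_def by auto
    have "{q \<in> ?P. agree ?K p q} = {x'\<in>\<Omega>. agree F x x'} \<times> {y'\<in>\<Omega>. agree E y y'}"
    proof -
      have "agree G x' y'" if "agree F x x'" "agree E y y'" for x' y'
        using that p'(4) assms by (meson agree_mono agree_sym agree_trans)
      then show ?thesis unfolding agree_Un agree_fst agree_snd p'(1) fibre_product_def by auto
    qed
    then have "mass ?P ?v ?K p = (\<Sum>(x', y')\<in>{x'\<in>\<Omega>. agree F x x'} \<times> {y'\<in>\<Omega>. agree E y y'}. ?v (x', y'))"
      unfolding mass_def by simp
    also have "\<dots> = (\<Sum>(x', y')\<in>{x'\<in>\<Omega>. agree F x x'} \<times> {y'\<in>\<Omega>. agree E y y'}. w x' * w y' / ?m G x)"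
    proof (rule sum.cong[OF refl], clarify)
      fix x' y' assume "agree F x x'"
      then have "?m G x' = ?m G x" using mass_cong[OF agree_mono[OF _ assms(1)]] by metis
      then show "?v (x', y') = w x' * w y' / ?m G x" unfolding fibre_weight_def by simp
    qed
    also have "\<dots> = (\<Sum>x'\<in>{x'\<in>\<Omega>. agree F x x'}. \<Sum>y'\<in>{y'\<in>\<Omega>. agree E y y'}. w x' * w y' / ?m G x)"
      by (rule sum.cartesian_product[symmetric])
    also have "\<dots> = ?m F x * ?m E y / ?m G x"
      unfolding mass_def[of _ _ F] mass_def[of _ _ E] by (simp add: sum_product sum_divide_distrib)
    finally show ?thesis by (simp add: p'(1))
  qed
  have "?v p * log 2 (mass ?P ?v ?K p) = ?v p * log 2 (?m F (fst p)) + ?v p * log 2 (?m E (snd p))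
      - ?v p * log 2 (?m G (fst p))" if p: "p \<in> ?P" for p
  proof -
    have "fst p \<in> \<Omega>" "snd p \<in> \<Omega>" using p unfolding fibre_product_def by auto
    then show ?thesis
      unfolding m[OF p] using mass_pos[OF dist, of "fst p" F] mass_pos[OF dist, of "snd p" E]
        mass_pos[OF dist, of "fst p" G]
      by (simp add: log_divide log_mult algebra_simps)
  qed
  then have "(\<Sum>p\<in>?P. ?v p * log 2 (mass ?P ?v ?K p)) = (\<Sum>p\<in>?P. ?v p * log 2 (?m F (fst p))
      + ?v p * log 2 (?m E (snd p)) - ?v p * log 2 (?m G (fst p)))" by (rule sum.cong[OF refl])
  then show ?thesis
    unfolding entropy_def
    by (simp add: sum.distrib sum_subtractf sum_fibre_fst[of "\<lambda>x. log 2 (?m F x)"]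
        sum_fibre_fst[of "\<lambda>x. log 2 (?m G x)"] sum_fibre_snd[of "\<lambda>x. log 2 (?m E x)"])
qed

end

text \<open>\<open>e'\<close> is a copy of \<open>e\<close> over \<open>G\<close> which is independent of everything else given \<open>G\<close>.
  The sample space is encoded in \<open>nat\<close> again, so that the construction can be iterated in an induction.\<close>

lemma copy_variable:
  fixes \<Omega> :: "nat set" and e :: "nat \<Rightarrow> 'v"
  assumes dist: "distribution \<Omega> w"
  obtains \<Omega>' :: "nat set" and w' and \<phi> :: "(nat \<Rightarrow> 'v) \<Rightarrow> nat \<Rightarrow> 'v" and e' where
    "distribution \<Omega>' w'"
    "\<And>F. entropy \<Omega>' w' (\<phi> ` F) = entropy \<Omega> w F"
    "\<And>F. F \<subseteq> G \<Longrightarrow> entropy \<Omega>' w' (insert e' (\<phi> ` F)) = entropy \<Omega> w (insert e F)"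
    "\<And>F. G \<subseteq> F \<Longrightarrow> entropy \<Omega>' w' (insert e' (\<phi> ` F)) + entropy \<Omega> w G =
      entropy \<Omega> w F + entropy \<Omega> w (insert e G)"
proof -
  let ?P = "fibre_product \<Omega> G" and ?v = "fibre_weight \<Omega> w G"
  let ?\<phi> = "\<lambda>f p. f (fst p)"
  let ?e = "\<lambda>p. e (snd p)"
  have same: "f (fst p) = f (snd p)" if "f \<in> G" "p \<in> ?P" for f p
    using that unfolding fibre_product_def agree_def by auto
  \<comment> \<open>On the fibre product the variables of \<open>G\<close> read the same from either
    sample, so the whole family can be read from the second one.\<close>
  have low: "entropy ?P ?v (insert ?e (?\<phi> ` F)) = entropy \<Omega> w (insert e F)" if F: "F \<subseteq> G" for F
  proof -
    have "entropy ?P ?v (insert ?e (?\<phi> ` F)) = entropy ?P ?v ((\<lambda>f p. f (snd p)) ` insert e F)"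
      by (rule entropy_cong) (use F same in \<open>fastforce simp: agree_def\<close>)
    then show ?thesis using entropy_snd[OF dist] by metis
  qed
  \<comment> \<open>Adding the variables of \<open>G\<close> read from the second sample changes
    nothing, as they are already present from the first.\<close>
  have high: "entropy ?P ?v (insert ?e (?\<phi> ` F)) + entropy \<Omega> w G =
      entropy \<Omega> w F + entropy \<Omega> w (insert e G)" if F: "G \<subseteq> F" for F
  proof -
    have "entropy ?P ?v (insert ?e (?\<phi> ` F)) = entropy ?P ?v (?\<phi> ` F \<union> (\<lambda>f p. f (snd p)) ` insert e G)"
      by (rule entropy_cong) (use F same in \<open>fastforce simp: agree_def\<close>)
    then show ?thesis using entropy_fst_snd[OF dist F subset_insertI[of G e]] by linarith
  qed
  let ?d = "\<lambda>F. (\<lambda>f x. f (prod_decode x)) ` F"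
  note r = entropy_reindex[of prod_decode prod_encode, OF prod_encode_inverse]
  have img: "(\<lambda>f x. f (fst (prod_decode x))) ` F = ?d (?\<phi> ` F)" for F :: "(nat \<Rightarrow> 'v) set"
    by (simp add: image_image)
  show ?thesis
  proof (rule that[of "prod_encode ` ?P" "\<lambda>x. ?v (prod_decode x)" "\<lambda>f x. f (fst (prod_decode x))"
        "\<lambda>x. e (snd (prod_decode x))"])
    show "distribution (prod_encode ` ?P) (\<lambda>x. ?v (prod_decode x))"
      by (rule r(2)[OF distribution_fibre[OF dist]])
    show "entropy (prod_encode ` ?P) (\<lambda>x. ?v (prod_decode x)) ((\<lambda>f x. f (fst (prod_decode x))) ` F)
        = entropy \<Omega> w F" for F :: "(nat \<Rightarrow> 'v) set"
      unfolding img r(1) by (rule entropy_fst[OF dist])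
    have ins: "insert (\<lambda>x. e (snd (prod_decode x))) ((\<lambda>f x. f (fst (prod_decode x))) ` F) = ?d (insert ?e (?\<phi> ` F))" for F :: "(nat \<Rightarrow> 'v) set"
      unfolding img by simp
    show "entropy (prod_encode ` ?P) (\<lambda>x. ?v (prod_decode x)) (insert (\<lambda>x. e (snd (prod_decode x)))
        ((\<lambda>f x. f (fst (prod_decode x))) ` F)) = entropy \<Omega> w (insert e F)" if "F \<subseteq> G" for F
      unfolding ins r(1) by (rule low[OF that])
    show "entropy (prod_encode ` ?P) (\<lambda>x. ?v (prod_decode x)) (insert (\<lambda>x. e (snd (prod_decode x)))
        ((\<lambda>f x. f (fst (prod_decode x))) ` F)) + entropy \<Omega> w G = entropy \<Omega> w F + entropy \<Omega> w (insert e G)"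
      if "G \<subseteq> F" for F
      unfolding ins r(1) by (rule high[OF that])
  qed
qed

lemma cond_info_nonneg:
  assumes "submodular h"
  shows "0 \<le> cond_info h x y z"
proof -
  have "h {x, y, z} + h {z} \<le> h {x, z} + h {y, z}"
    by (rule submodularD[OF assms]) auto
  then show ?thesis unfolding cond_info_def by simp
qed

text \<open>Joint entropies with the copy are preserved only over \<open>{p, q}\<close>; those are
  the ones in which the old inequality mentions \<open>e\<close>. The last clause is conditional
  independence in the form that the copy steps expect.\<close>

lemma copy_variable_info:
  fixes \<Omega> :: "nat set" and e :: "nat \<Rightarrow> 'v"
  assumes dist: "distribution \<Omega> w" and G: "p \<in> {a, b, c, d}" "q \<in> {a, b, c, d}"
  obtains \<Omega>' :: "nat set" and w' and \<phi> :: "(nat \<Rightarrow> 'v) \<Rightarrow> nat \<Rightarrow> 'v" and e' where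
    "distribution \<Omega>' w'"
    "\<And>x y z u. ingleton (entropy \<Omega>' w') (\<phi> x) (\<phi> y) (\<phi> z) (\<phi> u) = ingleton (entropy \<Omega> w) x y z u"
    "\<And>x y z. cond_info (entropy \<Omega>' w') (\<phi> x) (\<phi> y) (\<phi> z) = cond_info (entropy \<Omega> w) x y z"
    "\<And>x y. x \<in> {p, q} \<Longrightarrow> y \<in> {p, q} \<Longrightarrow>
       cond_info (entropy \<Omega>' w') (\<phi> x) (\<phi> y) e' = cond_info (entropy \<Omega> w) x y e"
    "\<And>x y. x \<in> {p, q} \<Longrightarrow> y \<in> {p, q} \<Longrightarrow>
       cond_info (entropy \<Omega>' w') (\<phi> x) e' (\<phi> y) = cond_info (entropy \<Omega> w) x e y"
    "entropy \<Omega>' w' {\<phi> a, \<phi> b, \<phi> c, \<phi> d, e'} + entropy \<Omega>' w' {\<phi> p, \<phi> q} =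
       entropy \<Omega>' w' {\<phi> a, \<phi> b, \<phi> c, \<phi> d} + entropy \<Omega>' w' {\<phi> p, \<phi> q, e'}"
proof -
  let ?h = "entropy \<Omega> w"
  obtain \<Omega>' :: "nat set" and w' and \<phi> :: "(nat \<Rightarrow> 'v) \<Rightarrow> nat \<Rightarrow> 'v" and e' where *: "distribution \<Omega>' w'"
    "\<And>F. entropy \<Omega>' w' (\<phi> ` F) = ?h F"
    "\<And>F. F \<subseteq> {p, q} \<Longrightarrow> entropy \<Omega>' w' (insert e' (\<phi> ` F)) = ?h (insert e F)"
    "\<And>F. {p, q} \<subseteq> F \<Longrightarrow> entropy \<Omega>' w' (insert e' (\<phi> ` F)) + ?h {p, q} = ?h F + ?h (insert e {p, q})"
    using copy_variable[OF dist, of "{p, q}" e] by blast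
  let ?h' = "entropy \<Omega>' w'"
  have h1: "?h' {\<phi> x} = ?h {x}" for x using *(2)[of "{x}"] by simp
  have h2: "?h' {\<phi> x, \<phi> y} = ?h {x, y}" for x y using *(2)[of "{x, y}"] by simp
  have h3: "?h' {\<phi> x, \<phi> y, \<phi> z} = ?h {x, y, z}" for x y z using *(2)[of "{x, y, z}"] by simp
  have e0: "?h' {e'} = ?h {e}" using *(3)[of "{}"] by simp
  have e1: "?h' {\<phi> x, e'} = ?h {x, e}" "?h' {e', \<phi> x} = ?h {e, x}" if "x \<in> {p, q}" for x
    using *(3)[of "{x}"] that by (simp_all add: insert_commute)
  have e2: "?h' {\<phi> x, \<phi> y, e'} = ?h {x, y, e}" "?h' {\<phi> x, e', \<phi> y} = ?h {x, e, y}"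
    if "x \<in> {p, q}" "y \<in> {p, q}" for x y
    using *(3)[of "{x, y}"] that by (simp_all add: insert_commute)
  show ?thesis
  proof (rule that[OF *(1)])
    show "ingleton ?h' (\<phi> x) (\<phi> y) (\<phi> z) (\<phi> u) = ingleton ?h x y z u" for x y z u
      unfolding ingleton_def cond_info_def info_def h1 h2 h3 ..
    show "cond_info ?h' (\<phi> x) (\<phi> y) (\<phi> z) = cond_info ?h x y z" for x y z
      unfolding cond_info_def h1 h2 h3 ..
    show "cond_info ?h' (\<phi> x) (\<phi> y) e' = cond_info ?h x y e" if "x \<in> {p, q}" "y \<in> {p, q}" for x y
      unfolding cond_info_def e0 e1(1)[OF that(1)] e1(1)[OF that(2)] e2(1)[OF that] ..
    show "cond_info ?h' (\<phi> x) e' (\<phi> y) = cond_info ?h x e y" if "x \<in> {p, q}" "y \<in> {p, q}" for x y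
      unfolding cond_info_def h1 h2 e1(2)[OF that(2)] e2(2)[OF that] ..
    have "{p, q} \<subseteq> {a, b, c, d}" using G by blast
    from *(4)[OF this] *(3)[of "{p, q}"] *(2)[of "{p, q}"] *(2)[of "{a, b, c, d}"]
    have "?h' (insert e' {\<phi> a, \<phi> b, \<phi> c, \<phi> d}) + ?h' {\<phi> p, \<phi> q} =
       ?h' {\<phi> a, \<phi> b, \<phi> c, \<phi> d} + ?h' (insert e' {\<phi> p, \<phi> q})" by simp
    then show "?h' {\<phi> a, \<phi> b, \<phi> c, \<phi> d, e'} + ?h' {\<phi> p, \<phi> q} =
       ?h' {\<phi> a, \<phi> b, \<phi> c, \<phi> d} + ?h' {\<phi> p, \<phi> q, e'}"
      by (simp only: insert_commute[of e'])
  qed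
qed

text \<open>\<open>Q'\<close> and \<open>I'\<close> belong to the copy. Each step costs
  \<open>D\<close> in the coefficient of \<open>s\<close>, whence the quadratic growth
  \<open>s + s * (s - 1) / 2 = (s + 1) * s / 2\<close>.\<close>

lemma matus_step:
  fixes s :: nat and Q Q' I I' D :: real
  assumes "0 \<le> real s * Q' + I' + real s * (real s - 1) / 2 * D" "Q' \<le> Q + D" "I' \<le> Q + I"
  shows "0 \<le> real (Suc s) * Q + I + real (Suc s) * (real (Suc s) - 1) / 2 * D"
proof -
  have "real s * Q' \<le> real s * (Q + D)" by (rule mult_left_mono[OF assms(2)]) simp
  then have "0 \<le> real s * (Q + D) + (Q + I) + real s * (real s - 1) / 2 * D"
    using assms(1,3) by linarith
  also have "\<dots> = real (Suc s) * Q + I + real (Suc s) * (real (Suc s) - 1) / 2 * D"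
    by (simp add: field_simps)
  finally show ?thesis .
qed

text \<open>The induction step applies the inequality for \<open>s\<close> to \<open>(a, b, d, c, e')\<close>, where \<open>e'\<close> is a copy
  of \<open>e\<close> over \<open>{a, c}\<close>.\<close>

lemma matus_1:
  fixes \<Omega> :: "nat set" and a b c d e :: "nat \<Rightarrow> 'v"
  assumes "distribution \<Omega> w"
  shows "0 \<le> real s * (ingleton (entropy \<Omega> w) a b c d + cond_info (entropy \<Omega> w) a c e + cond_info (entropy \<Omega> w) a e c)
    + cond_info (entropy \<Omega> w) c e a
    + real s * (real s - 1) / 2 * (cond_info (entropy \<Omega> w) a d c + cond_info (entropy \<Omega> w) a c d)"
  using assms
proof (induction s arbitrary: \<Omega> w a b c d e)
  case 0
  then show ?case using cond_info_nonneg[OF submodular_entropy] by simp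
next
  case (Suc s)
  have mem: "a \<in> {a, b, c, d}" "c \<in> {a, b, c, d}" by simp_all
  obtain \<Omega>' :: "nat set" and w' and \<phi> :: "(nat \<Rightarrow> 'v) \<Rightarrow> nat \<Rightarrow> 'v" and e' where *: "distribution \<Omega>' w'"
    "\<And>x y z u. ingleton (entropy \<Omega>' w') (\<phi> x) (\<phi> y) (\<phi> z) (\<phi> u) = ingleton (entropy \<Omega> w) x y z u"
    "\<And>x y z. cond_info (entropy \<Omega>' w') (\<phi> x) (\<phi> y) (\<phi> z) = cond_info (entropy \<Omega> w) x y z"
    "\<And>x y. x \<in> {a, c} \<Longrightarrow> y \<in> {a, c} \<Longrightarrow>
       cond_info (entropy \<Omega>' w') (\<phi> x) (\<phi> y) e' = cond_info (entropy \<Omega> w) x y e"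
    "\<And>x y. x \<in> {a, c} \<Longrightarrow> y \<in> {a, c} \<Longrightarrow>
       cond_info (entropy \<Omega>' w') (\<phi> x) e' (\<phi> y) = cond_info (entropy \<Omega> w) x e y"
    "entropy \<Omega>' w' {\<phi> a, \<phi> b, \<phi> c, \<phi> d, e'} + entropy \<Omega>' w' {\<phi> a, \<phi> c} =
       entropy \<Omega>' w' {\<phi> a, \<phi> b, \<phi> c, \<phi> d} + entropy \<Omega>' w' {\<phi> a, \<phi> c, e'}"
    using copy_variable_info[OF Suc.prems mem, of e] by blast
  let ?h = "entropy \<Omega> w" and ?h' = "entropy \<Omega>' w'"
  let ?Q = "ingleton ?h a b c d + cond_info ?h a c e + cond_info ?h a e c" and ?I = "cond_info ?h c e a" and ?D = "cond_info ?h a d c + cond_info ?h a c d"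
  let ?Q' = "ingleton ?h' (\<phi> a) (\<phi> b) (\<phi> d) (\<phi> c) + cond_info ?h' (\<phi> a) (\<phi> d) e' + cond_info ?h' (\<phi> a) e' (\<phi> d)" and ?I' = "cond_info ?h' (\<phi> d) e' (\<phi> a)"
  have "?Q' \<le> ?Q + ?D" "?I' \<le> ?Q + ?I"
    using copy_step1[OF submodular_entropy[OF *(1)] *(6)] by (simp_all add: *(2-5))
  \<comment> \<open>In the instance \<open>c\<close> and \<open>d\<close> trade places, which only
    permutes the two summands of \<open>?D\<close>.\<close>
  moreover have "0 \<le> real s * ?Q' + ?I' + real s * (real s - 1) / 2 * ?D"
    using Suc.IH[OF *(1), of "\<phi> a" "\<phi> b" "\<phi> d" "\<phi> c" e'] by (simp add: *(3) add.commute)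
  ultimately show ?case by (intro matus_step)
qed

text \<open>Each of the two families is used for the induction step of the other, with copies of \<open>e\<close> over
  \<open>{b, c}\<close> and over \<open>{c, d}\<close>, respectively.\<close>

lemma matus_23:
  fixes \<Omega> :: "nat set" and a b c d e :: "nat \<Rightarrow> 'v"
  assumes "distribution \<Omega> w"
  shows "0 \<le> real s * (ingleton (entropy \<Omega> w) a b c d + cond_info (entropy \<Omega> w) b c e + cond_info (entropy \<Omega> w) c e b)
    + cond_info (entropy \<Omega> w) b e c
    + real s * (real s - 1) / 2 * (cond_info (entropy \<Omega> w) b c d + cond_info (entropy \<Omega> w) c d b)"
    and "0 \<le> real s * (ingleton (entropy \<Omega> w) a b c d + cond_info (entropy \<Omega> w) c d e + cond_info (entropy \<Omega> w) c e d)
    + cond_info (entropy \<Omega> w) d e c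
    + real s * (real s - 1) / 2 * (cond_info (entropy \<Omega> w) b c d + cond_info (entropy \<Omega> w) c d b)"
  using assms
proof (induction s arbitrary: \<Omega> w a b c d e)
  case 0
  {
    case 1
    then show ?case using cond_info_nonneg[OF submodular_entropy] by simp
  next
    case 2
    then show ?case using cond_info_nonneg[OF submodular_entropy] by simp
  }
next
  case (Suc s)
  {
    case 1
    have mem: "b \<in> {a, b, c, d}" "c \<in> {a, b, c, d}" by simp_all
    obtain \<Omega>' :: "nat set" and w' and \<phi> :: "(nat \<Rightarrow> 'v) \<Rightarrow> nat \<Rightarrow> 'v" and e' where *: "distribution \<Omega>' w'"
      "\<And>x y z u. ingleton (entropy \<Omega>' w') (\<phi> x) (\<phi> y) (\<phi> z) (\<phi> u) = ingleton (entropy \<Omega> w) x y z u"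
      "\<And>x y z. cond_info (entropy \<Omega>' w') (\<phi> x) (\<phi> y) (\<phi> z) = cond_info (entropy \<Omega> w) x y z"
      "\<And>x y. x \<in> {b, c} \<Longrightarrow> y \<in> {b, c} \<Longrightarrow>
         cond_info (entropy \<Omega>' w') (\<phi> x) (\<phi> y) e' = cond_info (entropy \<Omega> w) x y e"
      "\<And>x y. x \<in> {b, c} \<Longrightarrow> y \<in> {b, c} \<Longrightarrow>
         cond_info (entropy \<Omega>' w') (\<phi> x) e' (\<phi> y) = cond_info (entropy \<Omega> w) x e y"
      "entropy \<Omega>' w' {\<phi> a, \<phi> b, \<phi> c, \<phi> d, e'} + entropy \<Omega>' w' {\<phi> b, \<phi> c} =
         entropy \<Omega>' w' {\<phi> a, \<phi> b, \<phi> c, \<phi> d} + entropy \<Omega>' w' {\<phi> b, \<phi> c, e'}"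
      using copy_variable_info[OF 1 mem, of e] by blast
    let ?h = "entropy \<Omega> w" and ?h' = "entropy \<Omega>' w'"
    let ?Q = "ingleton ?h a b c d + cond_info ?h b c e + cond_info ?h c e b" and ?I = "cond_info ?h b e c" and ?D = "cond_info ?h b c d + cond_info ?h c d b"
    let ?Q' = "ingleton ?h' (\<phi> a) (\<phi> b) (\<phi> c) (\<phi> d) + cond_info ?h' (\<phi> c) (\<phi> d) e' + cond_info ?h' (\<phi> c) e' (\<phi> d)" and ?I' = "cond_info ?h' (\<phi> d) e' (\<phi> c)"
    have "?Q' \<le> ?Q + ?D" "?I' \<le> ?Q + ?I"
      using copy_step2[OF submodular_entropy[OF *(1)] *(6)] by (simp_all add: *(2-5))
    moreover have "0 \<le> real s * ?Q' + ?I' + real s * (real s - 1) / 2 * ?D"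
      using Suc.IH(2)[OF *(1), of "\<phi> a" "\<phi> b" "\<phi> c" "\<phi> d" e'] by (simp add: *(3))
    ultimately show ?case by (intro matus_step)
  next
    case 2
    have mem: "c \<in> {a, b, c, d}" "d \<in> {a, b, c, d}" by simp_all
    obtain \<Omega>' :: "nat set" and w' and \<phi> :: "(nat \<Rightarrow> 'v) \<Rightarrow> nat \<Rightarrow> 'v" and e' where *: "distribution \<Omega>' w'"
      "\<And>x y z u. ingleton (entropy \<Omega>' w') (\<phi> x) (\<phi> y) (\<phi> z) (\<phi> u) = ingleton (entropy \<Omega> w) x y z u"
      "\<And>x y z. cond_info (entropy \<Omega>' w') (\<phi> x) (\<phi> y) (\<phi> z) = cond_info (entropy \<Omega> w) x y z"
      "\<And>x y. x \<in> {c, d} \<Longrightarrow> y \<in> {c, d} \<Longrightarrow>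
         cond_info (entropy \<Omega>' w') (\<phi> x) (\<phi> y) e' = cond_info (entropy \<Omega> w) x y e"
      "\<And>x y. x \<in> {c, d} \<Longrightarrow> y \<in> {c, d} \<Longrightarrow>
         cond_info (entropy \<Omega>' w') (\<phi> x) e' (\<phi> y) = cond_info (entropy \<Omega> w) x e y"
      "entropy \<Omega>' w' {\<phi> a, \<phi> b, \<phi> c, \<phi> d, e'} + entropy \<Omega>' w' {\<phi> c, \<phi> d} =
         entropy \<Omega>' w' {\<phi> a, \<phi> b, \<phi> c, \<phi> d} + entropy \<Omega>' w' {\<phi> c, \<phi> d, e'}"
      using copy_variable_info[OF 2 mem, of e] by blast
    let ?h = "entropy \<Omega> w" and ?h' = "entropy \<Omega>' w'"
    let ?Q = "ingleton ?h a b c d + cond_info ?h c d e + cond_info ?h c e d" and ?I = "cond_info ?h d e c" and ?D = "cond_info ?h b c d + cond_info ?h c d b"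
    let ?Q' = "ingleton ?h' (\<phi> a) (\<phi> b) (\<phi> c) (\<phi> d) + cond_info ?h' (\<phi> b) (\<phi> c) e' + cond_info ?h' (\<phi> c) e' (\<phi> b)" and ?I' = "cond_info ?h' (\<phi> b) e' (\<phi> c)"
    have "?Q' \<le> ?Q + ?D" "?I' \<le> ?Q + ?I"
      using copy_step3[OF submodular_entropy[OF *(1)] *(6)] by (simp_all add: *(2-5))
    moreover have "0 \<le> real s * ?Q' + ?I' + real s * (real s - 1) / 2 * ?D"
      using Suc.IH(1)[OF *(1), of "\<phi> a" "\<phi> b" "\<phi> c" "\<phi> d" e'] by (simp add: *(3))
    ultimately show ?case by (intro matus_step)
  }
qed

section \<open>Entropy of uniform distributions, and the choice of \<open>s\<close>\<close>

abbreviation uniform :: "'w set \<Rightarrow> 'w \<Rightarrow> real" where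
  "uniform A \<equiv> \<lambda>_. 1 / real (card A)"

lemma distribution_uniform: "finite A \<Longrightarrow> A \<noteq> {} \<Longrightarrow> distribution A (uniform A)"
  unfolding distribution_def by (simp add: card_gt_0_iff)

lemma mass_uniform: "mass A (uniform A) {f} x = real (card {y \<in> A. f x = f y}) / real (card A)"
  unfolding mass_def agree_def by simp

text \<open>Every point has mass at most \<open>2 ^ m / card A\<close>, and entropy is the mean of
  the negative logarithm of the mass.\<close>

lemma entropy_uniform_ge:
  assumes A: "finite A" "A \<noteq> {}" and fibre: "\<And>v. card {y \<in> A. f y = v} \<le> 2 ^ m"
  shows "log 2 (real (card A)) - real m \<le> entropy A (uniform A) {f}"
proof -
  have pos: "0 < real (card A)" using A by (simp add: card_gt_0_iff)
  have le: "log 2 (mass A (uniform A) {f} x) \<le> real m - log 2 (real (card A))" if x: "x \<in> A" for x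
  proof -
    have "{y \<in> A. f x = f y} = {y \<in> A. f y = f x}" by auto
    then have "real (card {y \<in> A. f x = f y}) \<le> real (2 ^ m)"
      using fibre[of "f x"] by (simp only: of_nat_le_iff)
    then have "mass A (uniform A) {f} x \<le> 2 ^ m / real (card A)"
      unfolding mass_uniform using pos by (intro divide_right_mono) simp_all
    then have "log 2 (mass A (uniform A) {f} x) \<le> log 2 (2 ^ m / real (card A))"
      using mass_pos[OF distribution_uniform[OF A] x] pos by (intro log_mono) auto
    also have "\<dots> = real m - log 2 (real (card A))"
      using pos by (simp add: log_divide log_nat_power)
    finally show ?thesis .
  qed
  have "(\<Sum>x\<in>A. uniform A x * log 2 (mass A (uniform A) {f} x))
      \<le> (\<Sum>x\<in>A. uniform A x * (real m - log 2 (real (card A))))"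
    by (intro sum_mono mult_left_mono le) auto
  also have "\<dots> = real m - log 2 (real (card A))" using pos by simp
  finally show ?thesis unfolding entropy_def by simp
qed

text \<open>Gibbs' inequality against the uniform distribution on the values: the quotients of
  weight and mass sum to one on each fibre, hence to the number of values.\<close>

lemma entropy_le_log_card:
  assumes dist: "distribution A w"
  shows "entropy A w {f} \<le> log 2 (real (card (f ` A)))"
proof -
  let ?m = "mass A w {f}" and ?N = "real (card (f ` A))"
  have fin: "finite A" and w1: "sum w A = 1" and wpos: "\<And>x. x \<in> A \<Longrightarrow> 0 < w x"
    using dist unfolding distribution_def by auto
  have ne: "A \<noteq> {}" using w1 by auto
  then have N: "0 < ?N" using fin by (simp add: card_gt_0_iff)
  have "(\<Sum>x\<in>A. w x / ?m x) = (\<Sum>v\<in>f ` A. \<Sum>x\<in>{x\<in>A. f x = v}. w x / ?m x)"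
    by (rule sum.group[symmetric, OF fin finite_imageI[OF fin]]) simp
  also have "\<dots> = (\<Sum>v\<in>f ` A. 1)"
  proof (rule sum.cong[OF refl])
    fix v assume "v \<in> f ` A"
    then obtain x0 where x0: "x0 \<in> A" "f x0 = v" by blast
    have m: "?m x = (\<Sum>x\<in>{x\<in>A. f x = v}. w x)" if "f x = v" for x
      unfolding mass_def agree_def using that by (intro sum.cong) auto
    have "(\<Sum>x\<in>{x\<in>A. f x = v}. w x / ?m x) = (\<Sum>x\<in>{x\<in>A. f x = v}. w x / ?m x0)"
      by (intro sum.cong refl) (simp add: m x0(2))
    also have "\<dots> = ?m x0 / ?m x0"
      by (simp only: m[OF x0(2)] sum_divide_distrib)
    also have "\<dots> = 1" using mass_pos[OF dist x0(1), of "{f}"] by simp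
    finally show "(\<Sum>x\<in>{x\<in>A. f x = v}. w x / ?m x) = 1" .
  qed
  finally have inv: "(\<Sum>x\<in>A. w x / ?m x) = ?N" by simp
  have "entropy A w {f} - log 2 ?N = (\<Sum>x\<in>A. w x * (- log 2 (?m x) - log 2 ?N))"
    unfolding entropy_def using w1
    by (simp add: right_diff_distrib sum_subtractf sum_negf flip: sum_distrib_right)
  also have "\<dots> \<le> (\<Sum>x\<in>A. w x * ((1 / (?m x * ?N) - 1) / ln 2))"
  proof (intro sum_mono mult_left_mono)
    fix x assume x: "x \<in> A"
    have p: "0 < ?m x" by (rule mass_pos[OF dist x])
    have "- log 2 (?m x) - log 2 ?N = log 2 (1 / (?m x * ?N))"
      using p N by (simp add: log_divide log_mult)
    also have "\<dots> \<le> (1 / (?m x * ?N) - 1) / ln 2"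
      unfolding log_def using p N by (intro divide_right_mono ln_le_minus_one) auto
    finally show "- log 2 (?m x) - log 2 ?N \<le> (1 / (?m x * ?N) - 1) / ln 2" .
    show "0 \<le> w x" using wpos[OF x] by simp
  qed
  also have "\<dots> = ((\<Sum>x\<in>A. w x / ?m x) / ?N - sum w A) / ln 2"
    by (simp add: sum_divide_distrib sum_subtractf[symmetric] diff_divide_distrib right_diff_distrib)
  also have "\<dots> = 0" using inv N w1 by simp
  finally show ?thesis by simp
qed

text \<open>With \<open>q = sqrt (n / f)\<close> both \<open>n / q\<close> and \<open>q * f\<close>
  equal \<open>sqrt (n * f)\<close>, so after division by \<open>s\<close> the terms of
  \<open>I\<close> and \<open>D\<close> each contribute at most
  \<open>B * sqrt (n * f)\<close>.\<close>

lemma sqrt_balance: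
  fixes Q I D B f n :: real
  assumes ineq: "\<And>s::nat. 0 \<le> real s * Q + I + real s * (real s - 1) / 2 * D"
    and pos: "0 < n" "0 < f" "0 \<le> B" and I: "I \<le> B * n" and D: "D \<le> B * f"
  shows "0 \<le> Q + 2 * B * sqrt (n * f)"
proof -
  define q where "q = sqrt (n / f)"
  \<comment> \<open>Rounding up keeps \<open>s\<close> positive even for \<open>n < f\<close>, so
    that division by \<open>s\<close> is possible.\<close>
  define s where "s = nat \<lceil>q\<rceil>"
  have q: "0 < q" using pos unfolding q_def by simp
  have "0 < \<lceil>q\<rceil>" using q by simp
  then have s: "q \<le> real s" "real s - 1 \<le> q" "1 \<le> real s"
    unfolding s_def by (linarith, linarith, simp)
  have nf: "sqrt (n * f) = q * f" "n = q * (q * f)"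
  proof -
    have "q * q = n / f" unfolding q_def using pos by simp
    then show n: "n = q * (q * f)" using pos by (simp add: field_simps)
    have "n * f = (q * f)\<^sup>2" using n by (simp add: power2_eq_square mult_ac)
    then show "sqrt (n * f) = q * f" using q pos by simp
  qed
  have "I \<le> B * (q * f) * real s"
  proof -
    have "I \<le> B * (q * f) * q" using I nf(2) by (simp add: mult_ac)
    also have "\<dots> \<le> B * (q * f) * real s" using s(1) pos q by (intro mult_left_mono) auto
    finally show ?thesis .
  qed
  moreover have "real s * (real s - 1) / 2 * D \<le> real s * (B * (q * f))"
  proof -
    have "(real s - 1) / 2 * D \<le> (real s - 1) / 2 * (B * f)" using D s(3) by (intro mult_left_mono) auto
    also have "\<dots> \<le> q * (B * f)" using s q pos by (intro mult_right_mono) auto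
    finally show ?thesis using mult_left_mono[of "(real s - 1) / 2 * D" "q * (B * f)" "real s"] s(3)
      by (simp add: mult_ac)
  qed
  ultimately have "0 \<le> real s * (Q + 2 * B * (q * f))"
  proof -
    assume *: "I \<le> B * (q * f) * real s" "real s * (real s - 1) / 2 * D \<le> real s * (B * (q * f))"
    have "real s * (Q + 2 * B * (q * f)) = real s * Q + B * (q * f) * real s + real s * (B * (q * f))"
      by (simp add: algebra_simps)
    then show ?thesis using ineq[of s] * by linarith
  qed
  then show ?thesis using s(3) unfolding nf(1) by (simp add: zero_le_mult_iff)
qed

section \<open>Transfer from entropy to complexity\<close>

lemma computable_list_encode_map:
  assumes "\<And>i. i \<in> set is \<Longrightarrow> computable n (f i)"
  shows "computable n (\<lambda>xs. list_encode (map (\<lambda>i. f i xs) is))"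
  using assms
proof (induction "is")
  case Nil
  then show ?case by (simp add: computable_const)
next
  case (Cons i "is")
  have "computable n (f i)" "computable n (\<lambda>xs. list_encode (map (\<lambda>i. f i xs) is))"
    using Cons by simp_all
  then show ?case
    unfolding list.map list_encode.simps prod_encode_def triangle_def prod.case
    by (intro computable_intros)
qed

text \<open>Every number is the \<open>list_encode\<close> of some list, so the program granted by
  \<open>tuple_code\<close> computes a total function on numbers, to which composition
  applies.\<close>

lemma computable_code:
  assumes "tuple_code code" and "\<And>i. i \<in> set is \<Longrightarrow> computable n (f i)"
  shows "computable n (\<lambda>xs. string_nat (code (map (\<lambda>i. inv string_nat (f i xs)) is)))"
proof -
  obtain r where r: "\<And>ys. computes r [list_encode (map string_nat ys)] (string_nat (code ys))"
    using assms(1) unfolding tuple_code_def by blast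
  define h where "h v = string_nat (code (map (inv string_nat) (list_decode v)))" for v
  have "computes r xs (h (hd xs))" if len: "length xs = 1" for xs
  proof -
    obtain v where v: "xs = [v]" using len by (cases xs) auto
    show ?thesis using r[of "map (inv string_nat) (list_decode v)"] unfolding h_def v
      by (simp add: comp_def)
  qed
  then have "computable 1 (\<lambda>xs. h (hd xs))" unfolding computable_def by blast
  from computable_app1[OF this computable_list_encode_map[OF assms(2)]]
  show ?thesis unfolding h_def by (simp add: comp_def)
qed

text \<open>A singleton list stands for the string itself, not for the code of a tuple of length one.\<close>

definition tuple_value :: "(bool list list \<Rightarrow> bool list) \<Rightarrow> nat list \<Rightarrow> nat \<Rightarrow> nat" where
  "tuple_value code is z =
     (if length is = 1 then digit z (hd is)
      else string_nat (code (map (\<lambda>i. inv string_nat (digit z i)) is)))"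

definition tuple_complexity ::
    "language \<Rightarrow> (bool list list \<Rightarrow> bool list) \<Rightarrow> bool list list \<Rightarrow> real" where
  "tuple_complexity U code xs = complexity U (if length xs = 1 then hd xs else code xs)"

lemma computable_tuple_value:
  assumes "tuple_code code"
  shows "computable 1 (\<lambda>xs. tuple_value code is (hd xs))"
  unfolding tuple_value_def
  by (cases "length is = 1"; simp only: if_True if_False)
    (intro computable_code[OF assms] computable_digit computable_intros; simp)+

text \<open>All codings are injective. This yields the assumption of \<open>typical_set\<close> that
  the full tuple determines its parts, and it turns the entropy of a single value into a joint
  entropy.\<close>

lemma tuple_value_eq_iff:
  assumes "tuple_code code"
  shows "tuple_value code is z = tuple_value code is z' \<longleftrightarrow> (\<forall>i\<in>set is. digit z i = digit z' i)"
proof (cases "length is = 1")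
  case True
  then obtain i where "is = [i]" by (auto simp: length_Suc_conv)
  then show ?thesis by (simp add: tuple_value_def)
next
  case False
  have inj: "inj code" "inj string_nat" "inj (inv string_nat)"
    using assms bij_string_nat bij_imp_bij_inv by (auto simp: tuple_code_def bij_def)
  show ?thesis using False inj by (auto simp: tuple_value_def inj_eq)
qed

text \<open>A single random vector, uniform on a typical set, approximates all listed subtuples at
  once. The parameter \<open>r\<close> of that set is logarithmic in \<open>n\<close> because the
  complexities are linear in \<open>n\<close>.\<close>

lemma complexity_entropy_approx:
  assumes U: "universal U" and code: "tuple_code code"
    and Ls: "\<And>is. is \<in> set Ls \<Longrightarrow> set is \<subseteq> {..<N}"
  obtains C :: real where "0 < C"
    "\<And>xs n. length xs = N \<Longrightarrow> n = sum_list (map length xs) \<Longrightarrow> 1 \<le> n \<Longrightarrow>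
      \<exists>(\<Omega> :: nat set) w (X :: nat \<Rightarrow> nat \<Rightarrow> nat). distribution \<Omega> w \<and>
        (\<forall>is\<in>set Ls. \<bar>tuple_complexity U code (map ((!) xs) is) - entropy \<Omega> w (X ` set is)\<bar>
             \<le> C * log 2 (real n + 1) \<and>
           tuple_complexity U code (map ((!) xs) is) \<le> C * real n)"
proof -
  define J where "J = Suc (length Ls)"
  \<comment> \<open>Index 0 is reserved for the full tuple, which has to determine all the
    others.\<close>
  define L where "L j = ([0..<N] # Ls) ! j" for j
  define \<pi> where "\<pi> j = tuple_value code (L j)" for j
  let ?K = "nat_complexity U"
  have L: "set (L j) \<subseteq> {..<N}" if "j < J" for j
    using that Ls nth_mem[of "j - 1" Ls] unfolding L_def J_def by (cases j) auto
  have \<pi>: "computable 1 (\<lambda>xs. \<pi> j (hd xs))" for j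
    unfolding \<pi>_def by (rule computable_tuple_value[OF code])
  have "\<pi> j z = \<pi> j z'" if "j < J" "\<pi> 0 z = \<pi> 0 z'" for j z z'
    using that(2) L[OF that(1)] unfolding \<pi>_def tuple_value_eq_iff[OF code] L_def by auto
  from typical_set[where \<pi>=\<pi> and J=J, OF U _ \<pi> this] obtain c where c:
    "\<And>z r. \<forall>j<J. ?K (\<pi> j z) < 2 ^ r \<Longrightarrow>
    (\<exists>(A :: nat set) g m. finite A \<and> A \<noteq> {} \<and>
      2 ^ ?K (\<pi> 0 z) \<le> card A * 2 ^ (c * Suc r) \<and>
      (\<forall>j<J. card ((\<lambda>t. \<pi> j (g t)) ` A) \<le> 2 ^ Suc (?K (\<pi> j z)) \<and>
        m j + ?K (\<pi> j z) \<le> ?K (\<pi> 0 z) + c * Suc r \<and>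
        (\<forall>v. card {t \<in> A. \<pi> j (g t) = v} \<le> 2 ^ m j)))"
    unfolding J_def by blast
  have "\<exists>c. \<forall>j<J. \<forall>w. ?K (\<pi> j w) \<le> string_length w + c"
  proof (rule bounded_stages)
    show "\<forall>j<J. \<exists>c. \<forall>w. ?K (\<pi> j w) \<le> string_length w + c"
    proof (intro allI impI)
      fix j
      \<comment> \<open>With a predicate that always holds the search stops at once, and
        \<open>w\<close> itself is a description of \<open>\<pi> j w\<close>.\<close>
      have "decidable 2 (\<lambda>xs. (\<lambda>w t. True) (hd xs) (hd (tl xs)))"
        unfolding decidable_def by (simp add: computable_const)
      moreover have "computable 2 (\<lambda>xs. (\<lambda>w t. \<pi> j w) (hd xs) (hd (tl xs)))"
        by (intro computable_app1[OF \<pi>] computable_intros) simp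
      ultimately obtain c where c: "\<And>w (t :: nat). True \<Longrightarrow> (\<And>t'. t' < t \<Longrightarrow> \<not> True) \<Longrightarrow>
          ?K (\<pi> j w) \<le> string_length w + c"
        by (rule complexity_search[OF U]) blast
      have "?K (\<pi> j w) \<le> string_length w + c" for w by (rule c[where t=0]) simp_all
      then show "\<exists>c. \<forall>w. ?K (\<pi> j w) \<le> string_length w + c" by blast
    qed
  qed (meson add_left_mono order_trans)
  then obtain c' where c': "\<And>j w. j < J \<Longrightarrow> ?K (\<pi> j w) \<le> string_length w + c'" by blast
  \<comment> \<open>\<open>Suc n \<le> 2 * n\<close> doubles the cost of the digits;
    \<open>c' + 2\<close> covers the additive terms and makes the bound strict.\<close>
  define B where "B = 2 * Suc N + c' + 2"
  \<comment> \<open>The factor 2 reflects the double loss of \<open>E\<close> in the lower bound on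
    entropy, the 1 the extra bit in the size of the images; \<open>B\<close> yields the linear bound
    on complexities.\<close>
  define C where "C = 2 * (real c * (log 2 (real B) + 3)) + 1 + real B"
  have B: "1 \<le> B" unfolding B_def by simp
  then have logB: "0 \<le> log 2 (real B)" by simp
  show ?thesis
  proof (rule that[of C])
    show "0 < C" unfolding C_def using B logB by (intro add_nonneg_pos add_pos_pos mult_nonneg_nonneg) auto
  next
    fix xs :: "bool list list" and n :: nat
    assume xs: "length xs = N" and n: "n = sum_list (map length xs)" "1 \<le> n"
    define ds where "ds = map string_nat xs"
    \<comment> \<open>A string of length at most \<open>n\<close> has a number below
      \<open>2 ^ Suc n\<close>, hence the digit width.\<close>
    define z where "z = pack (Suc n) ds 0"
    have ds: "\<forall>d\<in>set ds. d < 2 ^ Suc n" "length ds = N"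
    proof -
      have "string_nat p < 2 ^ Suc n" if "p \<in> set xs" for p
      proof -
        have "length p \<le> n" unfolding n(1) using that by (intro member_le_sum_list) auto
        then have "(2::nat) ^ Suc (length p) \<le> 2 ^ Suc n" by (intro power_increasing) auto
        then show ?thesis using string_nat_length_bounds(2)[of p] by linarith
      qed
      then show "\<forall>d\<in>set ds. d < 2 ^ Suc n" "length ds = N" unfolding ds_def using xs by auto
    qed
    have digit_z: "digit z i = string_nat (xs ! i)" if "i < N" for i
      using digit_pack[OF ds(1), of i 0] that ds(2) xs unfolding z_def ds_def by simp
    have complexity_z: "?K (\<pi> j z) < B * n" if j: "j < J" for j
    proof -
      have "?K (\<pi> j z) \<le> Suc n * Suc N + 1 + c'"
        using c'[OF j, of z] string_length_pack[OF ds(1), of 0 0] unfolding z_def ds(2) by simp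
      also have "\<dots> < B * n"
      proof -
        have "Suc n * Suc N \<le> (2 * n) * Suc N" using n(2) by (intro mult_right_mono) auto
        moreover have "(c' + 2) * 1 \<le> (c' + 2) * n" using n(2) by (intro mult_left_mono) auto
        ultimately show ?thesis unfolding B_def by (simp add: algebra_simps)
      qed
      finally show ?thesis .
    qed
    have "0 < B * n" using B n(2) by simp
    then obtain r where r: "B * n \<le> 2 ^ r" "2 ^ r \<le> 2 * (B * n)" by (rule exists_power_between)
    have "\<forall>j<J. ?K (\<pi> j z) < 2 ^ r" using complexity_z r(1) by (meson less_le_trans)
    from c[OF this] obtain A :: "nat set" and g m where A: "finite A" "A \<noteq> {}"
      and low: "2 ^ ?K (\<pi> 0 z) \<le> card A * 2 ^ (c * Suc r)"
      and img: "\<And>j. j < J \<Longrightarrow> card ((\<lambda>t. \<pi> j (g t)) ` A) \<le> 2 ^ Suc (?K (\<pi> j z))"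
      and m: "\<And>j. j < J \<Longrightarrow> m j + ?K (\<pi> j z) \<le> ?K (\<pi> 0 z) + c * Suc r"
      and fib: "\<And>j v. j < J \<Longrightarrow> card {t \<in> A. \<pi> j (g t) = v} \<le> 2 ^ m j"
      by blast
    let ?H = "entropy A (uniform A)"
    define E where "E = real (c * Suc r)"
    let ?lam = "log 2 (real n + 1)"
    have lam: "1 \<le> ?lam" using n(2) by (simp add: le_log_iff)
    have E_le: "E \<le> real c * (log 2 (real B) + 3) * ?lam"
    proof -
      have "real r = log 2 (real (2 ^ r))" by (simp add: log_nat_power)
      also have "\<dots> \<le> log 2 (real (2 * (B * n)))"
      proof (rule log_mono)
        show "real (2 ^ r) \<le> real (2 * (B * n))" using r(2) by (simp only: of_nat_le_iff)
      qed simp_all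
      also have "\<dots> = 1 + log 2 (real B) + log 2 (real n)"
        using B n(2) by (simp add: log_mult)
      also have "log 2 (real n) \<le> ?lam" using n(2) by simp
      finally have "real (Suc r) \<le> (2 + log 2 (real B)) * 1 + ?lam" by simp
      also have "\<dots> \<le> (2 + log 2 (real B)) * ?lam + ?lam"
        using lam logB by (intro add_right_mono mult_left_mono) auto
      finally have "real (Suc r) \<le> (log 2 (real B) + 3) * ?lam" by (simp add: algebra_simps)
      then show ?thesis unfolding E_def of_nat_mult mult.assoc by (intro mult_left_mono) auto
    qed
    have C_lam: "max 1 (2 * E) \<le> C * ?lam"
    proof -
      have "1 * 1 \<le> (1 + real B) * ?lam" by (rule mult_mono) (use lam in auto)
      moreover have "0 \<le> real c * (log 2 (real B) + 3) * ?lam" using logB lam by (intro mult_nonneg_nonneg) auto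
      moreover have "C * ?lam = 2 * (real c * (log 2 (real B) + 3) * ?lam) + (1 + real B) * ?lam"
        unfolding C_def by (simp add: algebra_simps)
      moreover have "0 \<le> (1 + real B) * ?lam" using lam by simp
      ultimately show ?thesis using E_le by linarith
    qed
    \<comment> \<open>From above only one bit is lost, through the image size. From below
      \<open>log 2 (card A)\<close> and \<open>m j\<close> are each off by at most
      \<open>E\<close>.\<close>
    have approx: "\<bar>real (?K (\<pi> j z)) - ?H {\<lambda>t. \<pi> j (g t)}\<bar> \<le> C * ?lam" if j: "j < J" for j
    proof -
      have cA: "0 < real (card A)" using A by (simp add: card_gt_0_iff)
      have "?H {\<lambda>t. \<pi> j (g t)} \<le> log 2 (real (card ((\<lambda>t. \<pi> j (g t)) ` A)))"
        by (rule entropy_le_log_card[OF distribution_uniform[OF A]])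
      also have "\<dots> \<le> log 2 (2 ^ Suc (?K (\<pi> j z)))"
      proof (rule log_mono)
        show "0 < real (card ((\<lambda>t. \<pi> j (g t)) ` A))" using A by (simp add: card_gt_0_iff)
        have "real (card ((\<lambda>t. \<pi> j (g t)) ` A)) \<le> real (2 ^ Suc (?K (\<pi> j z)))"
          using img[OF j] by (simp only: of_nat_le_iff)
        then show "real (card ((\<lambda>t. \<pi> j (g t)) ` A)) \<le> 2 ^ Suc (?K (\<pi> j z))" by simp
      qed simp
      also have "\<dots> = real (?K (\<pi> j z)) + 1" by (simp add: log_nat_power del: power_Suc)
      finally have up: "?H {\<lambda>t. \<pi> j (g t)} \<le> real (?K (\<pi> j z)) + 1" .
      have "real (?K (\<pi> 0 z)) = log 2 (real (2 ^ ?K (\<pi> 0 z)))" by (simp add: log_nat_power)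
      also have "\<dots> \<le> log 2 (real (card A * 2 ^ (c * Suc r)))"
        using low by (intro log_mono) (simp_all only: of_nat_le_iff, simp_all)
      also have "\<dots> = log 2 (real (card A)) + E"
        unfolding E_def using cA by (simp add: log_mult log_nat_power del: mult_Suc_right)
      finally have "real (?K (\<pi> 0 z)) \<le> log 2 (real (card A)) + E" .
      moreover have "log 2 (real (card A)) - real (m j) \<le> ?H {\<lambda>t. \<pi> j (g t)}"
        by (rule entropy_uniform_ge[OF A fib[OF j]])
      moreover have "real (m j) + real (?K (\<pi> j z)) \<le> real (?K (\<pi> 0 z)) + E"
        using m[OF j] unfolding E_def by (simp only: of_nat_add[symmetric] of_nat_le_iff)
      ultimately show ?thesis using up C_lam by linarith
    qed
    define X where "X i t = digit (g t) i" for i t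
    have "\<bar>tuple_complexity U code (map ((!) xs) is) - ?H (X ` set is)\<bar> \<le> C * ?lam \<and>
        tuple_complexity U code (map ((!) xs) is) \<le> C * real n" if is_in: "is \<in> set Ls" for "is"
    proof -
      obtain j0 where j0: "j0 < length Ls" "Ls ! j0 = is" using is_in by (metis in_set_conv_nth)
      define j where "j = Suc j0"
      have j: "j < J" "L j = is" using j0 unfolding j_def J_def L_def by simp_all
      have lt: "i < N" if "i \<in> set is" for i using Ls[OF is_in] that by blast
      have "tuple_complexity U code (map ((!) xs) is) = real (?K (\<pi> j z))"
      proof (cases "length is = 1")
        case True
        then obtain i where i: "is = [i]" by (auto simp: length_Suc_conv)
        show ?thesis using digit_z[OF lt[of i]] i
          by (simp add: tuple_complexity_def \<pi>_def j(2) tuple_value_def complexity_eq_nat_complexity)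
      next
        case False
        have eq: "map (\<lambda>i. inv string_nat (digit z i)) is = map ((!) xs) is"
          using digit_z[OF lt] by simp
        show ?thesis unfolding tuple_complexity_def \<pi>_def j(2) tuple_value_def eq
          using False by (simp add: complexity_eq_nat_complexity)
      qed
      moreover have "?H (X ` set is) = ?H {\<lambda>t. \<pi> j (g t)}"
        by (rule entropy_cong) (auto simp: agree_def X_def \<pi>_def j(2) tuple_value_eq_iff[OF code])
      moreover have "real (?K (\<pi> j z)) \<le> C * real n"
      proof -
        have "real (?K (\<pi> j z)) \<le> real B * real n"
          using complexity_z[OF j(1)] by (metis less_imp_le of_nat_le_iff of_nat_mult)
        also have "\<dots> \<le> C * real n"
          unfolding C_def using logB by (intro mult_right_mono) auto
        finally show ?thesis .
      qed
      ultimately show ?thesis using approx[OF j(1)] by simp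
    qed
    then show "\<exists>(\<Omega> :: nat set) w (X :: nat \<Rightarrow> nat \<Rightarrow> nat). distribution \<Omega> w \<and>
        (\<forall>is\<in>set Ls. \<bar>tuple_complexity U code (map ((!) xs) is) - entropy \<Omega> w (X ` set is)\<bar>
             \<le> C * ?lam \<and> tuple_complexity U code (map ((!) xs) is) \<le> C * real n)"
      using distribution_uniform[OF A] by blast
  qed
qed

lemma log_le_self: "1 \<le> n \<Longrightarrow> log 2 (real n + 1) \<le> real n"
proof -
  have "Suc n \<le> 2 ^ n" by (simp add: Suc_le_eq)
  then have "real (Suc n) \<le> real (2 ^ n)" by (simp only: of_nat_le_iff)
  then have "log 2 (real (Suc n)) \<le> log 2 (real (2 ^ n))" by (intro log_mono) auto
  then show ?thesis by (simp add: log_nat_power add.commute)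
qed

theorem theorem9:
  fixes U :: language
    and code :: "bool list list \<Rightarrow> bool list"
    and f :: "nat \<Rightarrow> real"
  assumes "universal U"
    and "tuple_code code"
    and "\<forall>n\<ge>1. f n \<ge> log 2 (real n)"
  shows "\<exists>\<theta>>0. \<forall>a b c d e. \<forall>n.
    n = length a + length b + length c + length d + length e \<and> real n * f n > 0 \<longrightarrow>
      (cond_mutual_info U code a d c \<le> f n \<and> cond_mutual_info U code a c d \<le> f n \<longrightarrow>
         ingleton_box U code a b c d + cond_mutual_info U code a c e + cond_mutual_info U code a e c
           + \<theta> * sqrt (real n * f n) \<ge> 0) \<and>
      (cond_mutual_info U code b c d \<le> f n \<and> cond_mutual_info U code c d b \<le> f n \<longrightarrow>
         ingleton_box U code a b c d + cond_mutual_info U code b c e + cond_mutual_info U code c e b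
           + \<theta> * sqrt (real n * f n) \<ge> 0) \<and>
      (cond_mutual_info U code b c d \<le> f n \<and> cond_mutual_info U code c d b \<le> f n \<longrightarrow>
         ingleton_box U code a b c d + cond_mutual_info U code c d e + cond_mutual_info U code c e d
           + \<theta> * sqrt (real n * f n) \<ge> 0)"
proof -
  \<comment> \<open>Every quantity in the claim involves one, two or three strings. All orders and
    repetitions are listed: the code depends on the order, the entropy only on the set, so
    permutations are absorbed by the approximation.\<close>
  define Ls where "Ls = List.n_lists 1 [0..<5] @ List.n_lists 2 [0..<5] @ List.n_lists 3 [0..<5]"
  have Ls: "is \<in> set Ls \<longleftrightarrow> length is \<in> {1, 2, 3} \<and> set is \<subseteq> {..<5}" for "is"
    unfolding Ls_def set_append set_n_lists by auto
  obtain C where C: "0 < C" and approx: "\<And>xs n. length xs = 5 \<Longrightarrow> n = sum_list (map length xs) \<Longrightarrow> 1 \<le> n \<Longrightarrow>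
      \<exists>(\<Omega> :: nat set) w (X :: nat \<Rightarrow> nat \<Rightarrow> nat). distribution \<Omega> w \<and>
        (\<forall>is\<in>set Ls. \<bar>tuple_complexity U code (map ((!) xs) is) - entropy \<Omega> w (X ` set is)\<bar>
             \<le> C * log 2 (real n + 1) \<and>
           tuple_complexity U code (map ((!) xs) is) \<le> C * real n)"
    by (rule complexity_entropy_approx[OF assms(1,2), of Ls 5]) (use Ls in blast)+
  \<comment> \<open>For \<open>n \<ge> 2\<close> one has
    \<open>log 2 (n + 1) \<le> 2 * log 2 n\<close>. At \<open>n = 1\<close> the hypothesis gives
    only \<open>f 1 \<ge> 0\<close>, hence the quotient; if \<open>f 1 = 0\<close> it is 0 by
    convention, and that case is excluded by \<open>n * f n > 0\<close>.\<close>
  define M where "M = max 2 (1 / f 1)"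
  \<comment> \<open>\<open>6 * C\<close> is the bound \<open>2 * C\<close> for \<open>I\<close> plus
    its error \<open>4 * \<delta>\<close>; \<open>2 + 8 * C * M\<close> is for two hypotheses with
    error \<open>4 * \<delta>\<close> each. In \<open>\<theta>\<close>, 22 = 14 + 4 + 4 adds the
    errors of the box and of the two other terms.\<close>
  define B where "B = 6 * C + (2 + 8 * C * M)"
  define \<theta> where "\<theta> = 2 * B + 22 * C * M"
  have M: "2 \<le> M" unfolding M_def by simp
  have B: "0 < B" unfolding B_def using C M by (intro add_pos_pos mult_pos_pos) auto
  have \<theta>: "0 < \<theta>" unfolding \<theta>_def using B C M by (intro add_pos_pos mult_pos_pos) auto
  have log_f: "log 2 (real n + 1) \<le> M * f n" if n: "1 \<le> n" "0 < f n" for n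
  proof (cases "n = 1")
    case True
    have "1 / f 1 * f 1 \<le> M * f 1" unfolding M_def using n True by (intro mult_right_mono) auto
    then show ?thesis using True n by simp
  next
    case False
    have "log 2 (real n + 1) \<le> log 2 ((real n)\<^sup>2)"
    proof (rule log_mono)
      have "2 * real n \<le> real n * real n" using False n(1) by (intro mult_right_mono) auto
      moreover have "1 \<le> real n" using n(1) by simp
      ultimately show "real n + 1 \<le> (real n)\<^sup>2" unfolding power2_eq_square by linarith
    qed (use n in auto)
    also have "\<dots> = 2 * log 2 (real n)" using n(1) by (simp add: log_nat_power)
    also have "\<dots> \<le> 2 * f n" using assms(3) n(1) by simp
    also have "\<dots> \<le> M * f n" using M n(2) by (intro mult_right_mono) auto
    finally show ?thesis .
  qed
  show ?thesis
  proof (intro exI[of _ \<theta>] conjI[OF \<theta>] allI impI)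
    fix a b c d e :: "bool list" and n
    assume "n = length a + length b + length c + length d + length e \<and> real n * f n > 0"
    then have n: "n = sum_list (map length [a, b, c, d, e])" and nf: "real n * f n > 0"
      by (simp, blast)
    have n1: "1 \<le> n" using nf by (cases n) auto
    then have f: "0 < f n" using nf by (simp add: zero_less_mult_iff)
    define v where "v = (!) [a, b, c, d, e]"
    have v: "a = v 0" "b = v 1" "c = v 2" "d = v 3" "e = v 4" unfolding v_def by simp_all
    obtain \<Omega> :: "nat set" and w and X :: "nat \<Rightarrow> nat \<Rightarrow> nat" where dist: "distribution \<Omega> w"
      and ap: "\<And>is. is \<in> set Ls \<Longrightarrow> \<bar>tuple_complexity U code (map v is) - entropy \<Omega> w (X ` set is)\<bar>
             \<le> C * log 2 (real n + 1)"
      and le: "\<And>is. is \<in> set Ls \<Longrightarrow> tuple_complexity U code (map v is) \<le> C * real n"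
      using approx[OF _ n n1] unfolding v_def by auto
    define h :: "(nat \<Rightarrow> nat) set \<Rightarrow> real" where "h = entropy \<Omega> w"
    define \<delta> where "\<delta> = C * log 2 (real n + 1)"
    have ap1: "\<bar>complexity U (v i) - h {X i}\<bar> \<le> \<delta>" if "i < 5" for i
      using ap[of "[i]"] that by (simp add: Ls tuple_complexity_def h_def \<delta>_def)
    have ap2: "\<bar>complexity U (code [v i, v j]) - h {X i, X j}\<bar> \<le> \<delta>" if "i < 5" "j < 5" for i j
      using ap[of "[i, j]"] that by (simp add: Ls tuple_complexity_def h_def \<delta>_def)
    have ap3: "\<bar>complexity U (code [v i, v j, v k]) - h {X i, X j, X k}\<bar> \<le> \<delta>"
      if "i < 5" "j < 5" "k < 5" for i j k
      using ap[of "[i, j, k]"] that by (simp add: Ls tuple_complexity_def h_def \<delta>_def)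
    have ci: "\<bar>cond_mutual_info U code (v i) (v j) (v k) - cond_info h (X i) (X j) (X k)\<bar> \<le> 4 * \<delta>"
      if "i < 5" "j < 5" "k < 5" for i j k
      unfolding cond_mutual_info_def cond_info_def
      using ap1[OF that(3)] ap2[OF that(1,3)] ap2[OF that(2,3)] ap3[OF that] by linarith
    have mi: "\<bar>mutual_info U code (v i) (v j) - info h (X i) (X j)\<bar> \<le> 3 * \<delta>"
      if "i < 5" "j < 5" for i j
      unfolding mutual_info_def info_def using ap1[OF that(1)] ap1[OF that(2)] ap2[OF that] by linarith
    have box: "\<bar>ingleton_box U code a b c d - ingleton h (X 0) (X 1) (X 2) (X 3)\<bar> \<le> 14 * \<delta>"
      unfolding ingleton_box_def ingleton_def v
      using ci[of 2 3 0] ci[of 2 3 1] mi[of 0 1] mi[of 2 3] by simp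
    \<comment> \<open>This term will be divided by \<open>s\<close>, so the trivial linear bound is
      enough: the subtracted complexities are dropped.\<close>
    have bound: "cond_mutual_info U code (v i) (v j) (v k) \<le> 2 * C * real n"
      if "i < 5" "j < 5" "k < 5" for i j k
    proof -
      have "complexity U (code [v i, v k]) \<le> C * real n" "complexity U (code [v j, v k]) \<le> C * real n"
        using le[of "[i, k]"] le[of "[j, k]"] that by (simp_all add: Ls tuple_complexity_def)
      moreover have "0 \<le> complexity U (code [v i, v j, v k])" "0 \<le> complexity U (v k)"
        unfolding complexity_def by simp_all
      ultimately show ?thesis unfolding cond_mutual_info_def by linarith
    qed
    have \<delta>_n: "\<delta> \<le> C * real n" unfolding \<delta>_def using log_le_self[OF n1] C by simp
    have \<delta>_f: "\<delta> \<le> C * M * f n" unfolding \<delta>_def using log_f[OF n1 f] C by simp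
    \<comment> \<open>The logarithm is at most \<open>n\<close> and at most \<open>M * f n\<close>,
      hence at most the geometric mean of the two.\<close>
    have \<delta>_sqrt: "\<delta> \<le> C * M * sqrt (real n * f n)"
    proof -
      have l0: "0 \<le> log 2 (real n + 1)" by simp
      have "(log 2 (real n + 1))\<^sup>2 \<le> real n * (M * f n)"
        unfolding power2_eq_square using log_le_self[OF n1] log_f[OF n1 f] l0 by (intro mult_mono) auto
      also have "\<dots> \<le> M\<^sup>2 * (real n * f n)"
        using M nf mult_right_mono[of 1 M "M * (real n * f n)"] by (simp add: power2_eq_square mult_ac)
      finally have "log 2 (real n + 1) \<le> sqrt (M\<^sup>2 * (real n * f n))"
        by (rule real_le_rsqrt)
      also have "\<dots> = M * sqrt (real n * f n)" using M by (simp add: real_sqrt_mult)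
      finally show ?thesis unfolding \<delta>_def using C by simp
    qed
    \<comment> \<open>\<open>Q\<close>, \<open>I\<close> and \<open>D\<close> are entropy
      expressions, \<open>Q'\<close> is the counterpart of \<open>Q\<close> for strings; the
      inequality for all \<open>s\<close> is used on the entropy side, and the error is paid once
      afterwards.\<close>
    have conclude: "0 \<le> Q' + \<theta> * sqrt (real n * f n)"
      if ineq: "\<And>s::nat. 0 \<le> real s * Q + I + real s * (real s - 1) / 2 * D"
        and I: "I \<le> 2 * C * real n + 4 * \<delta>" and D: "D \<le> 2 * f n + 8 * \<delta>" and Q: "Q \<le> Q' + 22 * \<delta>"
      for Q Q' I D
    proof -
      have "0 \<le> Q + 2 * B * sqrt (real n * f n)"
      proof (rule sqrt_balance[OF ineq])
        have "0 \<le> (2 + 8 * C * M) * real n" using C M by (intro mult_nonneg_nonneg add_nonneg_nonneg) auto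
        then show "I \<le> B * real n" using I \<delta>_n unfolding B_def by (simp add: algebra_simps)
        have "0 \<le> 6 * C * f n" using C f by simp
        then show "D \<le> B * f n" using D \<delta>_f unfolding B_def by (simp add: algebra_simps)
      qed (use n1 f B in auto)
      then show ?thesis using Q \<delta>_sqrt unfolding \<theta>_def by (simp add: algebra_simps)
    qed
    show "(cond_mutual_info U code a d c \<le> f n \<and> cond_mutual_info U code a c d \<le> f n \<longrightarrow>
         ingleton_box U code a b c d + cond_mutual_info U code a c e + cond_mutual_info U code a e c
           + \<theta> * sqrt (real n * f n) \<ge> 0) \<and>
      (cond_mutual_info U code b c d \<le> f n \<and> cond_mutual_info U code c d b \<le> f n \<longrightarrow>
         ingleton_box U code a b c d + cond_mutual_info U code b c e + cond_mutual_info U code c e b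
           + \<theta> * sqrt (real n * f n) \<ge> 0) \<and>
      (cond_mutual_info U code b c d \<le> f n \<and> cond_mutual_info U code c d b \<le> f n \<longrightarrow>
         ingleton_box U code a b c d + cond_mutual_info U code c d e + cond_mutual_info U code c e d
           + \<theta> * sqrt (real n * f n) \<ge> 0)"
    proof (intro conjI impI; elim conjE)
      assume "cond_mutual_info U code a d c \<le> f n" "cond_mutual_info U code a c d \<le> f n"
      then show "0 \<le> ingleton_box U code a b c d + cond_mutual_info U code a c e
          + cond_mutual_info U code a e c + \<theta> * sqrt (real n * f n)"
        using box ci[of 0 2 4] ci[of 0 4 2] ci[of 2 4 0] ci[of 0 3 2] ci[of 0 2 3] bound[of 2 4 0]
        by (intro conclude[OF matus_1[OF dist, of _ "X 0" "X 1" "X 2" "X 3" "X 4", folded h_def]])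
          (simp_all add: v)
    next
      assume "cond_mutual_info U code b c d \<le> f n" "cond_mutual_info U code c d b \<le> f n"
      then show "0 \<le> ingleton_box U code a b c d + cond_mutual_info U code b c e
          + cond_mutual_info U code c e b + \<theta> * sqrt (real n * f n)"
        using box ci[of 1 2 4] ci[of 2 4 1] ci[of 1 4 2] ci[of 1 2 3] ci[of 2 3 1] bound[of 1 4 2]
        by (intro conclude[OF matus_23(1)[OF dist, of _ "X 0" "X 1" "X 2" "X 3" "X 4", folded h_def]])
          (simp_all add: v)
    next
      assume "cond_mutual_info U code b c d \<le> f n" "cond_mutual_info U code c d b \<le> f n"
      then show "0 \<le> ingleton_box U code a b c d + cond_mutual_info U code c d e
          + cond_mutual_info U code c e d + \<theta> * sqrt (real n * f n)"
        using box ci[of 2 3 4] ci[of 2 4 3] ci[of 3 4 2] ci[of 1 2 3] ci[of 2 3 1] bound[of 3 4 2]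
        by (intro conclude[OF matus_23(2)[OF dist, of _ "X 0" "X 1" "X 2" "X 3" "X 4", folded h_def]])
          (simp_all add: v)
    qed
  qed
qed

end
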